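(* Let $\{Y_t\}_{t\in\mathbb Z}$ be an $\mathbb R^p$-valued random sequence generated from a stable VAR($d$) model $$Y_t=A_1Y_{t-1}+\dots+A_dY_{t-d}+E_t,$$ where $A_1,\dots,A_d\in\mathbb R^{p\times p}$ and $\{E_t\}_{t\in\mathbb Z}$ is a sequence of independent random vectors such that $\|u^{\mathsf T}E_t\|_{\psi_2}\le c'\|u^{\mathsf T}E_t\|_{L(2)}$ for all $t\in\mathbb Z$, $u\in\mathbb R^p$ and some universal constant $c'>0$. Assume $\sup_{t\in\mathbb Z}\sup_{u\in\mathbb S^{p-1}}\|u^{\mathsf T}E_t\|_{\psi_2}<D_1$ for some universal constant $0<D_1<\infty$, $\|A_k\|\le a_k<1$ for all $1\le k\le d$, and $\sum_{k=1}^da_k<1$, where $a_1,\dots,a_d$ and $d$ are universal constants. Let $$\bar A:=\begin{bmatrix}a_1&a_2&\cdots&a_{d-1}&a_d\\1&0&\cdots&0&0\\ \vdots&&\ddots&&\vdots\\0&0&\cdots&1&0\end{bmatrix}\in\mathbb R^{d\times d},$$ and let $\rho_1$ be a universal constant with $\rho(\bar A)<\rho_1<1$, where $\rho(\bar A)$ is the spectral radius (such $\rho_1$ exists because $\sum_ka_k<1$). Then $\{Y_t\}_{t\in\mathbb Z}$ satisfies Assumptions (A1)--(A4) of the context with $$\gamma_1=C\,\frac{\kappa_*}{\kappa_1}\Big(\frac{\|\bar A\|}{\rho_1}\Big)^K,\quad\gamma_2=\log(\rho_1^{-1}),\quad\gamma_3=C'd\Big(\frac{\|\bar A\|}{\rho_1}\Big)^K,\quad\gamma_4=\log(\rho_1^{-1}),$$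 where $K$ is some constant depending only on $\rho_1$, and $C,C'>0$ are some constants depending only on $\epsilon$.
   Context: Notation. $\|\cdot\|$ is the spectral norm of matrices, $\|\cdot\|_2$ the Euclidean norm of vectors. For a real random variable $X$: $\|X\|_{L(q)}:=(\mathbb E|X|^q)^{1/q}$ and $\|X\|_{\psi_2}:=\inf\{k\in(0,\infty):\mathbb E[\exp\{(|X|/k)^2\}-1]\le1\}$. $\mathbb S^{p-1}:=\{x\in\mathbb R^p:\|x\|_2=1\}$, $\bar{\mathbb S}^{p-1}:=\{x\in\mathbb R^p:|x_1|=\dots=|x_p|=1\}$. "Stable" means that $Y_t$ is the causal (infinite moving average in $E_t,E_{t-1},\dots$) solution of the recursion; e.g. for $d=1$, $Y_t=\sum_{j\ge0}A_1^jE_{t-j}$. (A1) $\kappa_1:=\sup_{t\in\mathbb Z}\sup_{u\in\mathbb S^{p-1}}\|u^{\mathsf T}Y_t\|_{\psi_2}<\infty$ and $\kappa_*:=\sup_{t\in\mathbb Z}\sup_{v\in\bar{\mathbb S}^{p-1}}\|v^{\mathsf T}Y_t\|_{\psi_2}<\infty$. (A2) (with constants $\gamma_1,\gamma_2,\epsilon>0$) For any integer $j$ there is a sequence of random vectors $\{\tilde Y_t\}_{t>j}$ which is independent of $\sigma(\{Y_t\}_{t\le j})$, identically distributed as $\{Y_t\}_{t>j}$, and for any integer $k\ge j+1$, $\big\|\,\|Y_k-\tilde Y_k\|_2\,\big\|_{L(1+\epsilon)}\le\gamma_1\kappa_1\exp\{-\gamma_2(k-j-1)\}$. (A3) (with constants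 $\gamma_3,\gamma_4,\epsilon>0$) For any integer $j$ there is a sequence of random vectors $\{\tilde Y_t\}_{t>j}$ which is independent of $\sigma(\{Y_t\}_{t\le j})$, identically distributed as $\{Y_t\}_{t>j}$, and for any integer $k\ge j+1$, $\sup_{u\in\mathbb S^{p-1}}\|(Y_k-\tilde Y_k)^{\mathsf T}u\|_{L(1+\epsilon)}\le\gamma_3\kappa_1\exp\{-\gamma_4(k-j-1)\}$. (A4) There is a universal constant $c>0$ such that for all $t\in\mathbb Z$ and all $u\in\mathbb R^p$, $\|u^{\mathsf T}Y_t\|_{\psi_2}^2\le c\,\mathbb E(u^{\mathsf T}Y_t)^2$. Here $\epsilon>0$ is arbitrary, the same in (A2) and (A3).
   Formalization: (A4) is proved only for mean-zero Y_t, as it can fail without centring; the copies in (A2) and (A3) live on an enlargement of the probability space, as the original may lack spare randomness; (A2) is asserted when κ_1 is nonzero, so that γ_1 is defined. *)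

theory Defs
  imports "HOL-Probability.Probability" "Jordan_Normal_Form.Spectral_Radius"
begin

text \<open>
  Constants that must not depend on the dimension \<open>p\<close> are quantified outside of \<open>p\<close>, so
  \<open>p\<close> has to be a term and not a type. A vector of \<open>\<real>\<^sup>p\<close> is a function
  \<open>nat \<Rightarrow> real\<close> read at the indices \<open>i < p\<close> (the paper's \<open>x\<^sub>1, \<dots>, x\<^sub>p\<close>),
  a random vector is a measurable map into the product space \<open>Rp p\<close>, and matrices are those of
  Jordan_Normal_Form.
\<close>

abbreviation Rp :: "nat \<Rightarrow> (nat \<Rightarrow> real) measure" where
  "Rp p \<equiv> PiM {..<p} (\<lambda>_. borel)"

definition dotp :: "nat \<Rightarrow> (nat \<Rightarrow> real) \<Rightarrow> (nat \<Rightarrow> real) \<Rightarrow> real" where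
  "dotp p u x = (\<Sum>i<p. u i * x i)"

abbreviation norm2 :: "nat \<Rightarrow> (nat \<Rightarrow> real) \<Rightarrow> real" where
  "norm2 p x \<equiv> L2_set x {..<p}"

definition unit_sphere :: "nat \<Rightarrow> (nat \<Rightarrow> real) set" where
  "unit_sphere p = {u. norm2 p u = 1}"

definition sign_sphere :: "nat \<Rightarrow> (nat \<Rightarrow> real) set" where
  "sign_sphere p = {v. \<forall>i<p. \<bar>v i\<bar> = 1}"

definition mat_app :: "real mat \<Rightarrow> (nat \<Rightarrow> real) \<Rightarrow> (nat \<Rightarrow> real)" where
  "mat_app A x = (\<lambda>i. \<Sum>l<dim_col A. A $$ (i, l) * x l)"

definition spectral_norm :: "real mat \<Rightarrow> real" where
  "spectral_norm A = (SUP x\<in>unit_sphere (dim_col A). norm2 (dim_row A) (mat_app A x))"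

text \<open>
  Both norms take values in \<open>[0,\<infinity>]\<close>; the infimum of the empty set is \<open>\<infinity>\<close>.
\<close>

definition L_norm :: "'w measure \<Rightarrow> real \<Rightarrow> ('w \<Rightarrow> real) \<Rightarrow> ennreal" where
  "L_norm M q X =
     (let I = (\<integral>\<^sup>+ \<omega>. ennreal (\<bar>X \<omega>\<bar> powr q) \<partial>M)
      in if I = \<infinity> then \<infinity> else ennreal (enn2real I powr (1 / q)))"

definition psi2_norm :: "'w measure \<Rightarrow> ('w \<Rightarrow> real) \<Rightarrow> ennreal" where
  "psi2_norm M X =
     (INF k\<in>{k. 0 < k \<and> (\<integral>\<^sup>+ \<omega>. ennreal (exp ((\<bar>X \<omega>\<bar> / k)\<^sup>2) - 1) \<partial>M) \<le> 1}. ennreal k)"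

definition kappa1 :: "'w measure \<Rightarrow> nat \<Rightarrow> (int \<Rightarrow> 'w \<Rightarrow> nat \<Rightarrow> real) \<Rightarrow> ennreal" where
  "kappa1 M p Y = (SUP t. SUP u\<in>unit_sphere p. psi2_norm M (\<lambda>\<omega>. dotp p u (Y t \<omega>)))"

definition kappa_star :: "'w measure \<Rightarrow> nat \<Rightarrow> (int \<Rightarrow> 'w \<Rightarrow> nat \<Rightarrow> real) \<Rightarrow> ennreal" where
  "kappa_star M p Y = (SUP t. SUP v\<in>sign_sphere p. psi2_norm M (\<lambda>\<omega>. dotp p v (Y t \<omega>)))"

definition assumption_A1 :: "'w measure \<Rightarrow> nat \<Rightarrow> (int \<Rightarrow> 'w \<Rightarrow> nat \<Rightarrow> real) \<Rightarrow> bool" where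
  "assumption_A1 M p Y \<longleftrightarrow> kappa1 M p Y < \<infinity> \<and> kappa_star M p Y < \<infinity>"

definition path_space :: "nat \<Rightarrow> int set \<Rightarrow> (int \<Rightarrow> nat \<Rightarrow> real) measure" where
  "path_space p T = PiM T (\<lambda>_. Rp p)"

definition path :: "int set \<Rightarrow> (int \<Rightarrow> 'w \<Rightarrow> nat \<Rightarrow> real) \<Rightarrow> 'w \<Rightarrow> (int \<Rightarrow> nat \<Rightarrow> real)" where
  "path T Y \<omega> = (\<lambda>t\<in>T. Y t \<omega>)"

text \<open>
  The sequence \<open>{Y'\<^sub>t}\<^bsub>t>j\<^esub>\<close> needs randomness that \<open>M\<close> itself may not carry (for
  instance if \<open>M\<close> is generated by \<open>{Y\<^sub>t}\<^bsub>t\<le>j\<^esub>\<close>). As usual for couplings it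
  therefore lives on an enlargement \<open>M \<Otimes>\<^sub>M N\<close> of the probability space by an auxiliary
  probability space \<open>N\<close>, on which \<open>Y t\<close> is read as \<open>\<lambda>\<omega>. Y t (fst \<omega>)\<close>.
\<close>

definition independent_future_copy ::
  "'w measure \<Rightarrow> nat \<Rightarrow> (int \<Rightarrow> 'w \<Rightarrow> nat \<Rightarrow> real) \<Rightarrow> int \<Rightarrow> 'v measure \<Rightarrow>
     (int \<Rightarrow> 'w \<times> 'v \<Rightarrow> nat \<Rightarrow> real) \<Rightarrow> bool" where
  "independent_future_copy M p Y j N Y' \<longleftrightarrow>
     prob_space N \<and>
     (\<forall>t>j. Y' t \<in> M \<Otimes>\<^sub>M N \<rightarrow>\<^sub>M Rp p) \<and>
     prob_space.indep_var (M \<Otimes>\<^sub>M N)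
       (path_space p {..j}) (path {..j} (\<lambda>t \<omega>. Y t (fst \<omega>)))
       (path_space p {j<..}) (path {j<..} Y') \<and>
     distr (M \<Otimes>\<^sub>M N) (path_space p {j<..}) (path {j<..} Y') =
       distr M (path_space p {j<..}) (path {j<..} Y)"

text \<open>
  In the next two definitions the auxiliary space consists of \<open>\<real>\<^sup>p\<close>-valued paths.
\<close>

definition assumption_A2 ::
  "'w measure \<Rightarrow> nat \<Rightarrow> (int \<Rightarrow> 'w \<Rightarrow> nat \<Rightarrow> real) \<Rightarrow> real \<Rightarrow> real \<Rightarrow> real \<Rightarrow> bool" where
  "assumption_A2 M p Y \<gamma>1 \<gamma>2 \<epsilon> \<longleftrightarrow>
     \<gamma>1 > 0 \<and> \<gamma>2 > 0 \<and> \<epsilon> > 0 \<and>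
     (\<forall>j. \<exists>(N :: (int \<Rightarrow> nat \<Rightarrow> real) measure) Y'.
        independent_future_copy M p Y j N Y' \<and>
        (\<forall>k\<ge>j + 1.
           L_norm (M \<Otimes>\<^sub>M N) (1 + \<epsilon>) (\<lambda>\<omega>. norm2 p (\<lambda>i. Y k (fst \<omega>) i - Y' k \<omega> i))
             \<le> ennreal \<gamma>1 * kappa1 M p Y * ennreal (exp (- \<gamma>2 * real_of_int (k - j - 1)))))"

definition assumption_A3 ::
  "'w measure \<Rightarrow> nat \<Rightarrow> (int \<Rightarrow> 'w \<Rightarrow> nat \<Rightarrow> real) \<Rightarrow> real \<Rightarrow> real \<Rightarrow> real \<Rightarrow> bool" where
  "assumption_A3 M p Y \<gamma>3 \<gamma>4 \<epsilon> \<longleftrightarrow>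
     \<gamma>3 > 0 \<and> \<gamma>4 > 0 \<and> \<epsilon> > 0 \<and>
     (\<forall>j. \<exists>(N :: (int \<Rightarrow> nat \<Rightarrow> real) measure) Y'.
        independent_future_copy M p Y j N Y' \<and>
        (\<forall>k\<ge>j + 1.
           (SUP u\<in>unit_sphere p.
              L_norm (M \<Otimes>\<^sub>M N) (1 + \<epsilon>) (\<lambda>\<omega>. dotp p (\<lambda>i. Y k (fst \<omega>) i - Y' k \<omega> i) u))
             \<le> ennreal \<gamma>3 * kappa1 M p Y * ennreal (exp (- \<gamma>4 * real_of_int (k - j - 1)))))"

definition assumption_A4 ::
  "'w measure \<Rightarrow> nat \<Rightarrow> (int \<Rightarrow> 'w \<Rightarrow> nat \<Rightarrow> real) \<Rightarrow> real \<Rightarrow> bool" where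
  "assumption_A4 M p Y c \<longleftrightarrow>
     (\<forall>t u. (psi2_norm M (\<lambda>\<omega>. dotp p u (Y t \<omega>)))\<^sup>2
              \<le> ennreal c * (\<integral>\<^sup>+ \<omega>. ennreal ((dotp p u (Y t \<omega>))\<^sup>2) \<partial>M))"

text \<open>
  The matrix coefficients of the power series
  \<open>(I - A\<^sub>1 z - \<dots> - A\<^sub>d z\<^sup>d)\<^sup>-\<^sup>1\<close>; for \<open>d = 1\<close> they are the powers
  \<open>A\<^sub>1\<^sup>n\<close>.
\<close>

fun ma_coeff :: "nat \<Rightarrow> nat \<Rightarrow> (nat \<Rightarrow> real mat) \<Rightarrow> nat \<Rightarrow> real mat" where
  "ma_coeff p d A 0 = 1\<^sub>m p"
| "ma_coeff p d A (Suc n) =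
     mat p p (\<lambda>il. \<Sum>k = 1..min d (Suc n). (A k * ma_coeff p d A (Suc n - k)) $$ il)"

definition stable_VAR ::
  "'w measure \<Rightarrow> nat \<Rightarrow> nat \<Rightarrow> (nat \<Rightarrow> real mat) \<Rightarrow> (int \<Rightarrow> 'w \<Rightarrow> nat \<Rightarrow> real) \<Rightarrow>
     (int \<Rightarrow> 'w \<Rightarrow> nat \<Rightarrow> real) \<Rightarrow> bool" where
  "stable_VAR M p d A E Y \<longleftrightarrow>
     (\<forall>t. Y t \<in> M \<rightarrow>\<^sub>M Rp p) \<and>
     (\<forall>t. AE \<omega> in M. \<forall>i<p. Y t \<omega> i = (\<Sum>k = 1..d. mat_app (A k) (Y (t - int k) \<omega>) i) + E t \<omega> i) \<and>
     (\<forall>t. AE \<omega> in M. \<forall>i<p. (\<lambda>n. mat_app (ma_coeff p d A n) (E (t - int n) \<omega>) i) sums Y t \<omega> i)"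

text \<open>
  Centring, required for (A4) only. Without it (A4) can fail: the moment conditions on \<open>E t\<close>
  compare uncentred norms, so \<open>E t\<close> may be a large constant plus a rare small-probability jump,
  and for time-dependent constants these can cancel in \<open>Y t\<close> at infinitely many \<open>t\<close>.
\<close>

definition mean_zero :: "'w measure \<Rightarrow> nat \<Rightarrow> (int \<Rightarrow> 'w \<Rightarrow> nat \<Rightarrow> real) \<Rightarrow> bool" where
  "mean_zero M p Y \<longleftrightarrow> (\<forall>t. \<forall>i<p. (\<integral>\<omega>. Y t \<omega> i \<partial>M) = 0)"

definition A_bar :: "nat \<Rightarrow> (nat \<Rightarrow> real) \<Rightarrow> real mat" where
  "A_bar d a = mat d d (\<lambda>(i, j). if i = 0 then a (j + 1) else if j + 1 = i then 1 else 0)"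

definition rho :: "real mat \<Rightarrow> real" where
  "rho B = spectral_radius (map_mat complex_of_real B)"

end

theory Submission
  imports Defs
begin

text \<open>
  For \<open>\<rho>(A_bar) < r < 1\<close> one has \<open>(\<Sum>k. a\<^sub>k r\<^sup>-\<^sup>k) \<le> 1\<close>, because otherwise the characteristic
  equation of \<open>A_bar\<close> would have a root in \<open>[r, 1]\<close>. Hence every nonnegative sequence with
  \<open>x\<^sub>t \<le> (\<Sum>k. a\<^sub>k x\<^bsub>t-k\<^esub>)\<close> for \<open>t > j\<close> and \<open>x\<^sub>t \<le> B\<close> for \<open>t \<le> j\<close> satisfies
  \<open>x\<^bsub>j+n\<^esub> \<le> B r\<^sup>n\<close>, and the theorem holds with \<open>K = 0\<close>. The copy \<open>Y'\<close> restarts the recursion from an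
  independent past with the same innovations after time \<open>j\<close>, so \<open>x\<^sub>t\<close> can be the size of
  \<open>Y\<^sub>t - Y'\<^sub>t\<close> in either of the norms of (A2) and (A3). The initial bound \<open>B\<close> is a multiple of
  \<open>\<kappa>\<^sub>1\<close> for (A3); for (A2) it is a multiple of \<open>\<kappa>\<^sub>*\<close>, since averaging over random signs shows that
  the \<open>\<psi>\<^sub>2\<close>-norm of \<open>\<parallel>Y\<^sub>t\<parallel>\<^sub>2\<close> is at most \<open>\<kappa>\<^sub>*\<close>. (A1) and (A4) come from the moving average: the
  triangle inequality and geometric decay of its coefficients give (A1), and the sub-Gaussian bound
  for sums of independent centred variables gives (A4).
\<close>

section \<open>Orlicz gauges\<close>

text \<open>Both norms are handled through admissible gauges \<open>orlicz_le M \<phi> X k\<close>.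
  The psi2 norm is an infimum that may be 0 or \<infinity>, whereas gauges are finite, add under
  sums, and by Fatou's lemma survive almost sure limits, as the infinite moving average demands. The
  difference of \<open>Y\<close> and its copy obeys the recursion without innovations, so its norms
  satisfy a scalar inequality with coefficients \<open>a k\<close>; powers of a block companion
  matrix never appear. The copy needs a fresh past with the right law, so the law of the past of
  \<open>Y\<close> itself is taken as the auxiliary probability space. For (A4) the constant must
  not see the dimension, the coefficients or the number of terms: the moment condition bounds the
  variance proxy of each term by a multiple of its variance, and by independence the variances of
  the partial sums stay below that of \<open>u\<^sup>T Y\<^sub>t\<close>.\<close>

definition orlicz_le :: "'w measure \<Rightarrow> (real \<Rightarrow> real) \<Rightarrow> ('w \<Rightarrow> real) \<Rightarrow> real \<Rightarrow> bool" where
  "orlicz_le M \<phi> X k \<longleftrightarrow> (\<integral>\<^sup>+ \<omega>. ennreal (\<phi> (\<bar>X \<omega>\<bar> / k)) \<partial>M) \<le> 1"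

text \<open>Both \<open>psi2_fun\<close> and the powers \<open>x powr q\<close> with
  \<open>q \<ge> 1\<close> are instances, so the triangle inequality (from convexity) and the
  passage to limits (from continuity) are proved once.\<close>

locale young_function =
  fixes \<phi> :: "real \<Rightarrow> real"
  assumes convex: "convex_on {0..} \<phi>"
    and mono: "mono_on {0..} \<phi>"
    and zero: "\<phi> 0 = 0"
    and cont: "continuous_on {0..} \<phi>"
    and borel [measurable]: "\<phi> \<in> borel_measurable borel"
begin

lemma nonneg: "0 \<le> x \<Longrightarrow> 0 \<le> \<phi> x"
  using mono_onD[OF mono, of 0 x] zero by simp

lemma mono_le: "0 \<le> x \<Longrightarrow> x \<le> y \<Longrightarrow> \<phi> x \<le> \<phi> y"
  using mono_onD[OF mono, of x y] by simp

lemma orlicz_le_mono: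
  assumes "orlicz_le M \<phi> X k" "0 < k" "k \<le> l" "AE \<omega> in M. \<bar>Y \<omega>\<bar> \<le> \<bar>X \<omega>\<bar>"
  shows "orlicz_le M \<phi> Y l"
proof -
  have "(\<integral>\<^sup>+ \<omega>. ennreal (\<phi> (\<bar>Y \<omega>\<bar> / l)) \<partial>M) \<le> (\<integral>\<^sup>+ \<omega>. ennreal (\<phi> (\<bar>X \<omega>\<bar> / k)) \<partial>M)"
  proof (rule nn_integral_mono_AE, use assms(4) in eventually_elim)
    case (elim \<omega>)
    have "\<bar>Y \<omega>\<bar> / l \<le> \<bar>X \<omega>\<bar> / k"
      using elim assms(2,3) by (intro frac_le) auto
    then show ?case
      using assms(2,3) by (intro ennreal_leI mono_le) auto
  qed
  then show ?thesis
    using assms(1) unfolding orlicz_le_def by simp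
qed

text \<open>\<open>\<bar>X + Y\<bar> / (k + l)\<close> is at most the convex combination of
  \<open>\<bar>X\<bar> / k\<close> and \<open>\<bar>Y\<bar> / l\<close> with weights
  \<open>k / (k + l)\<close> and \<open>l / (k + l)\<close>.\<close>

lemma orlicz_le_add:
  assumes [measurable]: "X \<in> borel_measurable M" "Y \<in> borel_measurable M"
    and X: "orlicz_le M \<phi> X k" "0 < k" and Y: "orlicz_le M \<phi> Y l" "0 < l"
  shows "orlicz_le M \<phi> (\<lambda>\<omega>. X \<omega> + Y \<omega>) (k + l)"
proof -
  define t where "t = l / (k + l)"
  have t: "0 \<le> t" "t \<le> 1" "1 - t = k / (k + l)" "0 \<le> 1 - t"
    using X(2) Y(2) by (auto simp: t_def field_simps)
  have "(\<integral>\<^sup>+ \<omega>. ennreal (\<phi> (\<bar>X \<omega> + Y \<omega>\<bar> / (k + l))) \<partial>M)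
    \<le> (\<integral>\<^sup>+ \<omega>. ennreal (1 - t) * ennreal (\<phi> (\<bar>X \<omega>\<bar> / k)) + ennreal t * ennreal (\<phi> (\<bar>Y \<omega>\<bar> / l)) \<partial>M)"
  proof (rule nn_integral_mono)
    fix \<omega>
    have "\<bar>X \<omega> + Y \<omega>\<bar> / (k + l) \<le> (\<bar>X \<omega>\<bar> + \<bar>Y \<omega>\<bar>) / (k + l)"
      using X(2) Y(2) by (intro divide_right_mono) auto
    also have "\<dots> = (1 - t) * (\<bar>X \<omega>\<bar> / k) + t * (\<bar>Y \<omega>\<bar> / l)"
      using X(2) Y(2) unfolding t(3) unfolding t_def by (simp add: add_divide_distrib)
    finally have "\<phi> (\<bar>X \<omega> + Y \<omega>\<bar> / (k + l)) \<le> \<phi> ((1 - t) * (\<bar>X \<omega>\<bar> / k) + t * (\<bar>Y \<omega>\<bar> / l))"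
      using X(2) Y(2) by (intro mono_le) auto
    also have "\<dots> \<le> (1 - t) * \<phi> (\<bar>X \<omega>\<bar> / k) + t * \<phi> (\<bar>Y \<omega>\<bar> / l)"
      using convex_onD[OF convex, of t "\<bar>X \<omega>\<bar> / k" "\<bar>Y \<omega>\<bar> / l"] X(2) Y(2) t by simp
    finally have "ennreal (\<phi> (\<bar>X \<omega> + Y \<omega>\<bar> / (k + l)))
      \<le> ennreal ((1 - t) * \<phi> (\<bar>X \<omega>\<bar> / k) + t * \<phi> (\<bar>Y \<omega>\<bar> / l))"
      by (rule ennreal_leI)
    also have "\<dots> = ennreal (1 - t) * ennreal (\<phi> (\<bar>X \<omega>\<bar> / k)) + ennreal t * ennreal (\<phi> (\<bar>Y \<omega>\<bar> / l))"
      using t(1,4) nonneg[of "\<bar>X \<omega>\<bar> / k"] nonneg[of "\<bar>Y \<omega>\<bar> / l"] X(2) Y(2)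
      by (simp add: ennreal_mult ennreal_plus)
    finally show "ennreal (\<phi> (\<bar>X \<omega> + Y \<omega>\<bar> / (k + l)))
      \<le> ennreal (1 - t) * ennreal (\<phi> (\<bar>X \<omega>\<bar> / k)) + ennreal t * ennreal (\<phi> (\<bar>Y \<omega>\<bar> / l))" .
  qed
  also have "\<dots> = ennreal (1 - t) * (\<integral>\<^sup>+ \<omega>. ennreal (\<phi> (\<bar>X \<omega>\<bar> / k)) \<partial>M)
      + ennreal t * (\<integral>\<^sup>+ \<omega>. ennreal (\<phi> (\<bar>Y \<omega>\<bar> / l)) \<partial>M)"
    by (simp add: nn_integral_add nn_integral_cmult)
  also have "\<dots> \<le> ennreal (1 - t) * 1 + ennreal t * 1"
    using X Y unfolding orlicz_le_def by (intro add_mono mult_left_mono) auto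
  also have "\<dots> = 1"
    using t by (simp flip: ennreal_plus)
  finally show ?thesis
    unfolding orlicz_le_def .
qed

lemma orlicz_le_sum:
  assumes "finite I" "I \<noteq> {}" "\<And>i. i \<in> I \<Longrightarrow> X i \<in> borel_measurable M"
    "\<And>i. i \<in> I \<Longrightarrow> orlicz_le M \<phi> (X i) (k i)" "\<And>i. i \<in> I \<Longrightarrow> 0 < k i"
  shows "orlicz_le M \<phi> (\<lambda>\<omega>. \<Sum>i\<in>I. X i \<omega>) (\<Sum>i\<in>I. k i)"
  using assms
proof (induction rule: finite_ne_induct)
  case (insert i I)
  have "orlicz_le M \<phi> (\<lambda>\<omega>. X i \<omega> + (\<Sum>i\<in>I. X i \<omega>)) (k i + (\<Sum>i\<in>I. k i))"
    using insert by (intro orlicz_le_add borel_measurable_sum sum_pos) auto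
  then show ?case
    using insert by simp
qed auto

text \<open>Fatou's lemma: a common gauge of the approximants survives the limit without a
  dominating function.\<close>

lemma orlicz_le_lim:
  assumes [measurable]: "\<And>n. S n \<in> borel_measurable M"
    and k: "0 < k" "\<And>n. orlicz_le M \<phi> (S n) k"
    and lim: "AE \<omega> in M. (\<lambda>n. S n \<omega>) \<longlonglongrightarrow> X \<omega>"
  shows "orlicz_le M \<phi> X k"
proof -
  have "(\<integral>\<^sup>+ \<omega>. ennreal (\<phi> (\<bar>X \<omega>\<bar> / k)) \<partial>M)
    \<le> (\<integral>\<^sup>+ \<omega>. liminf (\<lambda>n. ennreal (\<phi> (\<bar>S n \<omega>\<bar> / k))) \<partial>M)"
  proof (rule nn_integral_mono_AE, use lim in eventually_elim)
    case (elim \<omega>)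
    have "(\<lambda>n. \<phi> (\<bar>S n \<omega>\<bar> / k)) \<longlonglongrightarrow> \<phi> (\<bar>X \<omega>\<bar> / k)"
      using k(1) elim
      by (intro continuous_on_tendsto_compose[OF cont] tendsto_intros) auto
    then have "(\<lambda>n. ennreal (\<phi> (\<bar>S n \<omega>\<bar> / k))) \<longlonglongrightarrow> ennreal (\<phi> (\<bar>X \<omega>\<bar> / k))"
      by (rule tendsto_ennrealI)
    then show ?case
      by (simp add: lim_imp_Liminf)
  qed
  also have "\<dots> \<le> liminf (\<lambda>n. \<integral>\<^sup>+ \<omega>. ennreal (\<phi> (\<bar>S n \<omega>\<bar> / k)) \<partial>M)"
    by (intro nn_integral_liminf) auto
  also have "\<dots> \<le> liminf (\<lambda>n::nat. 1)"
    using k(2) unfolding orlicz_le_def by (intro Liminf_mono always_eventually) auto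
  also have "\<dots> = 1"
    by (simp add: Liminf_const)
  finally show ?thesis
    unfolding orlicz_le_def .
qed

lemma orlicz_le_sums:
  assumes [measurable]: "\<And>n. X n \<in> borel_measurable M"
    and k: "\<And>n. orlicz_le M \<phi> (X n) (k n)" "\<And>n. 0 < k n" "k sums K"
    and lim: "AE \<omega> in M. (\<lambda>n. X n \<omega>) sums S \<omega>"
  shows "orlicz_le M \<phi> S K"
proof -
  have "k 0 \<le> K"
    using sum_le_suminf[of k "{0}"] k(2,3) by (auto simp: sums_iff less_imp_le)
  then have K: "0 < K"
    using k(2)[of 0] by simp
  show ?thesis
  proof (rule orlicz_le_lim)
    \<comment> \<open>Partial sums start with one term: the empty sum would have gauge 0, and gauges
      have to be positive.\<close>
    show "AE \<omega> in M. (\<lambda>n. \<Sum>i<Suc n. X i \<omega>) \<longlonglongrightarrow> S \<omega>"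
      using lim by eventually_elim (auto simp: sums_def simp del: sum.lessThan_Suc intro!: LIMSEQ_Suc)
    fix n
    have "orlicz_le M \<phi> (\<lambda>\<omega>. \<Sum>i<Suc n. X i \<omega>) (\<Sum>i<Suc n. k i)"
      using k by (intro orlicz_le_sum) auto
    moreover have "(\<Sum>i<Suc n. k i) \<le> K"
      using sum_le_suminf[of k "{..<Suc n}"] k(2,3) by (auto simp: sums_iff less_imp_le)
    ultimately show "orlicz_le M \<phi> (\<lambda>\<omega>. \<Sum>i<Suc n. X i \<omega>) K"
      using k(2) by (intro orlicz_le_mono[where k = "\<Sum>i<Suc n. k i" and l = K and X = "\<lambda>\<omega>. \<Sum>i<Suc n. X i \<omega>"] sum_pos) auto
  qed (use K in auto)
qed

lemma orlicz_le_scale: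
  "c \<noteq> 0 \<Longrightarrow> orlicz_le M \<phi> (\<lambda>\<omega>. c * X \<omega>) (\<bar>c\<bar> * k) \<longleftrightarrow> orlicz_le M \<phi> X k"
  unfolding orlicz_le_def by (simp add: abs_mult)

text \<open>For \<open>c < 1\<close> the variable \<open>c * X\<close> has gauge \<open>k\<close>,
  because \<open>k / c\<close> exceeds \<open>k\<close>; then \<open>c\<close> tends to 1. Hence the
  infimum defining the norm is attained when it is positive and finite.\<close>

lemma orlicz_le_closed:
  assumes [measurable]: "X \<in> borel_measurable M" and k: "0 < k" "\<And>l. k < l \<Longrightarrow> orlicz_le M \<phi> X l"
  shows "orlicz_le M \<phi> X k"
proof (rule orlicz_le_lim)
  fix n :: nat
  define c where "c = inverse (1 + 1 / real (Suc n))"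
  have c: "0 < c" "c < 1"
    by (auto simp: c_def field_simps)
  have "orlicz_le M \<phi> (\<lambda>\<omega>. c * X \<omega>) (\<bar>c\<bar> * (k / c))"
    using c k by (subst orlicz_le_scale) (auto simp: field_simps)
  then show "orlicz_le M \<phi> (\<lambda>\<omega>. inverse (1 + 1 / real (Suc n)) * X \<omega>) k"
    using c unfolding c_def[symmetric] by simp
next
  have "(\<lambda>n. inverse (1 + 1 / real (Suc n)) * X \<omega>) \<longlonglongrightarrow> inverse (1 + 0) * X \<omega>" for \<omega>
    by (intro tendsto_intros LIMSEQ_Suc[OF lim_1_over_n]) simp
  then show "AE \<omega> in M. (\<lambda>n. inverse (1 + 1 / real (Suc n)) * X \<omega>) \<longlonglongrightarrow> X \<omega>"
    by simp
qed (use k in auto)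

end

section \<open>The two gauges and the norms they define\<close>

definition psi2_fun :: "real \<Rightarrow> real" where
  "psi2_fun x = exp (x\<^sup>2) - 1"

interpretation psi2: young_function psi2_fun
proof
  show "convex_on {0..} psi2_fun"
  proof (rule convex_on_realI[where f' = "\<lambda>x. 2 * x * exp (x\<^sup>2)"])
    show "2 * x * exp (x\<^sup>2) \<le> 2 * y * exp (y\<^sup>2)" if "x \<in> {0..}" "y \<in> {0..}" "x \<le> y" for x y :: real
      using that by (intro mult_mono) auto
  qed (auto simp: psi2_fun_def [abs_def] intro!: derivative_eq_intros)
  show "mono_on {0..} psi2_fun"
    by (auto simp: mono_on_def psi2_fun_def)
  show "continuous_on {0..} psi2_fun" "psi2_fun \<in> borel_measurable borel"
    unfolding psi2_fun_def [abs_def] by (auto intro!: continuous_intros)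
qed (simp add: psi2_fun_def)

lemma young_powr:
  assumes q: "1 \<le> q"
  shows "young_function (\<lambda>x. x powr q)"
proof
  have pos: "convex_on {0<..} (\<lambda>x::real. x powr q)"
  proof (rule convex_on_realI[where f' = "\<lambda>x. q * x powr (q - 1)"])
    show "q * x powr (q - 1) \<le> q * y powr (q - 1)" if "x \<in> {0<..}" "y \<in> {0<..}" "x \<le> y" for x y :: real
      using that q by (intro mult_left_mono powr_mono2) auto
  qed (auto intro!: derivative_eq_intros)
  \<comment> \<open>The derivative test is applied on the open half-line; at the endpoint 0
    convexity reduces to \<open>t powr q \<le> t\<close>.\<close>
  show "convex_on {0..} (\<lambda>x::real. x powr q)"
  proof (rule convex_on_linorderI)
    fix t x y :: real
    assume t: "0 < t" "t < 1" and xy: "x \<in> {0..}" "y \<in> {0..}" "x < y"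
    show "((1 - t) *\<^sub>R x + t *\<^sub>R y) powr q \<le> (1 - t) * x powr q + t * y powr q"
    proof (cases "x = 0")
      case True
      have "t powr q \<le> t"
        using powr_mono'[of 1 q t] q t by simp
      then show ?thesis
        using True t xy by (simp add: powr_mult mult_right_mono)
    next
      case False
      then show ?thesis
        using convex_onD[OF pos, of t x y] t xy by simp
    qed
  qed simp
  show "mono_on {0..} (\<lambda>x::real. x powr q)"
    using q by (auto simp: mono_on_def intro!: powr_mono2)
  show "continuous_on {0..} (\<lambda>x::real. x powr q)"
    using q by (intro continuous_on_powr' continuous_intros) auto
qed (use q in auto)

lemma psi2_norm_eq:
  "psi2_norm M X = (INF k\<in>{k. 0 < k \<and> orlicz_le M psi2_fun X k}. ennreal k)"
  by (simp add: psi2_norm_def orlicz_le_def psi2_fun_def)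

text \<open>If the norm is at most \<open>k\<close>, every \<open>l > k\<close> lies above an
  admissible gauge and is therefore admissible; closedness then yields \<open>k\<close>
  itself.\<close>

lemma psi2_norm_le_iff:
  assumes [measurable]: "X \<in> borel_measurable M" and k: "0 < k"
  shows "psi2_norm M X \<le> ennreal k \<longleftrightarrow> orlicz_le M psi2_fun X k"
proof
  assume "orlicz_le M psi2_fun X k"
  then show "psi2_norm M X \<le> ennreal k"
    unfolding psi2_norm_eq using k by (intro INF_lower) auto
next
  assume le: "psi2_norm M X \<le> ennreal k"
  show "orlicz_le M psi2_fun X k"
  proof (rule psi2.orlicz_le_closed)
    fix l assume l: "k < l"
    have "psi2_norm M X < ennreal l"
      using le l k by (metis ennreal_less_iff less_imp_le order_le_less_trans)
    then obtain k' where "0 < k'" "orlicz_le M psi2_fun X k'" "ennreal k' < ennreal l"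
      unfolding psi2_norm_eq INF_less_iff by auto
    then show "orlicz_le M psi2_fun X l"
      by (intro psi2.orlicz_le_mono[of M X k' l]) (auto simp: ennreal_less_iff)
  qed (use k in auto)
qed

text \<open>Reduces comparisons of norms to finite positive bounds, where gauges are available; the
  values 0 and \<infinity> are dealt with here once.\<close>

lemma ennreal_le_of_pos_bounds:
  fixes x y :: ennreal
  assumes "\<And>k. 0 < k \<Longrightarrow> y \<le> ennreal k \<Longrightarrow> x \<le> ennreal k"
  shows "x \<le> y"
proof (rule dense_ge)
  fix z assume z: "y < z"
  show "x \<le> z"
  proof (cases z)
    case (real r)
    then have "0 < r"
      using z by (metis ennreal_neg not_less_zero not_le ennreal_0 order.strict_iff_not)
    then show ?thesis
      using assms[of r] z real by simp
  qed auto
qed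

lemma psi2_norm_mono:
  assumes [measurable]: "X \<in> borel_measurable M" "Y \<in> borel_measurable M"
    and "AE \<omega> in M. \<bar>X \<omega>\<bar> \<le> \<bar>Y \<omega>\<bar>"
  shows "psi2_norm M X \<le> psi2_norm M Y"
proof (rule ennreal_le_of_pos_bounds)
  fix k :: real assume k: "0 < k" "psi2_norm M Y \<le> ennreal k"
  then show "psi2_norm M X \<le> ennreal k"
    using psi2.orlicz_le_mono[of M Y k k X] assms by (simp add: psi2_norm_le_iff)
qed

text \<open>By homogeneity of the power, \<open>I \<le> k powr q\<close> is a gauge condition, so
  the L(q) norm inherits the calculus of Young functions.\<close>

lemma L_norm_le_iff:
  assumes q: "1 \<le> q" and k: "0 < k" and [measurable]: "X \<in> borel_measurable M"
  shows "L_norm M q X \<le> ennreal k \<longleftrightarrow> orlicz_le M (\<lambda>x. x powr q) X k"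
proof -
  define I where "I = (\<integral>\<^sup>+ \<omega>. ennreal (\<bar>X \<omega>\<bar> powr q) \<partial>M)"
  have "(\<integral>\<^sup>+ \<omega>. ennreal ((\<bar>X \<omega>\<bar> / k) powr q) \<partial>M) =
      (\<integral>\<^sup>+ \<omega>. ennreal (1 / k powr q) * ennreal (\<bar>X \<omega>\<bar> powr q) \<partial>M)"
    using k by (intro nn_integral_cong) (simp add: powr_divide flip: ennreal_mult)
  also have "\<dots> = ennreal (1 / k powr q) * I"
    unfolding I_def by (rule nn_integral_cmult) simp
  finally have *: "orlicz_le M (\<lambda>x. x powr q) X k \<longleftrightarrow> ennreal (1 / k powr q) * I \<le> 1"
    by (simp add: orlicz_le_def)
  show ?thesis
  proof (cases I)
    case (real r)
    have "ennreal (1 / k powr q) * I \<le> 1 \<longleftrightarrow> r \<le> k powr q"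
      using real k by (simp add: field_simps flip: ennreal_mult ennreal_1)
    also have "\<dots> \<longleftrightarrow> r powr (1 / q) \<le> k"
    proof
      assume "r \<le> k powr q"
      then have "r powr (1 / q) \<le> (k powr q) powr (1 / q)"
        using q real by (intro powr_mono2) auto
      then show "r powr (1 / q) \<le> k"
        using q k by (simp add: powr_powr)
    next
      assume "r powr (1 / q) \<le> k"
      then have "(r powr (1 / q)) powr q \<le> k powr q"
        using q real by (intro powr_mono2) auto
      then show "r \<le> k powr q"
        using q real by (simp add: powr_powr)
    qed
    also have "\<dots> \<longleftrightarrow> L_norm M q X \<le> ennreal k"
      using real k by (simp add: L_norm_def Let_def flip: I_def)
    finally show ?thesis
      using * by simp
  next
    case top
    then show ?thesis
      using * k by (simp add: L_norm_def Let_def ennreal_mult_top top_unique flip: I_def)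
  qed
qed

lemma L_norm_mono:
  assumes q: "1 \<le> q" and [measurable]: "X \<in> borel_measurable M" "Y \<in> borel_measurable M"
    and "AE \<omega> in M. \<bar>X \<omega>\<bar> \<le> \<bar>Y \<omega>\<bar>"
  shows "L_norm M q X \<le> L_norm M q Y"
proof (rule ennreal_le_of_pos_bounds)
  fix k :: real assume k: "0 < k" "L_norm M q Y \<le> ennreal k"
  then show "L_norm M q X \<le> ennreal k"
    using young_function.orlicz_le_mono[OF young_powr[OF q], of M Y k k X] assms
    by (simp add: L_norm_le_iff)
qed

lemma L_norm_cmult:
  assumes q: "1 \<le> q" and [measurable]: "X \<in> borel_measurable M"
  shows "L_norm M q (\<lambda>\<omega>. c * X \<omega>) \<le> ennreal \<bar>c\<bar> * L_norm M q X"
proof (cases "c = 0")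
  case True
  then show ?thesis
    using q by (simp add: L_norm_def)
next
  case False
  show ?thesis
  proof (rule ennreal_le_of_pos_bounds)
    fix k :: real assume k: "0 < k" "ennreal \<bar>c\<bar> * L_norm M q X \<le> ennreal k"
    have "ennreal \<bar>c\<bar> * L_norm M q X \<le> ennreal \<bar>c\<bar> * ennreal (k / \<bar>c\<bar>)"
      using k False by (simp flip: ennreal_mult)
    then have "L_norm M q X \<le> ennreal (k / \<bar>c\<bar>)"
      using False by (simp add: ennreal_mult_le_mult_iff)
    then have "orlicz_le M (\<lambda>x. x powr q) X (k / \<bar>c\<bar>)"
      using k False q by (simp add: L_norm_le_iff)
    then have "orlicz_le M (\<lambda>x. x powr q) (\<lambda>\<omega>. c * X \<omega>) (\<bar>c\<bar> * (k / \<bar>c\<bar>))"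
      using False by (subst young_function.orlicz_le_scale[OF young_powr[OF q]]) auto
    then show "L_norm M q (\<lambda>\<omega>. c * X \<omega>) \<le> ennreal k"
      using k False q by (simp add: L_norm_le_iff)
  qed
qed

lemma L_norm_add:
  assumes q: "1 \<le> q" and [measurable]: "X \<in> borel_measurable M" "Y \<in> borel_measurable M"
  shows "L_norm M q (\<lambda>\<omega>. X \<omega> + Y \<omega>) \<le> L_norm M q X + L_norm M q Y"
proof (cases "L_norm M q X = \<infinity> \<or> L_norm M q Y = \<infinity>")
  case False
  define x y where "x = enn2real (L_norm M q X)" and "y = enn2real (L_norm M q Y)"
  have xy: "L_norm M q X = ennreal x" "L_norm M q Y = ennreal y" "0 \<le> x" "0 \<le> y"
    using False by (auto simp: x_def y_def less_top)
  have "L_norm M q (\<lambda>\<omega>. X \<omega> + Y \<omega>) \<le> ennreal (x + y) + ennreal e" if e: "0 < e" for e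
  proof -
    \<comment> \<open>A norm may be 0 while gauges are positive; hence the room \<open>e / 2\<close>
      on either side.\<close>
    have "orlicz_le M (\<lambda>x. x powr q) X (x + e / 2)" "orlicz_le M (\<lambda>x. x powr q) Y (y + e / 2)"
      using e xy by (simp_all flip: L_norm_le_iff[OF q])
    then have "orlicz_le M (\<lambda>x. x powr q) (\<lambda>\<omega>. X \<omega> + Y \<omega>) (x + e / 2 + (y + e / 2))"
      using e xy by (intro young_function.orlicz_le_add[OF young_powr[OF q]]) auto
    then have "L_norm M q (\<lambda>\<omega>. X \<omega> + Y \<omega>) \<le> ennreal (x + e / 2 + (y + e / 2))"
      using e xy q by (subst L_norm_le_iff) auto
    also have "x + e / 2 + (y + e / 2) = (x + y) + e"
      by simp
    finally show ?thesis
      using e xy by (simp add: ennreal_plus)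
  qed
  then have "L_norm M q (\<lambda>\<omega>. X \<omega> + Y \<omega>) \<le> ennreal (x + y)"
    by (rule ennreal_le_epsilon)
  then show ?thesis
    using xy by (simp add: ennreal_plus)
qed auto

lemma L_norm_sum:
  assumes q: "1 \<le> q" and "finite I" "\<And>i. i \<in> I \<Longrightarrow> X i \<in> borel_measurable M"
  shows "L_norm M q (\<lambda>\<omega>. \<Sum>i\<in>I. X i \<omega>) \<le> (\<Sum>i\<in>I. L_norm M q (X i))"
  using assms(2,3)
proof (induction rule: finite_induct)
  case (insert i I)
  have "L_norm M q (\<lambda>\<omega>. X i \<omega> + (\<Sum>i\<in>I. X i \<omega>)) \<le> L_norm M q (X i) + L_norm M q (\<lambda>\<omega>. \<Sum>i\<in>I. X i \<omega>)"
    using insert q by (intro L_norm_add borel_measurable_sum) auto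
  also have "\<dots> \<le> L_norm M q (X i) + (\<Sum>i\<in>I. L_norm M q (X i))"
    using insert by (intro add_left_mono) auto
  finally show ?case
    using insert by simp
qed (use q in \<open>simp add: L_norm_def\<close>)

text \<open>Bounds the integral of the right-hand side of \<open>powr_le_exp_square\<close> at an
  admissible gauge. It depends on \<open>q\<close> alone, which makes the final constants depend on
  \<open>\<epsilon>\<close> alone.\<close>

definition moment_const :: "real \<Rightarrow> real" where
  "moment_const q = 1 + fact (nat \<lceil>q\<rceil>)"

lemma powr_le_exp_square:
  assumes q: "1 \<le> q" and x: "0 \<le> (x::real)"
  shows "x powr q \<le> 1 + fact (nat \<lceil>q\<rceil>) * (exp (x\<^sup>2) - 1)"
proof (cases "x \<le> 1")
  case True
  then have "x powr q \<le> 1"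
    using q x by (simp add: powr_le1)
  moreover have "0 \<le> fact (nat \<lceil>q\<rceil>) * (exp (x\<^sup>2) - 1)"
    by (intro mult_nonneg_nonneg) auto
  ultimately show ?thesis by linarith
next
  case False
  define m where "m = nat \<lceil>q\<rceil>"
  have m: "q \<le> real m" "m \<ge> 1"
    using q unfolding m_def by linarith+
  have "x powr q \<le> x powr real (2 * m)"
    using False m q by (intro powr_mono) auto
  also have "\<dots> = (x\<^sup>2) ^ m"
    using False powr_realpow[of x "2 * m"] by (simp add: power_mult)
  also have "\<dots> = fact m * ((x\<^sup>2) ^ m / fact m)"
    by simp
  also have "\<dots> \<le> fact m * (exp (x\<^sup>2) - 1)"
  proof (rule mult_left_mono)
    \<comment> \<open>Only the terms of degree 0 and \<open>m\<close> of the exponential series are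
      kept; they are distinct since \<open>m \<ge> 1\<close>.\<close>
    have "(\<Sum>n\<in>{0, m}. (x\<^sup>2) ^ n /\<^sub>R fact n) \<le> exp (x\<^sup>2)"
      unfolding exp_def using summable_exp_generic[of "x\<^sup>2"] by (intro sum_le_suminf) auto
    then show "(x\<^sup>2) ^ m / fact m \<le> exp (x\<^sup>2) - 1"
      using m by (simp add: field_simps)
  qed simp
  finally show ?thesis
    unfolding m_def by simp
qed

lemma (in prob_space) L_norm_le_psi2_norm:
  assumes q: "1 \<le> q" and [measurable]: "X \<in> borel_measurable M"
  shows "L_norm M q X \<le> ennreal (moment_const q) * psi2_norm M X"
proof -
  have c: "1 \<le> moment_const q"
    by (simp add: moment_const_def)
  have "L_norm M q X \<le> ennreal (moment_const q) * ennreal k"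
    if k: "0 < k" "orlicz_le M psi2_fun X k" for k
  proof -
    have "(\<integral>\<^sup>+ \<omega>. ennreal ((\<bar>X \<omega>\<bar> / (moment_const q * k)) powr q) \<partial>M)
      \<le> (\<integral>\<^sup>+ \<omega>. ennreal (1 / moment_const q) * (1 + ennreal (fact (nat \<lceil>q\<rceil>)) * ennreal (psi2_fun (\<bar>X \<omega>\<bar> / k))) \<partial>M)"
    proof (rule nn_integral_mono)
      fix \<omega>
      have "(\<bar>X \<omega>\<bar> / (moment_const q * k)) powr q = (\<bar>X \<omega>\<bar> / k) powr q / moment_const q powr q"
        using k c by (simp add: powr_divide powr_mult)
      \<comment> \<open>As \<open>moment_const q \<ge> 1\<close>, its q-th power dominates it, so no
        q-th root has to be taken.\<close>
      also have "\<dots> \<le> (\<bar>X \<omega>\<bar> / k) powr q / moment_const q powr 1"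
        using c q by (intro divide_left_mono powr_mono) auto
      also have "\<dots> \<le> 1 / moment_const q * (1 + fact (nat \<lceil>q\<rceil>) * psi2_fun (\<bar>X \<omega>\<bar> / k))"
        using powr_le_exp_square[OF q, of "\<bar>X \<omega>\<bar> / k"] c k
        by (simp add: divide_right_mono psi2_fun_def)
      finally show "ennreal ((\<bar>X \<omega>\<bar> / (moment_const q * k)) powr q) \<le>
        ennreal (1 / moment_const q) * (1 + ennreal (fact (nat \<lceil>q\<rceil>)) * ennreal (psi2_fun (\<bar>X \<omega>\<bar> / k)))"
        using c k psi2.nonneg[of "\<bar>X \<omega>\<bar> / k"]
        by (simp flip: ennreal_mult ennreal_plus ennreal_1 add: ennreal_leI)
    qed
    also have "\<dots> = ennreal (1 / moment_const q) *
        (1 + ennreal (fact (nat \<lceil>q\<rceil>)) * (\<integral>\<^sup>+ \<omega>. ennreal (psi2_fun (\<bar>X \<omega>\<bar> / k)) \<partial>M))"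
      by (simp add: nn_integral_add nn_integral_cmult emeasure_space_1)
    also have "\<dots> \<le> ennreal (1 / moment_const q) * (1 + ennreal (fact (nat \<lceil>q\<rceil>)) * 1)"
      using k(2) unfolding orlicz_le_def by (intro mult_left_mono add_left_mono) auto
    also have "\<dots> = ennreal (1 / moment_const q * (1 + fact (nat \<lceil>q\<rceil>) * 1))"
      using c by (simp flip: ennreal_mult ennreal_plus ennreal_1)
    also have "\<dots> = 1"
      using c by (simp add: moment_const_def add_nonneg_eq_0_iff)
    finally have "orlicz_le M (\<lambda>x. x powr q) X (moment_const q * k)"
      by (simp add: orlicz_le_def)
    then have "L_norm M q X \<le> ennreal (moment_const q * k)"
      using c k q by (subst L_norm_le_iff) auto
    then show ?thesis
      using c k by (simp add: ennreal_mult)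
  qed
  \<comment> \<open>With the constant moved to the left, the bound valid for every admissible gauge
    passes to the infimum.\<close>
  then have "L_norm M q X / ennreal (moment_const q) \<le> psi2_norm M X"
    unfolding psi2_norm_eq using c
    by (intro INF_greatest) (auto simp: mult.commute intro!: divide_le_posI_ennreal)
  then have "ennreal (moment_const q) * (L_norm M q X / ennreal (moment_const q))
      \<le> ennreal (moment_const q) * psi2_norm M X"
    by (rule mult_left_mono) simp
  then show ?thesis
    using c by (simp add: ennreal_times_divide mult.commute[of _ "L_norm M q X"] ennreal_mult_divide_eq)
qed

section \<open>Euclidean operator norms and the companion matrix\<close>

lemma norm2_sum_le:
  "finite I \<Longrightarrow> norm2 p (\<lambda>i. \<Sum>k\<in>I. f k i) \<le> (\<Sum>k\<in>I. norm2 p (f k))"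
proof (induction rule: finite_induct)
  case (insert k I)
  then show ?case
    using L2_set_triangle_ineq[of "f k" "\<lambda>i. \<Sum>k\<in>I. f k i" "{..<p}"] by simp
qed (simp add: L2_set_def)

lemma norm2_cmult: "norm2 p (\<lambda>i. c * x i) = \<bar>c\<bar> * norm2 p x"
  by (simp add: L2_set_def power_mult_distrib real_sqrt_mult flip: sum_distrib_left)

lemma norm2_eq_0D: "norm2 p x = 0 \<Longrightarrow> i < p \<Longrightarrow> x i = 0"
  by (simp add: L2_set_eq_0_iff)

lemma norm2_cong: "(\<And>i. i < p \<Longrightarrow> x i = y i) \<Longrightarrow> norm2 p x = norm2 p y"
  by (intro L2_set_cong) auto

lemma norm2_sign_sphere: "v \<in> sign_sphere p \<Longrightarrow> norm2 p v = sqrt (real p)"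
proof -
  assume "v \<in> sign_sphere p"
  then have "(\<Sum>i<p. (v i)\<^sup>2) = (\<Sum>i<p. 1)"
    by (intro sum.cong refl) (auto simp: sign_sphere_def power2_eq_1_iff abs_eq_iff')
  then show ?thesis
    by (simp add: L2_set_def)
qed

lemma dotp_commute: "dotp p x y = dotp p y x"
  by (simp add: dotp_def mult.commute)

lemma dotp_cmult: "dotp p (\<lambda>i. c * x i) y = c * dotp p x y"
  by (simp add: dotp_def sum_distrib_left mult.assoc)

lemma dotp_cong:
  "(\<And>i. i < p \<Longrightarrow> x i = x' i) \<Longrightarrow> (\<And>i. i < p \<Longrightarrow> y i = y' i) \<Longrightarrow> dotp p x y = dotp p x' y'"
  by (simp add: dotp_def)

lemma dotp_self: "dotp p x x = (norm2 p x)\<^sup>2"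
  by (simp add: dotp_def L2_set_def sum_nonneg power2_eq_square)

lemma abs_dotp_le: "\<bar>dotp p x y\<bar> \<le> norm2 p x * norm2 p y"
proof -
  have "\<bar>dotp p x y\<bar> \<le> (\<Sum>i<p. \<bar>x i\<bar> * \<bar>y i\<bar>)"
    unfolding dotp_def abs_mult[symmetric] by (rule sum_abs)
  also have "\<dots> \<le> norm2 p x * norm2 p y"
    by (rule L2_set_mult_ineq)
  finally show ?thesis .
qed

lemma normalize_unit_sphere:
  assumes "norm2 p x \<noteq> 0"
  obtains u where "u \<in> unit_sphere p" "x = (\<lambda>i. norm2 p x * u i)"
proof
  have "norm2 p x \<ge> 0"
    by (rule L2_set_nonneg)
  then show "(\<lambda>i. inverse (norm2 p x) * x i) \<in> unit_sphere p"
    using assms unfolding unit_sphere_def mem_Collect_eq norm2_cmult by simp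
qed (use assms in auto)

section \<open>Matrices acting on vectors\<close>

lemma mat_app_cmult: "mat_app A (\<lambda>l. c * x l) = (\<lambda>i. c * mat_app A x i)"
  by (simp add: mat_app_def sum_distrib_left algebra_simps)

lemma mat_app_diff: "mat_app A (\<lambda>l. x l - y l) i = mat_app A x i - mat_app A y i"
  by (simp add: mat_app_def right_diff_distrib sum_subtractf)

lemma mat_app_mult:
  assumes "dim_col A = dim_row B" "i < dim_row A"
  shows "mat_app (A * B) x i = mat_app A (mat_app B x) i"
proof -
  have "mat_app (A * B) x i = (\<Sum>l<dim_col B. \<Sum>j<dim_col A. A $$ (i, j) * B $$ (j, l) * x l)"
    using assms by (simp add: mat_app_def scalar_prod_def sum_distrib_right atLeast0LessThan)
  also have "\<dots> = (\<Sum>j<dim_col A. \<Sum>l<dim_col B. A $$ (i, j) * B $$ (j, l) * x l)"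
    by (rule sum.swap)
  also have "\<dots> = mat_app A (mat_app B x) i"
    by (simp add: mat_app_def sum_distrib_left mult.assoc)
  finally show ?thesis .
qed

lemma mat_app_one: "i < p \<Longrightarrow> mat_app (1\<^sub>m p) x i = x i"
  by (simp add: mat_app_def one_mat_def if_distrib[where f = "\<lambda>c. c * _"] cong: if_cong)

lemma dotp_mat_app:
  "dotp (dim_row A) u (mat_app A x) = dotp (dim_col A) (mat_app (transpose_mat A) u) x"
proof -
  have "dotp (dim_row A) u (mat_app A x) = (\<Sum>i<dim_row A. \<Sum>l<dim_col A. u i * A $$ (i, l) * x l)"
    by (simp add: dotp_def mat_app_def sum_distrib_left mult.assoc)
  also have "\<dots> = (\<Sum>l<dim_col A. \<Sum>i<dim_row A. u i * A $$ (i, l) * x l)"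
    by (rule sum.swap)
  also have "\<dots> = dotp (dim_col A) (mat_app (transpose_mat A) u) x"
    by (simp add: dotp_def mat_app_def sum_distrib_left sum_distrib_right mult_ac)
  finally show ?thesis .
qed

text \<open>An operator norm bound without a supremum: majorants such as \<open>r ^ n\<close> can be
  inserted directly, and the zero vector is included.\<close>

definition op_le :: "real mat \<Rightarrow> real \<Rightarrow> bool" where
  "op_le A c \<longleftrightarrow> (\<forall>x. norm2 (dim_row A) (mat_app A x) \<le> c * norm2 (dim_col A) x)"

lemma op_leD: "op_le A c \<Longrightarrow> norm2 (dim_row A) (mat_app A x) \<le> c * norm2 (dim_col A) x"
  by (simp add: op_le_def)

lemma op_le_mono: "op_le A c \<Longrightarrow> c \<le> c' \<Longrightarrow> op_le A c'"
  unfolding op_le_def by (meson L2_set_nonneg mult_right_mono order_trans)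

lemma op_le_spectral_norm: "op_le A (spectral_norm A)"
  unfolding op_le_def
proof
  fix x
  \<comment> \<open>A real supremum is an upper bound only of a bounded set; the sum of the
    Euclidean norms of the rows is a crude bound.\<close>
  have bdd: "bdd_above ((\<lambda>x. norm2 (dim_row A) (mat_app A x)) ` unit_sphere (dim_col A))"
  proof (rule bdd_aboveI2)
    fix x assume x: "x \<in> unit_sphere (dim_col A)"
    have "norm2 (dim_row A) (mat_app A x) \<le> (\<Sum>i<dim_row A. \<bar>mat_app A x i\<bar>)"
      by (rule L2_set_le_sum_abs)
    also have "\<dots> \<le> (\<Sum>i<dim_row A. norm2 (dim_col A) (\<lambda>l. A $$ (i, l)))"
    proof (rule sum_mono)
      fix i
      show "\<bar>mat_app A x i\<bar> \<le> norm2 (dim_col A) (\<lambda>l. A $$ (i, l))"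
        using abs_dotp_le[of "dim_col A" "\<lambda>l. A $$ (i, l)" x] x
        by (simp add: unit_sphere_def dotp_def mat_app_def)
    qed
    finally show "norm2 (dim_row A) (mat_app A x) \<le> (\<Sum>i<dim_row A. norm2 (dim_col A) (\<lambda>l. A $$ (i, l)))" .
  qed
  show "norm2 (dim_row A) (mat_app A x) \<le> spectral_norm A * norm2 (dim_col A) x"
  proof (cases "norm2 (dim_col A) x = 0")
    case True
    then have "mat_app A x = (\<lambda>_. 0)"
      using norm2_eq_0D[OF True] by (simp add: mat_app_def)
    then show ?thesis
      using True by (simp add: L2_set_def)
  next
    case False
    then obtain u where u: "u \<in> unit_sphere (dim_col A)" "x = (\<lambda>i. norm2 (dim_col A) x * u i)"
      by (rule normalize_unit_sphere)
    have "norm2 (dim_row A) (mat_app A u) \<le> spectral_norm A"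
      unfolding spectral_norm_def by (rule cSUP_upper[OF u(1) bdd])
    moreover have "norm2 (dim_row A) (mat_app A x) = norm2 (dim_col A) x * norm2 (dim_row A) (mat_app A u)"
      by (subst u(2)) (simp add: mat_app_cmult norm2_cmult L2_set_nonneg)
    ultimately show ?thesis
      using mult_left_mono[of "norm2 (dim_row A) (mat_app A u)" "spectral_norm A" "norm2 (dim_col A) x"]
      by (simp add: mult.commute[of "spectral_norm A"] L2_set_nonneg)
  qed
qed

text \<open>For \<open>w = A\<^sup>T u\<close> the square of its norm is the inner product of
  \<open>u\<close> and \<open>A w\<close>, at most \<open>norm2 u * c * norm2 w\<close>; one factor
  cancels. Directional bounds need the transpose because there the matrices act on the
  direction.\<close>

lemma op_le_transpose:
  assumes A: "op_le A c" and c: "0 \<le> c"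
  shows "op_le (transpose_mat A) c"
  unfolding op_le_def
proof
  fix u
  define w where "w = mat_app (transpose_mat A) u"
  have "(norm2 (dim_col A) w)\<^sup>2 = dotp (dim_row A) u (mat_app A w)"
    unfolding dotp_mat_app w_def[symmetric] dotp_self ..
  also have "\<dots> \<le> norm2 (dim_row A) u * norm2 (dim_row A) (mat_app A w)"
    using abs_dotp_le by (rule order_trans[OF abs_ge_self])
  also have "\<dots> \<le> norm2 (dim_row A) u * (c * norm2 (dim_col A) w)"
    by (intro mult_left_mono op_leD[OF A] L2_set_nonneg)
  finally have "norm2 (dim_col A) w * norm2 (dim_col A) w \<le> (c * norm2 (dim_row A) u) * norm2 (dim_col A) w"
    by (simp add: power2_eq_square mult_ac)
  then have "norm2 (dim_col A) w \<le> c * norm2 (dim_row A) u"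
    using c L2_set_nonneg[of w "{..<dim_col A}"] L2_set_nonneg[of u "{..<dim_row A}"]
    by (cases "norm2 (dim_col A) w = 0") (auto simp: mult_le_cancel_right)
  then show "norm2 (dim_row (transpose_mat A)) (mat_app (transpose_mat A) u)
      \<le> c * norm2 (dim_col (transpose_mat A)) u"
    by (simp add: w_def)
qed

lemma ma_coeff_carrier: "ma_coeff p d A n \<in> carrier_mat p p"
  by (cases n) auto

lemma mat_app_ma_coeff_Suc:
  assumes A: "\<And>k. k \<in> {1..d} \<Longrightarrow> A k \<in> carrier_mat p p" and i: "i < p"
  shows "mat_app (ma_coeff p d A (Suc n)) x i =
    (\<Sum>k = 1..min d (Suc n). mat_app (A k) (mat_app (ma_coeff p d A (Suc n - k)) x) i)"
proof -
  have "mat_app (ma_coeff p d A (Suc n)) x i =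
      (\<Sum>l<p. \<Sum>k = 1..min d (Suc n). (A k * ma_coeff p d A (Suc n - k)) $$ (i, l) * x l)"
    using i by (simp add: mat_app_def sum_distrib_right)
  also have "\<dots> = (\<Sum>k = 1..min d (Suc n). \<Sum>l<p. (A k * ma_coeff p d A (Suc n - k)) $$ (i, l) * x l)"
    by (rule sum.swap)
  also have "\<dots> = (\<Sum>k = 1..min d (Suc n). mat_app (A k * ma_coeff p d A (Suc n - k)) x i)"
  proof (rule sum.cong[OF refl])
    fix k
    have "dim_col (ma_coeff p d A (Suc n - k)) = p"
      using ma_coeff_carrier[of p d A "Suc n - k"] by auto
    then show "(\<Sum>l<p. (A k * ma_coeff p d A (Suc n - k)) $$ (i, l) * x l) =
        mat_app (A k * ma_coeff p d A (Suc n - k)) x i"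
      by (simp add: mat_app_def)
  qed
  also have "\<dots> = (\<Sum>k = 1..min d (Suc n). mat_app (A k) (mat_app (ma_coeff p d A (Suc n - k)) x) i)"
  proof (intro sum.cong refl mat_app_mult)
    fix k assume k: "k \<in> {1..min d (Suc n)}"
    have "ma_coeff p d A (Suc n - k) \<in> carrier_mat p p" "A k \<in> carrier_mat p p"
      using A[of k] k ma_coeff_carrier by auto
    then show "dim_col (A k) = dim_row (ma_coeff p d A (Suc n - k))" "i < dim_row (A k)"
      using i by auto
  qed
  finally show ?thesis .
qed

text \<open>The k-th summand of the recursion is at most
  \<open>a k * r ^ (n - k) = (a k / r ^ k) * r ^ n\<close>, and the weights
  \<open>a k / r ^ k\<close> sum to at most 1, so the geometric rate is reproduced with constant
  1.\<close>

lemma op_le_ma_coeff: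
  assumes A: "\<And>k. k \<in> {1..d} \<Longrightarrow> A k \<in> carrier_mat p p" "\<And>k. k \<in> {1..d} \<Longrightarrow> op_le (A k) (a k)"
    and a: "\<And>k. k \<in> {1..d} \<Longrightarrow> 0 \<le> a k" and r: "0 < r" "(\<Sum>k = 1..d. a k / r ^ k) \<le> 1"
  shows "op_le (ma_coeff p d A n) (r ^ n)"
proof (induction n rule: less_induct)
  case (less n)
  show ?case
  proof (cases n)
    case 0
    then show ?thesis
      by (auto simp: op_le_def mat_app_one intro!: eq_refl norm2_cong)
  next
    case (Suc m)
    have dim: "dim_row (ma_coeff p d A i) = p" "dim_col (ma_coeff p d A i) = p" for i
      using ma_coeff_carrier[of p d A i] by auto
    show ?thesis
      unfolding op_le_def dim
    proof
      fix x
      let ?y = "\<lambda>k. mat_app (ma_coeff p d A (n - k)) x"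
      have "norm2 p (mat_app (ma_coeff p d A n) x) = norm2 p (\<lambda>i. \<Sum>k = 1..min d n. mat_app (A k) (?y k) i)"
        unfolding Suc by (intro norm2_cong mat_app_ma_coeff_Suc A)
      also have "\<dots> \<le> (\<Sum>k = 1..min d n. norm2 p (mat_app (A k) (?y k)))"
        by (rule norm2_sum_le) simp
      also have "\<dots> \<le> (\<Sum>k = 1..min d n. a k / r ^ k * (r ^ n * norm2 p x))"
      proof (rule sum_mono)
        fix k assume k: "k \<in> {1..min d n}"
        then have "norm2 p (mat_app (A k) (?y k)) \<le> a k * norm2 p (?y k)"
          using op_leD[OF A(2), of k "?y k"] A(1)[of k] by auto
        also have "\<dots> \<le> a k * (r ^ (n - k) * norm2 p x)"
          using k a[of k] op_leD[OF less.IH, of "n - k" x] Suc by (intro mult_left_mono) (auto simp: dim)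
        also have "\<dots> = a k / r ^ k * (r ^ n * norm2 p x)"
          using k r by (simp add: power_diff)
        finally show "norm2 p (mat_app (A k) (?y k)) \<le> a k / r ^ k * (r ^ n * norm2 p x)" .
      qed
      also have "\<dots> \<le> (\<Sum>k = 1..d. a k / r ^ k * (r ^ n * norm2 p x))"
        using a r by (intro sum_mono2) (auto simp: L2_set_nonneg)
      also have "\<dots> \<le> 1 * (r ^ n * norm2 p x)"
        unfolding sum_distrib_right[symmetric] using r by (intro mult_right_mono) (auto simp: L2_set_nonneg)
      finally show "norm2 p (mat_app (ma_coeff p d A n) x) \<le> r ^ n * norm2 p x"
        by simp
    qed
  qed
qed

section \<open>The companion matrix and its spectral radius\<close>

lemma A_bar_mult_vec:
  assumes v: "v \<in> carrier_vec d" and i: "i < d"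
  shows "(map_mat complex_of_real (A_bar d a) *\<^sub>v v) $ i =
    (if i = 0 then \<Sum>j<d. complex_of_real (a (Suc j)) * v $ j else v $ (i - 1))"
proof -
  have "(map_mat complex_of_real (A_bar d a) *\<^sub>v v) $ i =
      (\<Sum>j<d. complex_of_real (if i = 0 then a (Suc j) else if j = i - 1 then 1 else 0) * v $ j)"
    using v i by (auto simp: A_bar_def scalar_prod_def atLeast0LessThan intro!: sum.cong)
  also have "\<dots> = (if i = 0 then \<Sum>j<d. complex_of_real (a (Suc j)) * v $ j else v $ (i - 1))"
    using i by (auto simp: if_distrib[where f = "\<lambda>c. complex_of_real c * _"] cong: if_cong)
  finally show ?thesis .
qed

lemma A_bar_carrier: "map_mat complex_of_real (A_bar d a) \<in> carrier_mat d d"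
  by (simp add: A_bar_def)

lemma sum_shift_Suc: "(\<Sum>j<d. f (Suc j)) = (\<Sum>k = 1..d. f k)" for f :: "nat \<Rightarrow> 'b::comm_monoid_add"
  by (simp add: sum.atLeast1_atMost_eq)

lemma rho_A_bar_nonneg: "d \<ge> 1 \<Longrightarrow> 0 \<le> rho (A_bar d a)"
  using spectral_radius_mem_max(1)[OF A_bar_carrier, of d a] by (auto simp: rho_def)

text \<open>Suppose an eigenvalue \<open>z\<close> has modulus at least 1. The shift rows give
  \<open>norm (v $ i) = norm z * norm (v $ Suc i)\<close>, so the first entry of the eigenvector is
  the largest; the first row then bounds it by \<open>(\<Sum>k. a k)\<close> times itself, and the
  eigenvector vanishes.\<close>

lemma rho_A_bar_less_1:
  assumes d: "d \<ge> 1" and a: "\<And>k. k \<in> {1..d} \<Longrightarrow> 0 \<le> a k" "(\<Sum>k = 1..d. a k) < 1"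
  shows "rho (A_bar d a) < 1"
proof (rule ccontr)
  assume "\<not> rho (A_bar d a) < 1"
  moreover obtain z where "eigenvalue (map_mat complex_of_real (A_bar d a)) z" "norm z = rho (A_bar d a)"
    using spectral_radius_mem_max(1)[OF A_bar_carrier, of d a] d by (auto simp: rho_def spectrum_def)
  ultimately obtain v where z: "1 \<le> norm z" and v: "v \<in> carrier_vec d" "v \<noteq> 0\<^sub>v d"
      "map_mat complex_of_real (A_bar d a) *\<^sub>v v = z \<cdot>\<^sub>v v"
    by (auto simp: eigenvalue_def eigenvector_def A_bar_def)
  have eq: "z * v $ i = (if i = 0 then \<Sum>j<d. complex_of_real (a (Suc j)) * v $ j else v $ (i - 1))"
    if "i < d" for i
    using A_bar_mult_vec[OF v(1) that, of a] v that by simp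
  have le: "norm (v $ i) \<le> norm (v $ 0)" if "i < d" for i
    using that
  proof (induction i)
    case (Suc i)
    have "norm (v $ Suc i) \<le> norm z * norm (v $ Suc i)"
      using z by (simp add: mult_right_le_one_le mult_le_cancel_right1)
    also have "\<dots> = norm (v $ i)"
      using eq[of "Suc i"] Suc by (simp flip: norm_mult)
    finally show ?case
      using Suc by simp
  qed simp
  have "norm (v $ 0) \<le> norm z * norm (v $ 0)"
    using z by (simp add: mult_le_cancel_right1)
  also have "\<dots> = norm (\<Sum>j<d. complex_of_real (a (Suc j)) * v $ j)"
    using eq[of 0] d by (simp flip: norm_mult)
  also have "\<dots> \<le> (\<Sum>j<d. a (Suc j) * norm (v $ 0))"
    using a(1) le by (intro sum_norm_le) (auto simp: norm_mult intro!: mult_left_mono)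
  also have "\<dots> = (\<Sum>k = 1..d. a k) * norm (v $ 0)"
    unfolding sum_shift_Suc[symmetric] sum_distrib_right ..
  finally have "v $ 0 = 0"
    using a(2) by (auto simp: mult_le_cancel_right1)
  then have "v = 0\<^sub>v d"
    using v(1) le by (intro eq_vecI) auto
  then show False
    using v by simp
qed

text \<open>A positive root \<open>x\<close> of \<open>(\<Sum>k. a\<^sub>k x\<^sup>-\<^sup>k) = 1\<close> is an eigenvalue of \<open>A_bar d a\<close>
  with eigenvector \<open>(x\<^sup>d\<^sup>-\<^sup>1, \<dots>, x, 1)\<close>.\<close>

lemma sum_le_1_of_rho_less:
  assumes d: "d \<ge> 1" and a: "\<And>k. k \<in> {1..d} \<Longrightarrow> 0 \<le> a k" "(\<Sum>k = 1..d. a k) < 1"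
    and r: "rho (A_bar d a) < r" "r < 1"
  shows "(\<Sum>k = 1..d. a k / r ^ k) \<le> 1"
proof (rule ccontr)
  assume gt: "\<not> ?thesis"
  \<comment> \<open>The spectral radius is nonnegative. Positivity of \<open>r\<close> keeps
    \<open>a k / x ^ k\<close> continuous on \<open>[r, 1]\<close>, as the intermediate value
    theorem demands.\<close>
  have r0: "0 < r"
    using r rho_A_bar_nonneg[OF d, of a] by simp
  have "\<exists>x\<ge>r. x \<le> 1 \<and> (\<Sum>k = 1..d. a k / x ^ k) = 1"
    using gt a(2) r r0 by (intro IVT2') (auto intro!: continuous_intros)
  then obtain x where x: "r \<le> x" "(\<Sum>k = 1..d. a k / x ^ k) = 1"
    by auto
  define v where "v = vec d (\<lambda>i. complex_of_real (x ^ (d - 1 - i)))"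
  have v: "v \<in> carrier_vec d"
    by (simp add: v_def)
  \<comment> \<open>Multiplying the root equation by \<open>x ^ d\<close> clears the denominators
    and yields the first row of the eigenvalue equation.\<close>
  have "(\<Sum>j<d. a (Suc j) * x ^ (d - 1 - j)) = x ^ d * (\<Sum>k = 1..d. a k / x ^ k)"
    unfolding sum_shift_Suc[symmetric] sum_distrib_left
  proof (rule sum.cong[OF refl])
    fix j assume "j \<in> {..<d}"
    then have "d = (d - 1 - j) + Suc j"
      by simp
    then have "x ^ d = x ^ (d - 1 - j) * x ^ Suc j"
      by (metis power_add)
    then show "a (Suc j) * x ^ (d - 1 - j) = x ^ d * (a (Suc j) / x ^ Suc j)"
      using r0 x by simp
  qed
  also have "\<dots> = x * x ^ (d - 1)"
    using x d by (simp flip: power_Suc)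
  finally have "complex_of_real (\<Sum>j<d. a (Suc j) * x ^ (d - 1 - j)) = complex_of_real (x * x ^ (d - 1))"
    by (rule arg_cong)
  then have top: "(\<Sum>j<d. complex_of_real (a (Suc j)) * v $ j) = complex_of_real (x * x ^ (d - 1))"
    by (simp add: v_def)
  have "map_mat complex_of_real (A_bar d a) *\<^sub>v v = complex_of_real x \<cdot>\<^sub>v v"
  proof (rule eq_vecI)
    fix i assume "i < dim_vec (complex_of_real x \<cdot>\<^sub>v v)"
    then have i: "i < d"
      by (simp add: v_def)
    have "x ^ (d - i) = x * x ^ (d - Suc i)"
      using i by (simp add: Suc_diff_Suc flip: power_Suc)
    then show "(map_mat complex_of_real (A_bar d a) *\<^sub>v v) $ i = (complex_of_real x \<cdot>\<^sub>v v) $ i"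
      using i top unfolding A_bar_mult_vec[OF v i] by (auto simp: v_def simp flip: of_real_power of_real_mult)
  qed (simp add: v_def A_bar_def)
  moreover have "v \<noteq> 0\<^sub>v d"
  proof
    assume "v = 0\<^sub>v d"
    then have "v $ (d - 1) = 0"
      using d by simp
    then show False
      using d by (simp add: v_def)
  qed
  ultimately have "complex_of_real x \<in> spectrum (map_mat complex_of_real (A_bar d a))"
    using v unfolding spectrum_def eigenvalue_def eigenvector_def by (auto simp: A_bar_def)
  then have "norm (complex_of_real x) \<le> rho (A_bar d a)"
    unfolding rho_def using d by (intro spectral_radius_mem_max(2)[OF A_bar_carrier] imageI) auto
  then show False
    using x r r0 by simp
qed

text \<open>With the majorant \<open>B r\<^sup>n\<close> the recursion loses no constant, because \<open>B \<le> B r\<^sup>n\<close> for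
  the nonpositive indices \<open>n\<close> of the initial values.\<close>

lemma recursion_decay:
  fixes x :: "int \<Rightarrow> ennreal"
  assumes init: "\<And>t. t \<le> j \<Longrightarrow> x t \<le> B"
    and rec: "\<And>t. j < t \<Longrightarrow> x t \<le> (\<Sum>k = 1..d. ennreal (a k) * x (t - int k))"
    and a: "\<And>k. k \<in> {1..d} \<Longrightarrow> 0 \<le> a k" and r: "0 < r" "r \<le> 1" "(\<Sum>k = 1..d. a k / r ^ k) \<le> 1"
  shows "x (j + int n) \<le> B * ennreal (r ^ n)"
proof (induction n rule: less_induct)
  case (less n)
  show ?case
  proof (cases "n = 0")
    case True
    then show ?thesis
      using init by simp
  next
    case False
    have "x (j + int n) \<le> (\<Sum>k = 1..d. ennreal (a k) * x (j + int n - int k))"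
      using False by (intro rec) simp
    also have "\<dots> \<le> (\<Sum>k = 1..d. B * ennreal (r ^ n) * ennreal (a k / r ^ k))"
    proof (rule sum_mono)
      fix k assume k: "k \<in> {1..d}"
      have "x (j + int n - int k) \<le> B * ennreal (r ^ n / r ^ k)"
      proof (cases "k \<le> n")
        case True
        have "x (j + int (n - k)) \<le> B * ennreal (r ^ (n - k))"
          using k True by (intro less.IH) auto
        then show ?thesis
          using True r by (simp add: power_diff of_nat_diff algebra_simps)
      next
        case False
        have "r ^ k \<le> r ^ n"
          using False r by (intro power_decreasing) auto
        then have "1 \<le> r ^ n / r ^ k"
          using r by simp
        then have "B * 1 \<le> B * ennreal (r ^ n / r ^ k)"
          by (intro mult_left_mono) (auto simp: ennreal_ge_1)
        moreover have "x (j + int n - int k) \<le> B"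
          using False by (intro init) simp
        ultimately show ?thesis
          by simp
      qed
      then have "ennreal (a k) * x (j + int n - int k) \<le> ennreal (a k) * (B * ennreal (r ^ n / r ^ k))"
        by (rule mult_left_mono) simp
      also have "\<dots> = B * (ennreal (a k) * ennreal (r ^ n / r ^ k))"
        by (simp add: mult_ac)
      also have "ennreal (a k) * ennreal (r ^ n / r ^ k) = ennreal (r ^ n) * ennreal (a k / r ^ k)"
        using a[OF k] r by (simp add: mult_ac flip: ennreal_mult)
      finally show "ennreal (a k) * x (j + int n - int k) \<le> B * ennreal (r ^ n) * ennreal (a k / r ^ k)"
        by (simp add: mult_ac)
    qed
    also have "\<dots> = B * ennreal (r ^ n) * ennreal (\<Sum>k = 1..d. a k / r ^ k)"
      using a r by (subst sum_ennreal[symmetric]) (auto simp: sum_distrib_left)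
    also have "\<dots> \<le> B * ennreal (r ^ n) * 1"
      using r(3) by (intro mult_left_mono) (auto simp: ennreal_le_1)
    finally show ?thesis
      by simp
  qed
qed

section \<open>Sub-Gaussian variables\<close>

lemma (in prob_space) indep_vars_reindex_inj:
  assumes indep: "indep_vars (\<lambda>i. M' i) X (f ` I)" and inj: "inj_on f I"
  shows "indep_vars (\<lambda>i. M' (f i)) (\<lambda>i. X (f i)) I"
proof -
  have "indep_sets (\<lambda>i. F (f i)) I" if F: "indep_sets F (f ` I)" for F
    unfolding indep_sets_def
  proof (intro conjI ballI allI impI)
    fix J A assume J: "J \<subseteq> I" "J \<noteq> {}" "finite J" and A: "A \<in> (\<Pi> j\<in>J. F (f j))"
    define g where "g = the_inv_into J f"
    have inj': "inj_on f J"
      using inj J(1) by (rule inj_on_subset)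
    have g: "g (f j) = j" if "j \<in> J" for j
      using that inj' by (simp add: g_def the_inv_into_f_f)
    have "prob (\<Inter>k\<in>f ` J. A (g k)) = (\<Prod>k\<in>f ` J. prob (A (g k)))"
      using F J A g by (intro indep_setsD[OF F]) auto
    then show "prob (\<Inter>j\<in>J. A j) = (\<Prod>j\<in>J. prob (A j))"
      using g inj' by (simp add: prod.reindex)
  next
    fix i assume "i \<in> I"
    then show "F (f i) \<subseteq> events"
      using F by (auto simp: indep_sets_def)
  qed
  note this[of "\<lambda>i. sigma_sets (space M) {X i -` A \<inter> space M |A. A \<in> sets (M' i)}"]
  then show ?thesis
    using indep unfolding indep_vars_def by auto
qed

text \<open>Independence is a property of joint and marginal laws, which ignore null sets. The
  moving average represents \<open>Y\<close> only almost surely.\<close>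

lemma (in prob_space) indep_var_cong_AE:
  assumes indep: "indep_var S X T Y" and X' [measurable]: "X' \<in> M \<rightarrow>\<^sub>M S"
    and AE: "AE \<omega> in M. X \<omega> = X' \<omega>"
  shows "indep_var S X' T Y"
proof -
  have [measurable]: "X \<in> M \<rightarrow>\<^sub>M S" "Y \<in> M \<rightarrow>\<^sub>M T"
    using indep by (auto dest: indep_var_rv1 indep_var_rv2)
  have "distr M S X' = distr M S X"
    using AE by (intro distr_cong_AE) auto
  moreover have "distr M (S \<Otimes>\<^sub>M T) (\<lambda>x. (X' x, Y x)) = distr M (S \<Otimes>\<^sub>M T) (\<lambda>x. (X x, Y x))"
    using AE by (intro distr_cong_AE) auto
  ultimately show ?thesis
    using indep by (simp add: indep_var_distribution_eq)
qed

text \<open>In the applications \<open>N\<close> is the original space and \<open>M\<close> the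
  auxiliary factor, so almost sure statements and norms lift along \<open>fst\<close> to the
  enlarged space.\<close>

lemma (in prob_space) distr_pair_fst:
  assumes "sigma_finite_measure N"
  shows "distr (N \<Otimes>\<^sub>M M) N fst = N"
proof (rule measure_eqI)
  fix A assume A: "A \<in> sets (distr (N \<Otimes>\<^sub>M M) N fst)"
  interpret N: sigma_finite_measure N by fact
  have "fst -` A \<inter> space (N \<Otimes>\<^sub>M M) = A \<times> space M"
    using A sets.sets_into_space by (auto simp: space_pair_measure)
  then show "emeasure (distr (N \<Otimes>\<^sub>M M) N fst) A = emeasure N A"
    using A by (simp add: emeasure_distr emeasure_pair_measure_Times emeasure_space_1)
qed simp

lemma L_norm_distr:
  assumes [measurable]: "f \<in> M \<rightarrow>\<^sub>M N" "X \<in> borel_measurable N"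
  shows "L_norm (distr M N f) q X = L_norm M q (\<lambda>\<omega>. X (f \<omega>))"
  by (simp add: L_norm_def nn_integral_distr)

text \<open>From \<open>x\<^sup>2 \<le> exp (x\<^sup>2) - 1\<close> at
  \<open>x = X / k\<close>.\<close>

lemma orlicz_le_psi2_integrable:
  assumes [measurable]: "X \<in> borel_measurable M" and X: "orlicz_le M psi2_fun X k" "0 < k"
  shows "integrable M (\<lambda>\<omega>. (X \<omega>)\<^sup>2)" "(\<integral>\<omega>. (X \<omega>)\<^sup>2 \<partial>M) \<le> k\<^sup>2"
proof -
  have "(\<integral>\<^sup>+ \<omega>. ennreal ((X \<omega>)\<^sup>2) \<partial>M) \<le> (\<integral>\<^sup>+ \<omega>. ennreal (k\<^sup>2) * ennreal (psi2_fun (\<bar>X \<omega>\<bar> / k)) \<partial>M)"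
  proof (rule nn_integral_mono)
    fix \<omega>
    have "(X \<omega> / k)\<^sup>2 \<le> psi2_fun (\<bar>X \<omega>\<bar> / k)"
      using exp_ge_add_one_self[of "(X \<omega> / k)\<^sup>2"] unfolding psi2_fun_def power_divide power2_abs by linarith
    then have "(X \<omega>)\<^sup>2 \<le> k\<^sup>2 * psi2_fun (\<bar>X \<omega>\<bar> / k)"
      using X(2) by (simp add: power_divide field_simps)
    then show "ennreal ((X \<omega>)\<^sup>2) \<le> ennreal (k\<^sup>2) * ennreal (psi2_fun (\<bar>X \<omega>\<bar> / k))"
      using X(2) by (simp add: psi2.nonneg ennreal_leI flip: ennreal_mult)
  qed
  also have "\<dots> \<le> ennreal (k\<^sup>2) * 1"
    using mult_left_mono[OF X(1)[unfolded orlicz_le_def], of "ennreal (k\<^sup>2)"]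
    by (subst nn_integral_cmult) auto
  finally have *: "(\<integral>\<^sup>+ \<omega>. ennreal ((X \<omega>)\<^sup>2) \<partial>M) \<le> ennreal (k\<^sup>2)"
    by simp
  show int: "integrable M (\<lambda>\<omega>. (X \<omega>)\<^sup>2)"
    by (rule integrableI_nonneg) (use * in \<open>auto intro: le_less_trans\<close>)
  show "(\<integral>\<omega>. (X \<omega>)\<^sup>2 \<partial>M) \<le> k\<^sup>2"
    using * by (simp add: nn_integral_eq_integral[OF int])
qed

lemma L_norm_2_eq:
  assumes "integrable M (\<lambda>\<omega>. (X \<omega>)\<^sup>2)"
  shows "L_norm M 2 X = ennreal (sqrt (\<integral>\<omega>. (X \<omega>)\<^sup>2 \<partial>M))"
proof -
  have "(\<integral>\<^sup>+ \<omega>. ennreal (\<bar>X \<omega>\<bar> powr 2) \<partial>M) = ennreal (\<integral>\<omega>. (X \<omega>)\<^sup>2 \<partial>M)"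
    using assms by (simp add: nn_integral_eq_integral)
  then show ?thesis
    by (simp add: L_norm_def powr_half_sqrt)
qed

text \<open>Averaging over the sign of one coordinate at a time: by convexity of \<open>exp\<close>,
  \<open>exp (c\<^sup>2 + y\<^sup>2)\<close> is at most the mean of \<open>exp ((c + y)\<^sup>2)\<close> and \<open>exp ((c - y)\<^sup>2)\<close>.\<close>

lemma sign_average:
  fixes Y :: "'w \<Rightarrow> nat \<Rightarrow> real"
  assumes [measurable]: "\<And>i. i < p \<Longrightarrow> (\<lambda>\<omega>. Y \<omega> i) \<in> borel_measurable M" "c \<in> borel_measurable M"
    and le: "\<And>v. v \<in> sign_sphere p \<Longrightarrow> (\<integral>\<^sup>+ \<omega>. ennreal (exp (((c \<omega> + dotp p v (Y \<omega>)) / k)\<^sup>2) - 1) \<partial>M) \<le> 1"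
  shows "(\<integral>\<^sup>+ \<omega>. ennreal (exp (((c \<omega>)\<^sup>2 + (\<Sum>i<p. (Y \<omega> i)\<^sup>2)) / k\<^sup>2) - 1) \<partial>M) \<le> 1"
  using assms
proof (induction p arbitrary: c)
  case 0
  then show ?case
    by (simp add: dotp_def sign_sphere_def power_divide)
next
  case (Suc p)
  note [measurable] = Suc.prems(1,2)
  \<comment> \<open>\<open>J s\<close> is the integrand of the induction hypothesis after the last
    coordinate, with sign \<open>s\<close>, has been moved into the offset \<open>c\<close>; this is
    why \<open>c\<close> is arbitrary in the induction.\<close>
  define J where "J s \<omega> = exp (((c \<omega> + s * Y \<omega> p)\<^sup>2 + (\<Sum>i<p. (Y \<omega> i)\<^sup>2)) / k\<^sup>2) - 1" for s \<omega>
  have [measurable]: "J s \<in> borel_measurable M" for s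
    unfolding J_def by measurable
  have J: "(\<integral>\<^sup>+ \<omega>. ennreal (J s \<omega>) \<partial>M) \<le> 1" if s: "\<bar>s\<bar> = 1" for s
    unfolding J_def
  proof (rule Suc.IH)
    fix v assume v: "v \<in> sign_sphere p"
    have "dotp (Suc p) (v(p := s)) y = s * y p + dotp p v y" for y
      by (simp add: dotp_def)
    moreover have "v(p := s) \<in> sign_sphere (Suc p)"
      using v s by (auto simp: sign_sphere_def less_Suc_eq)
    ultimately show "(\<integral>\<^sup>+ \<omega>. ennreal (exp (((c \<omega> + s * Y \<omega> p + dotp p v (Y \<omega>)) / k)\<^sup>2) - 1) \<partial>M) \<le> 1"
      using Suc.prems(3)[of "v(p := s)"] by (simp only: add.assoc)
  qed auto
  have "(\<integral>\<^sup>+ \<omega>. ennreal (exp (((c \<omega>)\<^sup>2 + (\<Sum>i<Suc p. (Y \<omega> i)\<^sup>2)) / k\<^sup>2) - 1) \<partial>M)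
    \<le> (\<integral>\<^sup>+ \<omega>. ennreal (1 / 2) * ennreal (J 1 \<omega>) + ennreal (1 / 2) * ennreal (J (-1) \<omega>) \<partial>M)"
  proof (rule nn_integral_mono)
    fix \<omega>
    define A B D where "A = ((c \<omega> + Y \<omega> p)\<^sup>2 + (\<Sum>i<p. (Y \<omega> i)\<^sup>2)) / k\<^sup>2"
      and "B = ((c \<omega> - Y \<omega> p)\<^sup>2 + (\<Sum>i<p. (Y \<omega> i)\<^sup>2)) / k\<^sup>2"
      and "D = ((c \<omega>)\<^sup>2 + (\<Sum>i<Suc p. (Y \<omega> i)\<^sup>2)) / k\<^sup>2"
    \<comment> \<open>Parallelogram identity: the cross terms cancel, so \<open>D\<close> is the
      midpoint of \<open>A\<close> and \<open>B\<close>.\<close>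
    have "A + B = 2 * D"
      unfolding A_def B_def D_def add_divide_distrib[symmetric] times_divide_eq_right
      by (simp add: power2_eq_square algebra_simps)
    then have "D = (1 - 1 / 2) *\<^sub>R A + (1 / 2) *\<^sub>R B"
      by simp
    then have "exp D \<le> (1 - 1 / 2) * exp A + (1 / 2) * exp B"
      by (simp only:) (intro convex_onD[OF exp_convex], auto)
    moreover have "J 1 \<omega> = exp A - 1" "J (-1) \<omega> = exp B - 1"
      by (simp_all add: J_def A_def B_def)
    ultimately have "exp D - 1 \<le> 1 / 2 * J 1 \<omega> + 1 / 2 * J (-1) \<omega>"
      by (simp add: field_simps)
    moreover have "0 \<le> J 1 \<omega>" "0 \<le> J (-1) \<omega>"
      unfolding J_def by (auto intro!: add_nonneg_nonneg divide_nonneg_nonneg sum_nonneg)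
    ultimately show "ennreal (exp (((c \<omega>)\<^sup>2 + (\<Sum>i<Suc p. (Y \<omega> i)\<^sup>2)) / k\<^sup>2) - 1)
        \<le> ennreal (1 / 2) * ennreal (J 1 \<omega>) + ennreal (1 / 2) * ennreal (J (-1) \<omega>)"
      unfolding D_def[symmetric] by (subst (1 2) ennreal_mult[symmetric]) (auto simp flip: ennreal_plus intro!: ennreal_leI)
  qed
  also have "\<dots> = ennreal (1 / 2) * (\<integral>\<^sup>+ \<omega>. ennreal (J 1 \<omega>) \<partial>M) + ennreal (1 / 2) * (\<integral>\<^sup>+ \<omega>. ennreal (J (-1) \<omega>) \<partial>M)"
    by (simp add: nn_integral_add nn_integral_cmult)
  also have "\<dots> \<le> ennreal (1 / 2) * 1 + ennreal (1 / 2) * 1"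
    by (intro add_mono mult_left_mono J) auto
  also have "\<dots> = 1"
    by (subst (1 2) mult_1_right, subst ennreal_plus[symmetric]) auto
  finally show ?case .
qed

lemma psi2_norm_norm2_le:
  fixes Y :: "'w \<Rightarrow> nat \<Rightarrow> real"
  assumes [measurable]: "\<And>i. i < p \<Longrightarrow> (\<lambda>\<omega>. Y \<omega> i) \<in> borel_measurable M"
  shows "psi2_norm M (\<lambda>\<omega>. norm2 p (Y \<omega>)) \<le> (SUP v\<in>sign_sphere p. psi2_norm M (\<lambda>\<omega>. dotp p v (Y \<omega>)))"
proof (rule ennreal_le_of_pos_bounds)
  fix k :: real assume k: "0 < k" "(SUP v\<in>sign_sphere p. psi2_norm M (\<lambda>\<omega>. dotp p v (Y \<omega>))) \<le> ennreal k"
  have "(\<integral>\<^sup>+ \<omega>. ennreal (exp (((0 + dotp p v (Y \<omega>)) / k)\<^sup>2) - 1) \<partial>M) \<le> 1" if "v \<in> sign_sphere p" for v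
  proof -
    have "psi2_norm M (\<lambda>\<omega>. dotp p v (Y \<omega>)) \<le> ennreal k"
      using k(2) that by (simp add: SUP_le_iff)
    then have "orlicz_le M psi2_fun (\<lambda>\<omega>. dotp p v (Y \<omega>)) k"
      using k(1) by (subst (asm) psi2_norm_le_iff) (auto simp: dotp_def)
    then show ?thesis
      by (simp add: orlicz_le_def psi2_fun_def power_divide)
  qed
  then have "(\<integral>\<^sup>+ \<omega>. ennreal (exp ((0\<^sup>2 + (\<Sum>i<p. (Y \<omega> i)\<^sup>2)) / k\<^sup>2) - 1) \<partial>M) \<le> 1"
    by (intro sign_average) auto
  then have "orlicz_le M psi2_fun (\<lambda>\<omega>. norm2 p (Y \<omega>)) k"
    by (simp add: orlicz_le_def psi2_fun_def L2_set_def power_divide sum_nonneg)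
  then show "psi2_norm M (\<lambda>\<omega>. norm2 p (Y \<omega>)) \<le> ennreal k"
    using k(1) by (subst psi2_norm_le_iff) (auto simp: L2_set_def)
qed

text \<open>Made for centred variables: the linear term has mean 0, so the expectation of
  \<open>exp (s * X)\<close> is at most that of \<open>exp ((s * X)\<^sup>2)\<close>.\<close>

lemma exp_le_add_exp_square: "exp x \<le> x + exp (x\<^sup>2)" for x :: real
proof -
  consider "1 \<le> x" | "0 \<le> x" "x \<le> 1" | "x \<le> 0"
    by linarith
  then show ?thesis
  proof cases
    case 1
    then have "x \<le> x\<^sup>2"
      by (simp add: power2_eq_square)
    then show ?thesis
      using 1 by (smt (verit) exp_le_cancel_iff)
  next
    case 2
    then show ?thesis
      using exp_bound[of x] exp_ge_add_one_self[of "x\<^sup>2"] by linarith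
  next
    case 3
    define y where "y = - x"
    have y: "0 \<le> y"
      using 3 by (simp add: y_def)
    \<comment> \<open>The product is \<open>1 + y ^ 3\<close>; this leads to
      \<open>exp (- y) \<le> 1 - y + y\<^sup>2\<close>.\<close>
    have "1 \<le> (1 + y) * (1 - y + y\<^sup>2)"
      using y by (simp add: field_simps power2_eq_square)
    also have "\<dots> \<le> exp y * (1 - y + y\<^sup>2)"
    proof (rule mult_right_mono)
      have "0 \<le> (1 - y)\<^sup>2 + y"
        using y by simp
      then show "0 \<le> 1 - y + y\<^sup>2"
        by (simp add: power2_eq_square algebra_simps)
    qed (rule exp_ge_add_one_self)
    finally have "exp (- y) * 1 \<le> exp (- y) * (exp y * (1 - y + y\<^sup>2))"
      by (rule mult_left_mono) simp
    then have "exp x \<le> 1 + x + x\<^sup>2"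
      by (simp add: y_def flip: mult.assoc exp_add)
    then show ?thesis
      using exp_ge_add_one_self[of "x\<^sup>2"] by linarith
  qed
qed

text \<open>The chord of \<open>exp\<close> between 0 and \<open>s\<close>. It bounds
  \<open>exp (t * (X / k)\<^sup>2)\<close> linearly in \<open>exp ((X / k)\<^sup>2)\<close>, whose
  mean is at most 2.\<close>

lemma exp_convex_comb_le: "exp (t * s) \<le> 1 - t + t * exp s" if "0 \<le> t" "t \<le> 1" for s t :: real
  using convex_onD[OF exp_convex, of t 0 s] that by simp

text \<open>With \<open>\<theta> = s\<^sup>2 * k\<^sup>2\<close> there are two regimes. For
  \<open>\<theta> \<le> 1\<close> the expectation is at most \<open>1 + \<theta>\<close>, by
  \<open>exp_le_add_exp_square\<close> and the chord. For \<open>\<theta> > 1\<close> completing the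
  square gives \<open>3 / 2 * exp (\<theta> / 2)\<close>, and
  \<open>3 / 2 \<le> exp (\<theta> / 2)\<close>.\<close>

lemma (in prob_space) mgf_le_of_orlicz_le:
  assumes [measurable]: "X \<in> borel_measurable M" and X: "orlicz_le M psi2_fun X k" "0 < k"
    and mean: "expectation X = 0"
  shows "(\<integral>\<^sup>+ \<omega>. ennreal (exp (s * X \<omega>)) \<partial>M) \<le> ennreal (exp (s\<^sup>2 * k\<^sup>2))"
proof -
  define W where "W \<omega> = exp ((X \<omega> / k)\<^sup>2)" for \<omega>
  have [measurable]: "W \<in> borel_measurable M"
    unfolding W_def by measurable
  have "(\<integral>\<^sup>+ \<omega>. ennreal (W \<omega>) \<partial>M) = (\<integral>\<^sup>+ \<omega>. ennreal (psi2_fun (\<bar>X \<omega>\<bar> / k)) + 1 \<partial>M)"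
    using X(2) by (intro nn_integral_cong)
      (simp add: W_def psi2_fun_def power_divide flip: ennreal_1 ennreal_plus)
  also have "\<dots> \<le> 1 + 1"
    using add_right_mono[OF X(1)[unfolded orlicz_le_def], of 1]
    by (subst nn_integral_add) (auto simp: emeasure_space_1)
  finally have W2: "(\<integral>\<^sup>+ \<omega>. ennreal (W \<omega>) \<partial>M) \<le> ennreal 2"
    by simp
  have intW: "integrable M W"
    by (rule integrableI_nonneg) (use W2 in \<open>auto simp: W_def intro: le_less_trans\<close>)
  have "(\<integral>\<^sup>+ \<omega>. ennreal (W \<omega>) \<partial>M) = ennreal (expectation W)"
    using intW by (rule nn_integral_eq_integral) (simp add: W_def)
  with W2 have EW: "expectation W \<le> 2"
    by (simp only: ennreal_le_iff zero_le_numeral)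
  have intX: "integrable M X"
    by (rule square_integrable_imp_integrable[OF _ orlicz_le_psi2_integrable(1)[OF _ X]]) auto
  \<comment> \<open>Both regimes majorise \<open>exp (s * X)\<close> by a combination of
    \<open>X\<close>, 1 and \<open>W\<close>; the first integrates to 0 and the mean of
    \<open>W\<close> is replaced by 2.\<close>
  have upper: "(\<integral>\<^sup>+ \<omega>. ennreal (exp (s * X \<omega>)) \<partial>M) \<le> ennreal (a + b * 2)"
    if b: "0 \<le> b" and le: "\<And>\<omega>. exp (s * X \<omega>) \<le> c * X \<omega> + a + b * W \<omega>" for a b c
  proof -
    have "(\<integral>\<^sup>+ \<omega>. ennreal (exp (s * X \<omega>)) \<partial>M) \<le> (\<integral>\<^sup>+ \<omega>. ennreal (c * X \<omega> + a + b * W \<omega>) \<partial>M)"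
      by (intro nn_integral_mono ennreal_leI le)
    also have "\<dots> = ennreal (expectation (\<lambda>\<omega>. c * X \<omega> + a + b * W \<omega>))"
      using intX intW by (intro nn_integral_eq_integral) (auto intro!: AE_I2 order_trans[OF _ le])
    also have "expectation (\<lambda>\<omega>. c * X \<omega> + a + b * W \<omega>) = a + b * expectation W"
      using intX intW mean by (simp add: prob_space)
    also have "ennreal \<dots> \<le> ennreal (a + b * 2)"
      using b EW by (intro ennreal_leI add_left_mono mult_left_mono)
    finally show ?thesis .
  qed
  define \<theta> where "\<theta> = s\<^sup>2 * k\<^sup>2"
  have \<theta>: "0 \<le> \<theta>"
    by (simp add: \<theta>_def)
  show ?thesis
    unfolding \<theta>_def[symmetric]
  proof (cases "\<theta> \<le> 1")
    case True
    have "(\<integral>\<^sup>+ \<omega>. ennreal (exp (s * X \<omega>)) \<partial>M) \<le> ennreal ((1 - \<theta>) + \<theta> * 2)"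
    proof (rule upper[OF \<theta>])
      fix \<omega>
      have "(s * X \<omega>)\<^sup>2 = \<theta> * (X \<omega> / k)\<^sup>2"
        using X(2) by (simp add: \<theta>_def power_mult_distrib power_divide)
      then have "exp (s * X \<omega>) \<le> s * X \<omega> + exp (\<theta> * (X \<omega> / k)\<^sup>2)"
        using exp_le_add_exp_square[of "s * X \<omega>"] by simp
      also have "exp (\<theta> * (X \<omega> / k)\<^sup>2) \<le> 1 - \<theta> + \<theta> * W \<omega>"
        unfolding W_def using \<theta> True by (rule exp_convex_comb_le)
      finally show "exp (s * X \<omega>) \<le> s * X \<omega> + (1 - \<theta>) + \<theta> * W \<omega>"
        by simp
    qed
    also have "\<dots> \<le> ennreal (exp \<theta>)"
      using exp_ge_add_one_self[of \<theta>] by (intro ennreal_leI) linarith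
    finally show "(\<integral>\<^sup>+ \<omega>. ennreal (exp (s * X \<omega>)) \<partial>M) \<le> ennreal (exp \<theta>)" .
  next
    case False
    have "(\<integral>\<^sup>+ \<omega>. ennreal (exp (s * X \<omega>)) \<partial>M) \<le> ennreal (exp (\<theta> / 2) / 2 + exp (\<theta> / 2) / 2 * 2)"
    proof (rule upper)
      fix \<omega>
      have "0 \<le> (s * k - X \<omega> / k)\<^sup>2"
        by simp
      also have "\<dots> = \<theta> + (X \<omega> / k)\<^sup>2 - 2 * (s * X \<omega>)"
        using X(2) by (simp add: \<theta>_def power2_eq_square field_simps)
      finally have "exp (s * X \<omega>) \<le> exp (\<theta> / 2 + 1 / 2 * (X \<omega> / k)\<^sup>2)"
        by simp
      also have "\<dots> = exp (\<theta> / 2) * exp (1 / 2 * (X \<omega> / k)\<^sup>2)"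
        by (rule exp_add)
      also have "\<dots> \<le> exp (\<theta> / 2) * (1 - 1 / 2 + 1 / 2 * W \<omega>)"
        unfolding W_def by (intro mult_left_mono exp_convex_comb_le) auto
      finally show "exp (s * X \<omega>) \<le> 0 * X \<omega> + exp (\<theta> / 2) / 2 + exp (\<theta> / 2) / 2 * W \<omega>"
        by (simp add: algebra_simps)
    qed simp
    also have "exp (\<theta> / 2) / 2 + exp (\<theta> / 2) / 2 * 2 = exp (\<theta> / 2) * (1 + 1 / 2)"
      by simp
    also have "ennreal \<dots> \<le> ennreal (exp (\<theta> / 2) * exp (\<theta> / 2))"
    proof (intro ennreal_leI mult_left_mono)
      show "1 + 1 / 2 \<le> exp (\<theta> / 2)"
        using exp_ge_add_one_self[of "\<theta> / 2"] False by linarith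
    qed simp
    also have "\<dots> = ennreal (exp \<theta>)"
      by (simp flip: exp_add)
    finally show "(\<integral>\<^sup>+ \<omega>. ennreal (exp (s * X \<omega>)) \<partial>M) \<le> ennreal (exp \<theta>)" .
  qed
qed

text \<open>Later \<open>k\<close> is a multiple of a standard deviation and may be 0, whereas
  gauges are positive; so \<open>k + 1 / Suc n\<close> is used and \<open>n\<close> tends to
  infinity.\<close>

lemma (in prob_space) mgf_le_of_psi2_norm_le:
  assumes [measurable]: "X \<in> borel_measurable M" and X: "psi2_norm M X \<le> ennreal k" "0 \<le> k"
    and mean: "expectation X = 0"
  shows "(\<integral>\<^sup>+ \<omega>. ennreal (exp (s * X \<omega>)) \<partial>M) \<le> ennreal (exp (s\<^sup>2 * k\<^sup>2))"
proof (rule LIMSEQ_le_const)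
  have "(\<lambda>n. exp (s\<^sup>2 * (k + 1 / real (Suc n))\<^sup>2)) \<longlonglongrightarrow> exp (s\<^sup>2 * (k + 0)\<^sup>2)"
    by (intro tendsto_intros LIMSEQ_Suc[OF lim_1_over_n])
  then show "(\<lambda>n. ennreal (exp (s\<^sup>2 * (k + 1 / real (Suc n))\<^sup>2))) \<longlonglongrightarrow> ennreal (exp (s\<^sup>2 * k\<^sup>2))"
    by (intro tendsto_ennrealI) simp
  have "(\<integral>\<^sup>+ \<omega>. ennreal (exp (s * X \<omega>)) \<partial>M) \<le> ennreal (exp (s\<^sup>2 * (k + 1 / real (Suc n))\<^sup>2))" for n
  proof (rule mgf_le_of_orlicz_le)
    show k': "0 < k + 1 / real (Suc n)"
      using X(2) by (intro add_nonneg_pos) auto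
    have "psi2_norm M X \<le> ennreal (k + 1 / real (Suc n))"
      using X(1) by (rule order_trans) (simp add: ennreal_leI)
    then show "orlicz_le M psi2_fun X (k + 1 / real (Suc n))"
      using k' by (simp add: psi2_norm_le_iff)
  qed (use mean in auto)
  then show "\<exists>N. \<forall>n\<ge>N. (\<integral>\<^sup>+ \<omega>. ennreal (exp (s * X \<omega>)) \<partial>M) \<le> ennreal (exp (s\<^sup>2 * (k + 1 / real (Suc n))\<^sup>2))"
    by blast
qed

text \<open>Integrate the bound on the moment generating function against a centred Gaussian weight of
  standard deviation \<open>\<tau>\<close>; the constant \<open>3 / 8\<close> makes the right-hand side a Gaussian integral of
  standard deviation \<open>2 \<tau>\<close>.\<close>

lemma (in prob_space) exp_square_le_of_mgf_le:
  assumes [measurable]: "X \<in> borel_measurable M" and \<tau>: "0 < \<tau>"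
    and mgf: "\<And>s. (\<integral>\<^sup>+ \<omega>. ennreal (exp (s * X \<omega>)) \<partial>M) \<le> ennreal (exp (3 * s\<^sup>2 / (8 * \<tau>\<^sup>2)))"
  shows "(\<integral>\<^sup>+ \<omega>. ennreal (exp (\<tau>\<^sup>2 * (X \<omega>)\<^sup>2 / 2)) \<partial>M) \<le> 2"
proof -
  interpret lb: sigma_finite_measure "lborel :: real measure"
    by (rule sigma_finite_lborel)
  interpret pair_sigma_finite "lborel :: real measure" M ..
  have nd: "(\<integral>\<^sup>+ s. ennreal (normal_density \<mu> \<sigma> s) \<partial>lborel) = 1" if "0 < \<sigma>" for \<mu> \<sigma>
    using that by (subst nn_integral_eq_integral) auto
  \<comment> \<open>Completing the square: the weight tilted by \<open>exp (s * x)\<close> is a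
    multiple of the Gaussian density with mean \<open>\<tau>\<^sup>2 * x\<close>, so integrating
    over \<open>s\<close> leaves \<open>exp (\<tau>\<^sup>2 * x\<^sup>2 / 2)\<close>.\<close>
  have sq: "normal_density 0 \<tau> s * exp (s * x) = exp (\<tau>\<^sup>2 * x\<^sup>2 / 2) * normal_density (\<tau>\<^sup>2 * x) \<tau> s" for s x
  proof -
    have "- (s - 0)\<^sup>2 / (2 * \<tau>\<^sup>2) + s * x = \<tau>\<^sup>2 * x\<^sup>2 / 2 + - (s - \<tau>\<^sup>2 * x)\<^sup>2 / (2 * \<tau>\<^sup>2)"
      using \<tau> by (simp add: field_simps power2_eq_square)
    then show ?thesis
      by (simp add: normal_density_def mult_ac flip: exp_add)
  qed
  have "(\<integral>\<^sup>+ \<omega>. ennreal (exp (\<tau>\<^sup>2 * (X \<omega>)\<^sup>2 / 2)) \<partial>M)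
      = (\<integral>\<^sup>+ \<omega>. \<integral>\<^sup>+ s. ennreal (exp (\<tau>\<^sup>2 * (X \<omega>)\<^sup>2 / 2)) * ennreal (normal_density (\<tau>\<^sup>2 * X \<omega>) \<tau> s) \<partial>lborel \<partial>M)"
    using \<tau> by (subst nn_integral_cmult) (auto simp: nd)
  also have "\<dots> = (\<integral>\<^sup>+ \<omega>. \<integral>\<^sup>+ s. ennreal (normal_density 0 \<tau> s) * ennreal (exp (s * X \<omega>)) \<partial>lborel \<partial>M)"
    by (simp add: sq flip: ennreal_mult)
  also have "\<dots> = (\<integral>\<^sup>+ s. \<integral>\<^sup>+ \<omega>. ennreal (normal_density 0 \<tau> s) * ennreal (exp (s * X \<omega>)) \<partial>M \<partial>lborel)"
    by (rule Fubini') measurable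
  also have "\<dots> = (\<integral>\<^sup>+ s. ennreal (normal_density 0 \<tau> s) * (\<integral>\<^sup>+ \<omega>. ennreal (exp (s * X \<omega>)) \<partial>M) \<partial>lborel)"
    by (intro nn_integral_cong nn_integral_cmult) measurable
  also have "\<dots> \<le> (\<integral>\<^sup>+ s. ennreal (normal_density 0 \<tau> s) * ennreal (exp (3 * s\<^sup>2 / (8 * \<tau>\<^sup>2))) \<partial>lborel)"
    by (intro nn_integral_mono mult_left_mono mgf) auto
  also have "\<dots> = (\<integral>\<^sup>+ s. ennreal 2 * ennreal (normal_density 0 (2 * \<tau>) s) \<partial>lborel)"
  proof (intro nn_integral_cong)
    fix s
    have "- (s - 0)\<^sup>2 / (2 * \<tau>\<^sup>2) + 3 * s\<^sup>2 / (8 * \<tau>\<^sup>2) = - (s - 0)\<^sup>2 / (2 * (2 * \<tau>)\<^sup>2)"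
      using \<tau> by (simp add: field_simps power2_eq_square)
    then have "exp (- (s - 0)\<^sup>2 / (2 * \<tau>\<^sup>2)) * exp (3 * s\<^sup>2 / (8 * \<tau>\<^sup>2)) = exp (- (s - 0)\<^sup>2 / (2 * (2 * \<tau>)\<^sup>2))"
      by (simp only: flip: exp_add)
    \<comment> \<open>The wider density has half the normalising factor; this is the source of the
      final bound 2.\<close>
    moreover have "sqrt (2 * pi * (2 * \<tau>)\<^sup>2) = 2 * sqrt (2 * pi * \<tau>\<^sup>2)"
      using real_sqrt_mult[of "2\<^sup>2" "2 * pi * \<tau>\<^sup>2"] by (simp add: power_mult_distrib)
    then have "1 / sqrt (2 * pi * \<tau>\<^sup>2) = 2 * (1 / sqrt (2 * pi * (2 * \<tau>)\<^sup>2))"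
      by simp
    ultimately have "normal_density 0 \<tau> s * exp (3 * s\<^sup>2 / (8 * \<tau>\<^sup>2)) = 2 * normal_density 0 (2 * \<tau>) s"
      unfolding normal_density_def by (simp only: mult.assoc)
    then show "ennreal (normal_density 0 \<tau> s) * ennreal (exp (3 * s\<^sup>2 / (8 * \<tau>\<^sup>2))) =
        ennreal 2 * ennreal (normal_density 0 (2 * \<tau>) s)"
      by (metis ennreal_mult exp_ge_zero normal_density_nonneg zero_le_numeral)
  qed
  also have "\<dots> = 2"
    using \<tau> by (subst nn_integral_cmult) (auto simp: nd)
  finally show ?thesis .
qed

section \<open>Sums of independent centred variables\<close>

lemma (in prob_space) mgf_sum_le:
  assumes indep: "indep_vars (\<lambda>_. borel) X I" and I: "finite I"
    and mgf: "\<And>i. i \<in> I \<Longrightarrow> (\<integral>\<^sup>+ \<omega>. ennreal (exp (s * X i \<omega>)) \<partial>M) \<le> ennreal (exp (b i))"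
  shows "(\<integral>\<^sup>+ \<omega>. ennreal (exp (s * (\<Sum>i\<in>I. X i \<omega>))) \<partial>M) \<le> ennreal (exp (\<Sum>i\<in>I. b i))"
proof -
  have "(\<integral>\<^sup>+ \<omega>. ennreal (exp (s * (\<Sum>i\<in>I. X i \<omega>))) \<partial>M) = (\<integral>\<^sup>+ \<omega>. (\<Prod>i\<in>I. ennreal (exp (s * X i \<omega>))) \<partial>M)"
    using I by (simp add: prod_ennreal exp_sum sum_distrib_left)
  also have "\<dots> = (\<Prod>i\<in>I. \<integral>\<^sup>+ \<omega>. ennreal (exp (s * X i \<omega>)) \<partial>M)"
    using I indep_vars_compose2[OF indep, where Y = "\<lambda>_ x. ennreal (exp (s * x))" and N = "\<lambda>_. borel"]
    by (intro indep_vars_nn_integral) auto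
  also have "\<dots> \<le> (\<Prod>i\<in>I. ennreal (exp (b i)))"
    by (intro prod_mono_ennreal mgf)
  also have "\<dots> = ennreal (exp (\<Sum>i\<in>I. b i))"
    using I by (simp add: prod_ennreal exp_sum)
  finally show ?thesis .
qed

lemma (in prob_space) indep_vars_imp_indep_var:
  assumes "indep_vars (\<lambda>_. N) X I" "i \<in> I" "j \<in> I" "i \<noteq> j"
  shows "indep_var N (X i) N (X j)"
proof -
  have "inj_on (case_bool i j) UNIV"
    using assms(4) by (auto simp: inj_on_def split: bool.split)
  moreover have "indep_vars (\<lambda>_. N) X (case_bool i j ` UNIV)"
    using assms by (intro indep_vars_subset[OF assms(1)]) (auto simp: UNIV_bool)
  ultimately have *: "indep_vars (\<lambda>_. N) (\<lambda>b. X (case_bool i j b)) UNIV"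
    by (rule indep_vars_reindex_inj[where M' = "\<lambda>_. N", rotated])
  have X: "case_bool (X i) (X j) = (\<lambda>b. X (case_bool i j b))" and N: "case_bool N N = (\<lambda>_. N)"
    by (rule ext, simp split: bool.split)+
  show ?thesis
    unfolding indep_var_def X N by (rule *)
qed

text \<open>Independent centred variables are orthogonal, so only the diagonal of the double sum
  survives.\<close>

lemma (in prob_space) expectation_square_sum:
  assumes indep: "indep_vars (\<lambda>_. borel) X I" and I: "finite I"
    and sq: "\<And>i. i \<in> I \<Longrightarrow> integrable M (\<lambda>\<omega>. (X i \<omega>)\<^sup>2)"
    and mean: "\<And>i. i \<in> I \<Longrightarrow> expectation (X i) = (0::real)"
  shows "integrable M (\<lambda>\<omega>. (\<Sum>i\<in>I. X i \<omega>)\<^sup>2)"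
    "expectation (\<lambda>\<omega>. (\<Sum>i\<in>I. X i \<omega>)\<^sup>2) = (\<Sum>i\<in>I. expectation (\<lambda>\<omega>. (X i \<omega>)\<^sup>2))"
proof -
  have rv: "X i \<in> borel_measurable M" if "i \<in> I" for i
    using indep that by (auto simp: indep_vars_def)
  have int: "integrable M (X i)" if "i \<in> I" for i
    by (rule square_integrable_imp_integrable[OF rv sq]) (fact that)+
  have prod: "integrable M (\<lambda>\<omega>. X i \<omega> * X j \<omega>) \<and>
      expectation (\<lambda>\<omega>. X i \<omega> * X j \<omega>) = (if i = j then expectation (\<lambda>\<omega>. (X i \<omega>)\<^sup>2) else 0)"
    if ij: "i \<in> I" "j \<in> I" for i j
  proof (cases "i = j")
    case True
    then show ?thesis
      using sq[of j] ij by (simp add: power2_eq_square)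
  next
    case False
    have "indep_var borel (X i) borel (X j)"
      using indep ij False by (rule indep_vars_imp_indep_var)
    from indep_var_integrable[OF this int int] indep_var_lebesgue_integral[OF this int int] show ?thesis
      using ij False mean by simp
  qed
  have eq: "(\<lambda>\<omega>. (\<Sum>i\<in>I. X i \<omega>)\<^sup>2) = (\<lambda>\<omega>. \<Sum>i\<in>I. \<Sum>j\<in>I. X i \<omega> * X j \<omega>)"
    by (simp add: power2_eq_square sum_product)
  show "integrable M (\<lambda>\<omega>. (\<Sum>i\<in>I. X i \<omega>)\<^sup>2)"
    unfolding eq using prod by auto
  show "expectation (\<lambda>\<omega>. (\<Sum>i\<in>I. X i \<omega>)\<^sup>2) = (\<Sum>i\<in>I. expectation (\<lambda>\<omega>. (X i \<omega>)\<^sup>2))"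
    unfolding eq using prod I by (simp add: Bochner_Integration.integral_sum sum.delta)
qed

text \<open>The norm comparison makes \<open>c\<^sup>2 * s n\<close>, with \<open>s n\<close> the
  second moment of the n-th term, a variance proxy of that term. Proxies add up over partial sums
  and stay below \<open>c\<^sup>2 * V\<close>, where \<open>V\<close> is the second moment of
  \<open>S\<close>. The gauges \<open>k\<close> control the tails of the series and do not enter the
  constant.\<close>

lemma (in prob_space) psi2_norm_sums_le:
  assumes indep: "indep_vars (\<lambda>_. borel) X (UNIV :: nat set)"
    and mean: "\<And>n. expectation (X n) = 0"
    and k: "\<And>n. orlicz_le M psi2_fun (X n) (k n)" "\<And>n. 0 < k n" "summable k"
    and psi2: "\<And>n. psi2_norm M (X n) \<le> ennreal c * L_norm M 2 (X n)" and c: "0 < c"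
    and [measurable]: "S \<in> borel_measurable M" and lim: "AE \<omega> in M. (\<lambda>n. X n \<omega>) sums S \<omega>"
  shows "(psi2_norm M S)\<^sup>2 \<le> ennreal (16 / 3 * c\<^sup>2) * (\<integral>\<^sup>+ \<omega>. ennreal ((S \<omega>)\<^sup>2) \<partial>M)"
proof -
  have [measurable]: "X n \<in> borel_measurable M" for n
    using indep by (auto simp: indep_vars_def)
  define s where "s n = expectation (\<lambda>\<omega>. (X n \<omega>)\<^sup>2)" for n
  define V where "V = expectation (\<lambda>\<omega>. (S \<omega>)\<^sup>2)"
  define P where "P N \<omega> = (\<Sum>n<N. X n \<omega>)" for N \<omega>
  define tl where "tl N = suminf k - (\<Sum>n<N. k n)" for N
  have [measurable]: "P N \<in> borel_measurable M" for N
    unfolding P_def by measurable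
  have intX: "integrable M (\<lambda>\<omega>. (X n \<omega>)\<^sup>2)" for n
    by (rule orlicz_le_psi2_integrable(1)[OF _ k(1) k(2)]) simp
  have indep_N: "indep_vars (\<lambda>_. borel) X {..<N}" for N
    using indep by (rule indep_vars_subset) simp
  have tl_sums: "(\<lambda>n. k (n + N)) sums tl N" for N
    unfolding tl_def by (intro sums_split_initial_segment summable_sums k)
  have tl_pos: "0 < tl N" for N
    using tl_sums[of N] k(2) suminf_pos[of "\<lambda>n. k (n + N)"] by (auto simp: sums_iff)
  have tail: "orlicz_le M psi2_fun (\<lambda>\<omega>. S \<omega> - P N \<omega>) (tl N)" for N
  proof (rule psi2.orlicz_le_sums[where X = "\<lambda>n. X (n + N)" and k = "\<lambda>n. k (n + N)"])
    show "AE \<omega> in M. (\<lambda>n. X (n + N) \<omega>) sums (S \<omega> - P N \<omega>)"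
      using lim by eventually_elim (auto simp: P_def intro!: sums_split_initial_segment)
  qed (use k tl_sums in auto)
  have intS: "integrable M (\<lambda>\<omega>. (S \<omega>)\<^sup>2)"
    using orlicz_le_psi2_integrable(1)[of S M "tl 0"] tail[of 0] tl_pos[of 0] by (simp add: P_def)
  have sum_s: "L_norm M 2 (P N) = ennreal (sqrt (\<Sum>n<N. s n))" for N
    using expectation_square_sum[OF indep_N[of N] _ intX mean] by (subst L_norm_2_eq) (auto simp: P_def s_def)
  have le_tl: "sqrt (\<Sum>n<N. s n) \<le> sqrt V + tl N" for N
  proof -
    have "ennreal (sqrt (\<Sum>n<N. s n)) = L_norm M 2 (\<lambda>\<omega>. S \<omega> + - 1 * (S \<omega> - P N \<omega>))"
      by (simp add: sum_s)
    also have "\<dots> \<le> L_norm M 2 S + L_norm M 2 (\<lambda>\<omega>. - 1 * (S \<omega> - P N \<omega>))"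
      by (rule L_norm_add) auto
    also have "\<dots> \<le> L_norm M 2 S + ennreal \<bar>- 1\<bar> * L_norm M 2 (\<lambda>\<omega>. S \<omega> - P N \<omega>)"
      by (intro add_left_mono L_norm_cmult) auto
    also have "\<dots> = ennreal (sqrt V) + ennreal (sqrt (expectation (\<lambda>\<omega>. (S \<omega> - P N \<omega>)\<^sup>2)))"
      using intS orlicz_le_psi2_integrable(1)[OF _ tail tl_pos] by (simp add: L_norm_2_eq V_def)
    also have "\<dots> \<le> ennreal (sqrt V) + ennreal (tl N)"
      using orlicz_le_psi2_integrable(2)[OF _ tail tl_pos, of N] tl_pos[of N]
      by (intro add_left_mono ennreal_leI) (auto intro: real_le_lsqrt)
    also have "\<dots> = ennreal (sqrt V + tl N)"
      using tl_pos[of N] by (intro ennreal_plus[symmetric]) (auto simp: V_def)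
    finally show ?thesis
      using tl_pos[of N] by (subst (asm) ennreal_le_iff) (auto simp: V_def intro!: add_nonneg_nonneg)
  qed
  \<comment> \<open>Additivity of second moments is available for finite sums. These sums increase
    with \<open>m\<close>, and the tail in \<open>le_tl\<close> tends to 0, which leaves
    \<open>V\<close>.\<close>
  have sum_le_V: "(\<Sum>n<N. s n) \<le> V" for N
  proof -
    have "tl \<longlonglongrightarrow> suminf k - suminf k"
      unfolding tl_def by (intro tendsto_intros summable_LIMSEQ k)
    then have "(\<lambda>m. sqrt V + tl m) \<longlonglongrightarrow> sqrt V + 0"
      by (intro tendsto_intros) simp
    moreover have "sqrt (\<Sum>n<N. s n) \<le> sqrt V + tl m" if "N \<le> m" for m
    proof -
      have "(\<Sum>n<N. s n) \<le> (\<Sum>n<m. s n)"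
        using that by (intro sum_mono2) (auto simp: s_def)
      then show ?thesis
        using le_tl[of m] real_sqrt_le_mono order_trans by blast
    qed
    ultimately have "sqrt (\<Sum>n<N. s n) \<le> sqrt V + 0"
      by (intro LIMSEQ_le_const) auto
    then show ?thesis
      by simp
  qed
  have mgf: "(\<integral>\<^sup>+ \<omega>. ennreal (exp (x * P N \<omega>)) \<partial>M) \<le> ennreal (exp (x\<^sup>2 * c\<^sup>2 * V))" for x N
  proof -
    have "(\<integral>\<^sup>+ \<omega>. ennreal (exp (x * X n \<omega>)) \<partial>M) \<le> ennreal (exp (x\<^sup>2 * c\<^sup>2 * s n))" for n
    proof -
      have "psi2_norm M (X n) \<le> ennreal (c * sqrt (s n))"
        using psi2[of n] c by (simp add: L_norm_2_eq[OF intX] s_def ennreal_mult)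
      then have "(\<integral>\<^sup>+ \<omega>. ennreal (exp (x * X n \<omega>)) \<partial>M) \<le> ennreal (exp (x\<^sup>2 * (c * sqrt (s n))\<^sup>2))"
        using c by (intro mgf_le_of_psi2_norm_le mean) (auto simp: s_def)
      then show ?thesis
        by (simp add: power_mult_distrib s_def mult.assoc)
    qed
    then have "(\<integral>\<^sup>+ \<omega>. ennreal (exp (x * P N \<omega>)) \<partial>M) \<le> ennreal (exp (\<Sum>n<N. x\<^sup>2 * c\<^sup>2 * s n))"
      unfolding P_def by (intro mgf_sum_le[OF indep_N]) auto
    also have "\<dots> \<le> ennreal (exp (x\<^sup>2 * c\<^sup>2 * V))"
      using sum_le_V[of N] by (simp add: ennreal_leI mult_left_mono flip: sum_distrib_left)
    finally show ?thesis .
  qed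
  have "(psi2_norm M S)\<^sup>2 \<le> ennreal (16 / 3 * c\<^sup>2 * V)"
  proof (rule ennreal_le_of_pos_bounds)
    fix y :: real assume y: "0 < y" "ennreal (16 / 3 * c\<^sup>2 * V) \<le> ennreal y"
    then have cV: "16 / 3 * c\<^sup>2 * V \<le> y"
      by simp
    \<comment> \<open>With this choice \<open>exp (\<tau>\<^sup>2 * x\<^sup>2 / 2)\<close> is
      \<open>psi2_fun (\<bar>x\<bar> / sqrt y) + 1\<close>, and the Gaussian bound admits the
      variance proxy \<open>3 / (8 * \<tau>\<^sup>2) = 3 * y / 16\<close>. Requiring
      \<open>c\<^sup>2 * V\<close> to be at most this is the origin of
      \<open>16 / 3\<close>.\<close>
    define \<tau> where "\<tau> = sqrt (2 / y)"
    have \<tau>: "0 < \<tau>" "\<tau>\<^sup>2 = 2 / y"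
      using y(1) by (auto simp: \<tau>_def)
    have "orlicz_le M psi2_fun (P N) (sqrt y)" for N
    proof -
      have "(\<integral>\<^sup>+ \<omega>. ennreal (exp (\<tau>\<^sup>2 * (P N \<omega>)\<^sup>2 / 2)) \<partial>M) \<le> 2"
      proof (rule exp_square_le_of_mgf_le)
        fix x
        have "x\<^sup>2 * c\<^sup>2 * V \<le> 3 * x\<^sup>2 / (8 * \<tau>\<^sup>2)"
          using mult_left_mono[OF cV, of "3 * x\<^sup>2 / 16"] y(1) by (simp add: \<tau>(2) mult_ac)
        then show "(\<integral>\<^sup>+ \<omega>. ennreal (exp (x * P N \<omega>)) \<partial>M) \<le> ennreal (exp (3 * x\<^sup>2 / (8 * \<tau>\<^sup>2)))"
          by (intro order_trans[OF mgf] ennreal_leI) simp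
      qed (use \<tau> in auto)
      moreover have "exp (\<tau>\<^sup>2 * (P N \<omega>)\<^sup>2 / 2) = psi2_fun (\<bar>P N \<omega>\<bar> / sqrt y) + 1" for \<omega>
        using y(1) by (simp add: psi2_fun_def \<tau>(2) power_divide)
      ultimately have "(\<integral>\<^sup>+ \<omega>. 1 + ennreal (psi2_fun (\<bar>P N \<omega>\<bar> / sqrt y)) \<partial>M) \<le> 2"
        using y(1) by (simp add: psi2.nonneg add.commute flip: ennreal_plus ennreal_1)
      then have "1 + (\<integral>\<^sup>+ \<omega>. ennreal (psi2_fun (\<bar>P N \<omega>\<bar> / sqrt y)) \<partial>M) \<le> 1 + 1"
        by (subst (asm) nn_integral_add) (auto simp: emeasure_space_1)
      then show ?thesis
        unfolding orlicz_le_def ennreal_add_left_cancel_le by simp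
    qed
    then have "orlicz_le M psi2_fun S (sqrt y)"
    proof (rule psi2.orlicz_le_lim[rotated 2])
      show "AE \<omega> in M. (\<lambda>N. P N \<omega>) \<longlonglongrightarrow> S \<omega>"
        using lim by eventually_elim (auto simp: P_def sums_def)
    qed (use y in auto)
    then have "psi2_norm M S \<le> ennreal (sqrt y)"
      using y(1) by (subst psi2_norm_le_iff) auto
    then have "(psi2_norm M S)\<^sup>2 \<le> (ennreal (sqrt y))\<^sup>2"
      by (intro power_mono) auto
    then show "(psi2_norm M S)\<^sup>2 \<le> ennreal y"
      using y(1) by (simp add: ennreal_power)
  qed
  also have "\<dots> = ennreal (16 / 3 * c\<^sup>2) * ennreal V"
    by (intro ennreal_mult) (auto simp: V_def)
  also have "ennreal V = (\<integral>\<^sup>+ \<omega>. ennreal ((S \<omega>)\<^sup>2) \<partial>M)"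
    unfolding V_def by (rule nn_integral_eq_integral[OF intS, symmetric]) simp
  finally show ?thesis .
qed

section \<open>The moving average\<close>

lemma measurable_dotp:
  assumes "X \<in> M \<rightarrow>\<^sub>M Rp p"
  shows "(\<lambda>\<omega>. dotp p u (X \<omega>)) \<in> borel_measurable M"
proof -
  have "(\<lambda>\<omega>. X \<omega> i) \<in> borel_measurable M" if "i < p" for i
    using measurable_compose[OF assms measurable_component_singleton[of i]] that by simp
  then show ?thesis
    unfolding dotp_def by (intro borel_measurable_sum borel_measurable_times) auto
qed

lemma measurable_Rp_component:
  assumes "X \<in> M \<rightarrow>\<^sub>M Rp p" "i < p"
  shows "(\<lambda>\<omega>. X \<omega> i) \<in> borel_measurable M"
  using measurable_compose[OF assms(1) measurable_component_singleton[of i]] assms(2) by simp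

lemma measurable_mat_app:
  assumes "X \<in> M \<rightarrow>\<^sub>M Rp p" "B \<in> carrier_mat p p"
  shows "(\<lambda>\<omega>. mat_app B (X \<omega>) i) \<in> borel_measurable M"
  using measurable_dotp[OF assms(1), of "\<lambda>l. B $$ (i, l)"] assms(2) by (simp add: mat_app_def dotp_def)

lemma measurable_norm2:
  assumes [measurable]: "\<And>i. i < p \<Longrightarrow> (\<lambda>\<omega>. X \<omega> i) \<in> borel_measurable M"
  shows "(\<lambda>\<omega>. norm2 p (X \<omega>)) \<in> borel_measurable M"
  unfolding L2_set_def by measurable

locale var_model = prob_space M for M :: "'w measure" +
  fixes p d :: nat and a :: "nat \<Rightarrow> real" and A :: "nat \<Rightarrow> real mat"
    and E Y :: "int \<Rightarrow> 'w \<Rightarrow> nat \<Rightarrow> real" and D1 r :: real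
  assumes a_nonneg: "\<And>k. k \<in> {1..d} \<Longrightarrow> 0 \<le> a k"
    and r: "0 < r" "r < 1" "(\<Sum>k = 1..d. a k / r ^ k) \<le> 1"
    and A_carrier: "\<And>k. k \<in> {1..d} \<Longrightarrow> A k \<in> carrier_mat p p"
    and A_norm: "\<And>k. k \<in> {1..d} \<Longrightarrow> spectral_norm (A k) \<le> a k"
    and indep: "indep_vars (\<lambda>_. Rp p) E UNIV"
    and D1: "0 < D1" "(SUP t. SUP u\<in>unit_sphere p. psi2_norm M (\<lambda>\<omega>. dotp p u (E t \<omega>))) < ennreal D1"
    and stable: "stable_VAR M p d A E Y"
begin

lemma E_measurable: "E t \<in> M \<rightarrow>\<^sub>M Rp p"
  using indep by (auto simp: indep_vars_def)

lemma Y_measurable: "Y t \<in> M \<rightarrow>\<^sub>M Rp p"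
  using stable by (simp add: stable_VAR_def)

lemma Y_recursion: "AE \<omega> in M. \<forall>i<p. Y t \<omega> i = (\<Sum>k = 1..d. mat_app (A k) (Y (t - int k) \<omega>) i) + E t \<omega> i"
  using stable by (simp add: stable_VAR_def)

lemma Y_series: "AE \<omega> in M. \<forall>i<p. (\<lambda>n. mat_app (ma_coeff p d A n) (E (t - int n) \<omega>) i) sums Y t \<omega> i"
  using stable by (simp add: stable_VAR_def)

lemma op_le_A: "k \<in> {1..d} \<Longrightarrow> op_le (A k) (a k)"
  using op_le_mono[OF op_le_spectral_norm A_norm] .

lemma dim_ma_coeff [simp]: "dim_row (ma_coeff p d A n) = p" "dim_col (ma_coeff p d A n) = p"
  using ma_coeff_carrier[of p d A n] by auto

lemma norm2_ma_coeff_transpose_le: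
  "norm2 p (mat_app (transpose_mat (ma_coeff p d A n)) u) \<le> r ^ n * norm2 p u"
proof -
  have "op_le (ma_coeff p d A n) (r ^ n)"
    using A_carrier op_le_A a_nonneg r by (intro op_le_ma_coeff) auto
  then have "op_le (transpose_mat (ma_coeff p d A n)) (r ^ n)"
    using r by (intro op_le_transpose) auto
  from op_leD[OF this, of u] show ?thesis
    by simp
qed

lemma norm2_A_transpose_le:
  assumes "k \<in> {1..d}"
  shows "norm2 p (mat_app (transpose_mat (A k)) u) \<le> a k * norm2 p u"
  using op_leD[OF op_le_transpose[OF op_le_A[OF assms] a_nonneg[OF assms]], of u] A_carrier[OF assms]
  by auto

text \<open>Homogeneity in \<open>u\<close>. A majorant \<open>b > 0\<close> replaces the norm of
  \<open>u\<close>, because \<open>u\<close> may vanish while a gauge must be positive.\<close>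

lemma orlicz_le_E:
  assumes u: "norm2 p u \<le> b" and b: "0 < b"
  shows "orlicz_le M psi2_fun (\<lambda>\<omega>. dotp p u (E t \<omega>)) (b * D1)"
proof (cases "norm2 p u = 0")
  case True
  then show ?thesis
    using norm2_eq_0D[OF True] by (simp add: orlicz_le_def dotp_def psi2_fun_def)
next
  case False
  then obtain e where e: "e \<in> unit_sphere p" "u = (\<lambda>i. norm2 p u * e i)"
    by (rule normalize_unit_sphere)
  have "psi2_norm M (\<lambda>\<omega>. dotp p e (E t \<omega>)) \<le>
      (SUP t. SUP u\<in>unit_sphere p. psi2_norm M (\<lambda>\<omega>. dotp p u (E t \<omega>)))"
    by (rule SUP_upper2[where i = t]) (use e in \<open>auto intro: SUP_upper\<close>)
  also have "\<dots> \<le> ennreal D1"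
    using D1(2) by simp
  finally have "orlicz_le M psi2_fun (\<lambda>\<omega>. dotp p e (E t \<omega>)) D1"
    using D1(1) by (subst (asm) psi2_norm_le_iff) (auto intro: measurable_dotp E_measurable)
  then have "orlicz_le M psi2_fun (\<lambda>\<omega>. norm2 p u * dotp p e (E t \<omega>)) (\<bar>norm2 p u\<bar> * D1)"
    using False by (subst psi2.orlicz_le_scale)
  also have "(\<lambda>\<omega>. norm2 p u * dotp p e (E t \<omega>)) = (\<lambda>\<omega>. dotp p u (E t \<omega>))"
    using dotp_cmult[of p "norm2 p u" e] unfolding e(2)[symmetric] by simp
  finally have *: "orlicz_le M psi2_fun (\<lambda>\<omega>. dotp p u (E t \<omega>)) (norm2 p u * D1)"
    by (simp add: L2_set_nonneg)
  have "0 < norm2 p u"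
    using False by (simp add: order_less_le L2_set_nonneg)
  then show ?thesis
    using D1(1) u by (intro psi2.orlicz_le_mono[OF *]) auto
qed

text \<open>Transposing moves the coefficients onto \<open>u\<close>, which turns the vector series
  into a scalar one.\<close>

lemma dotp_Y_series:
  "AE \<omega> in M. (\<lambda>n. dotp p (mat_app (transpose_mat (ma_coeff p d A n)) u) (E (t - int n) \<omega>)) sums dotp p u (Y t \<omega>)"
  using Y_series[of t]
proof eventually_elim
  case (elim \<omega>)
  have "(\<lambda>n. \<Sum>i<p. u i * mat_app (ma_coeff p d A n) (E (t - int n) \<omega>) i) sums (\<Sum>i<p. u i * Y t \<omega> i)"
    using elim by (intro sums_sum sums_mult) auto
  moreover have "(\<Sum>i<p. u i * mat_app (ma_coeff p d A n) (E (t - int n) \<omega>) i) =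
      dotp p (mat_app (transpose_mat (ma_coeff p d A n)) u) (E (t - int n) \<omega>)" for n
    using dotp_mat_app[of "ma_coeff p d A n" u] by (simp add: dotp_def)
  ultimately show ?case
    by (simp add: dotp_def)
qed

lemma orlicz_le_MA_term:
  assumes "norm2 p u \<le> b" "0 < b"
  shows "orlicz_le M psi2_fun (\<lambda>\<omega>. dotp p (mat_app (transpose_mat (ma_coeff p d A n)) u) (E t \<omega>)) (r ^ n * (b * D1))"
proof -
  have "norm2 p (mat_app (transpose_mat (ma_coeff p d A n)) u) \<le> r ^ n * norm2 p u"
    by (rule norm2_ma_coeff_transpose_le)
  also have "\<dots> \<le> r ^ n * b"
    using r assms(1) by (intro mult_left_mono) auto
  finally have "orlicz_le M psi2_fun (\<lambda>\<omega>. dotp p (mat_app (transpose_mat (ma_coeff p d A n)) u) (E t \<omega>)) (r ^ n * b * D1)"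
    using r assms(2) by (intro orlicz_le_E) auto
  then show ?thesis
    by (simp add: mult.assoc)
qed

lemma orlicz_le_Y:
  assumes "norm2 p u \<le> b" "0 < b"
  shows "orlicz_le M psi2_fun (\<lambda>\<omega>. dotp p u (Y t \<omega>)) (b * D1 / (1 - r))"
proof (rule psi2.orlicz_le_sums[OF _ orlicz_le_MA_term[OF assms] _ _ dotp_Y_series])
  have "(\<lambda>n. r ^ n * (b * D1)) sums (1 / (1 - r) * (b * D1))"
    using r by (intro sums_mult2 geometric_sums) auto
  then show "(\<lambda>n. r ^ n * (b * D1)) sums (b * D1 / (1 - r))"
    by simp
  show "0 < r ^ n * (b * D1)" for n
    using r assms(2) D1(1) by simp
qed (auto intro: measurable_dotp E_measurable)

lemma psi2_norm_Y_le:
  assumes "norm2 p u \<le> b" "0 < b"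
  shows "psi2_norm M (\<lambda>\<omega>. dotp p u (Y t \<omega>)) \<le> ennreal (b * D1 / (1 - r))"
  using orlicz_le_Y[OF assms, of t] assms(2) D1(1) r
  by (subst psi2_norm_le_iff) (auto intro: measurable_dotp Y_measurable)

lemma assumption_A1: "assumption_A1 M p Y"
proof -
  have "kappa1 M p Y \<le> ennreal (1 * D1 / (1 - r))"
    unfolding kappa1_def by (intro SUP_least psi2_norm_Y_le) (auto simp: unit_sphere_def)
  \<comment> \<open>Sign vectors have norm \<open>sqrt p\<close>, and adding 1 keeps the majorant
    positive. The bound may grow with the dimension, since (A1) asks for finiteness.\<close>
  moreover have "kappa_star M p Y \<le> ennreal ((sqrt (real p) + 1) * D1 / (1 - r))"
    unfolding kappa_star_def
    by (intro SUP_least psi2_norm_Y_le) (auto simp: norm2_sign_sphere intro: add_nonneg_pos)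
  ultimately show ?thesis
    unfolding assumption_A1_def by (auto intro: le_less_trans)
qed

lemma psi2_norm_le_kappa1:
  "u \<in> unit_sphere p \<Longrightarrow> psi2_norm M (\<lambda>\<omega>. dotp p u (Y t \<omega>)) \<le> kappa1 M p Y"
  unfolding kappa1_def by (rule SUP_upper2[where i = t]) (auto intro: SUP_upper)

lemma psi2_norm_le_kappa_star:
  "psi2_norm M (\<lambda>\<omega>. norm2 p (Y t \<omega>)) \<le> kappa_star M p Y"
proof -
  have "psi2_norm M (\<lambda>\<omega>. norm2 p (Y t \<omega>)) \<le> (SUP v\<in>sign_sphere p. psi2_norm M (\<lambda>\<omega>. dotp p v (Y t \<omega>)))"
    using Y_measurable by (intro psi2_norm_norm2_le measurable_Rp_component)
  also have "\<dots> \<le> kappa_star M p Y"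
    unfolding kappa_star_def by (rule SUP_upper) simp
  finally show ?thesis .
qed

text \<open>Cauchy-Schwarz for a unit direction. It serves to infer that \<open>kappa_star\<close>
  is positive when \<open>kappa1\<close> is nonzero, so that the constant in (A2) is
  positive.\<close>

lemma kappa1_le_kappa_star: "kappa1 M p Y \<le> kappa_star M p Y"
  unfolding kappa1_def
proof (intro SUP_least)
  fix t u assume u: "u \<in> unit_sphere p"
  have "psi2_norm M (\<lambda>\<omega>. dotp p u (Y t \<omega>)) \<le> psi2_norm M (\<lambda>\<omega>. norm2 p (Y t \<omega>))"
  proof (rule psi2_norm_mono)
    show "AE \<omega> in M. \<bar>dotp p u (Y t \<omega>)\<bar> \<le> \<bar>norm2 p (Y t \<omega>)\<bar>"
      using abs_dotp_le[of p u] u by (auto simp: unit_sphere_def intro: order_trans)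
  qed (auto intro!: measurable_norm2 measurable_dotp measurable_Rp_component Y_measurable)
  also have "\<dots> \<le> kappa_star M p Y"
    by (rule psi2_norm_le_kappa_star)
  finally show "psi2_norm M (\<lambda>\<omega>. dotp p u (Y t \<omega>)) \<le> kappa_star M p Y" .
qed

text \<open>Centring is assumed of \<open>Y\<close>, whereas the sub-Gaussian bound needs it for the
  terms of the moving average. Solving the recursion for \<open>E\<close> expresses it linearly
  through \<open>Y\<close> and transfers the zero mean.\<close>

lemma assumption_A4:
  assumes mean: "mean_zero M p Y" and c: "0 < c"
    and psi2: "\<And>t u. psi2_norm M (\<lambda>\<omega>. dotp p u (E t \<omega>)) \<le> ennreal c * L_norm M 2 (\<lambda>\<omega>. dotp p u (E t \<omega>))"
  shows "assumption_A4 M p Y (16 / 3 * c\<^sup>2)"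
  unfolding assumption_A4_def
proof (intro allI)
  fix t u
  have int_Y: "integrable M (\<lambda>\<omega>. dotp p v (Y s \<omega>))" for v s
  proof (rule square_integrable_imp_integrable)
    define b where "b = norm2 p v + 1"
    have b: "norm2 p v \<le> b" "0 < b"
      by (auto simp: b_def intro: add_nonneg_pos L2_set_nonneg)
    show "integrable M (\<lambda>\<omega>. (dotp p v (Y s \<omega>))\<^sup>2)"
      using b D1(1) r
      by (intro orlicz_le_psi2_integrable(1)[OF _ orlicz_le_Y[OF b]] measurable_dotp Y_measurable) auto
  qed (rule measurable_dotp[OF Y_measurable])
  have dotp_unit: "dotp p (\<lambda>l. if l = i then 1 else 0) x = x i" if "i < p" for i and x :: "nat \<Rightarrow> real"
    using that by (simp add: dotp_def if_distrib[where f = "\<lambda>c. c * _"] cong: if_cong)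
  have int_Yi: "integrable M (\<lambda>\<omega>. Y s \<omega> i)" if "i < p" for s i
    using int_Y[of "\<lambda>l. if l = i then 1 else 0" s] that by (simp add: dotp_unit)
  have mat_Y: "integrable M (\<lambda>\<omega>. mat_app (A k) (Y s \<omega>) i)" "expectation (\<lambda>\<omega>. mat_app (A k) (Y s \<omega>) i) = 0"
    if "k \<in> {1..d}" for k s i
    using A_carrier[OF that] int_Yi mean by (auto simp: mat_app_def mean_zero_def)
  have E_i: "integrable M (\<lambda>\<omega>. E s \<omega> i)" "expectation (\<lambda>\<omega>. E s \<omega> i) = 0" if i: "i < p" for s i
  proof -
    define Z where "Z \<omega> = Y s \<omega> i - (\<Sum>k = 1..d. mat_app (A k) (Y (s - int k) \<omega>) i)" for \<omega>
    have AE: "AE \<omega> in M. E s \<omega> i = Z \<omega>"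
      using Y_recursion[of s] by eventually_elim (use i in \<open>simp add: Z_def\<close>)
    have Z1: "integrable M Z"
      unfolding Z_def
      by (intro Bochner_Integration.integrable_diff Bochner_Integration.integrable_sum int_Yi[OF i] mat_Y(1))
    have "expectation Z = expectation (\<lambda>\<omega>. Y s \<omega> i) -
        expectation (\<lambda>\<omega>. \<Sum>k = 1..d. mat_app (A k) (Y (s - int k) \<omega>) i)"
      unfolding Z_def
      by (intro Bochner_Integration.integral_diff Bochner_Integration.integrable_sum int_Yi[OF i] mat_Y(1))
    also have "expectation (\<lambda>\<omega>. \<Sum>k = 1..d. mat_app (A k) (Y (s - int k) \<omega>) i) =
        (\<Sum>k = 1..d. expectation (\<lambda>\<omega>. mat_app (A k) (Y (s - int k) \<omega>) i))"
      by (intro Bochner_Integration.integral_sum mat_Y(1))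
    also have "\<dots> = 0"
      by (intro sum.neutral ballI mat_Y(2))
    finally have Z2: "expectation Z = 0"
      using mean i by (simp add: mean_zero_def)
    have m: "(\<lambda>\<omega>. E s \<omega> i) \<in> borel_measurable M"
      by (rule measurable_Rp_component[OF E_measurable i])
    show "integrable M (\<lambda>\<omega>. E s \<omega> i)"
      using integrable_cong_AE[OF m _ AE] Z1 Z2 by auto
    show "expectation (\<lambda>\<omega>. E s \<omega> i) = 0"
      using integral_cong_AE[OF m _ AE] Z1 Z2 by auto
  qed
  define b where "b = norm2 p u + 1"
  have b: "norm2 p u \<le> b" "0 < b"
    by (auto simp: b_def intro: add_nonneg_pos L2_set_nonneg)
  define w where "w n = mat_app (transpose_mat (ma_coeff p d A n)) u" for n
  show "(psi2_norm M (\<lambda>\<omega>. dotp p u (Y t \<omega>)))\<^sup>2 \<le>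
      ennreal (16 / 3 * c\<^sup>2) * (\<integral>\<^sup>+ \<omega>. ennreal ((dotp p u (Y t \<omega>))\<^sup>2) \<partial>M)"
  proof (rule psi2_norm_sums_le[where X = "\<lambda>n \<omega>. dotp p (w n) (E (t - int n) \<omega>)" and k = "\<lambda>n. r ^ n * (b * D1)"])
    have "indep_vars (\<lambda>n. Rp p) (\<lambda>n. E (t - int n)) UNIV"
      by (rule indep_vars_reindex_inj[where M' = "\<lambda>_. Rp p" and X = E])
        (auto intro: inj_onI indep_vars_subset[OF indep])
    from indep_vars_compose2[OF this, where N = "\<lambda>_. borel" and Y = "\<lambda>n. dotp p (w n)"]
    show "indep_vars (\<lambda>_. borel) (\<lambda>n \<omega>. dotp p (w n) (E (t - int n) \<omega>)) UNIV"
      using measurable_dotp[OF measurable_ident] by auto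
    show "expectation (\<lambda>\<omega>. dotp p (w n) (E (t - int n) \<omega>)) = 0" for n
      unfolding dotp_def using E_i by (subst Bochner_Integration.integral_sum) auto
    show "orlicz_le M psi2_fun (\<lambda>\<omega>. dotp p (w n) (E (t - int n) \<omega>)) (r ^ n * (b * D1))" for n
      unfolding w_def by (rule orlicz_le_MA_term[OF b])
    show "summable (\<lambda>n. r ^ n * (b * D1))"
      using r by (intro summable_mult2 summable_geometric) auto
    show "AE \<omega> in M. (\<lambda>n. dotp p (w n) (E (t - int n) \<omega>)) sums dotp p u (Y t \<omega>)"
      unfolding w_def by (rule dotp_Y_series)
  qed (use r b D1 c psi2 measurable_dotp[OF Y_measurable] in auto)
qed

end

section \<open>The coupling\<close>

text \<open>\<open>P\<close> plays the past, \<open>Q\<close> the later innovations, and the second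
  coordinate is a fresh copy of the past. The three are independent, so copy and \<open>Q\<close>
  together have the law of \<open>(P, Q)\<close>, and \<open>P\<close> is independent of anything
  computed from them. One type serves \<open>S\<close> and \<open>T\<close> because both path spaces
  share it.\<close>

lemma (in prob_space) indep_copy:
  fixes P Q :: "'a \<Rightarrow> 'b" and S T :: "'b measure"
  assumes indep: "indep_var S P T Q"
  defines "N \<equiv> distr M S P"
  defines "G \<equiv> \<lambda>z :: 'a \<times> 'b. (snd z, Q (fst z))"
  shows "distr (M \<Otimes>\<^sub>M N) (S \<Otimes>\<^sub>M T) G = distr M (S \<Otimes>\<^sub>M T) (\<lambda>\<omega>. (P \<omega>, Q \<omega>))"
    and "\<And>h L. h \<in> S \<Otimes>\<^sub>M T \<rightarrow>\<^sub>M L \<Longrightarrow>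
      prob_space.indep_var (M \<Otimes>\<^sub>M N) S (\<lambda>z. P (fst z)) L (\<lambda>z. h (G z))"
proof -
  have [measurable]: "P \<in> M \<rightarrow>\<^sub>M S" "Q \<in> M \<rightarrow>\<^sub>M T"
    using indep by (auto dest: indep_var_rv1 indep_var_rv2)
  have sets_N [measurable_cong]: "sets N = sets S" and space_N: "space N = space S"
    by (auto simp: N_def)
  interpret N: prob_space N
    unfolding N_def by (rule prob_space_distr) simp
  interpret MN: pair_prob_space M N ..
  interpret Q: prob_space "distr M T Q"
    by (rule prob_space_distr) simp
  have [measurable]: "G \<in> M \<Otimes>\<^sub>M N \<rightarrow>\<^sub>M S \<Otimes>\<^sub>M T" "(\<lambda>z. P (fst z)) \<in> M \<Otimes>\<^sub>M N \<rightarrow>\<^sub>M S"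
    unfolding G_def by measurable
  \<comment> \<open>Equality is checked on rectangles, where \<open>G\<close> decouples into a
    condition on \<open>Q\<close> and one on the second coordinate.\<close>
  have "N \<Otimes>\<^sub>M distr M T Q = distr (M \<Otimes>\<^sub>M N) (S \<Otimes>\<^sub>M T) G"
  proof (rule pair_measure_eqI)
    fix A B assume "A \<in> sets N" "B \<in> sets (distr M T Q)"
    then have A [measurable]: "A \<in> sets S" and B [measurable]: "B \<in> sets T"
      by (auto simp: sets_N)
    have "G -` (A \<times> B) \<inter> space (M \<Otimes>\<^sub>M N) = (Q -` B \<inter> space M) \<times> A"
      using sets.sets_into_space[OF A] by (auto simp: G_def space_pair_measure space_N)
    then have "emeasure (distr (M \<Otimes>\<^sub>M N) (S \<Otimes>\<^sub>M T) G) (A \<times> B) = emeasure M (Q -` B \<inter> space M) * emeasure N A"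
      using A B by (simp add: emeasure_distr sets_N N.emeasure_pair_measure_Times)
    then show "emeasure N A * emeasure (distr M T Q) B = emeasure (distr (M \<Otimes>\<^sub>M N) (S \<Otimes>\<^sub>M T) G) (A \<times> B)"
      by (simp add: emeasure_distr mult.commute)
  qed (auto intro: N.sigma_finite_measure_axioms Q.sigma_finite_measure_axioms
      simp: sets_N cong: sets_pair_measure_cong)
  then show "distr (M \<Otimes>\<^sub>M N) (S \<Otimes>\<^sub>M T) G = distr M (S \<Otimes>\<^sub>M T) (\<lambda>\<omega>. (P \<omega>, Q \<omega>))"
    using indep by (simp add: indep_var_distribution_eq N_def)
  have prod: "distr (M \<Otimes>\<^sub>M N) S (\<lambda>z. P (fst z)) \<Otimes>\<^sub>M distr (M \<Otimes>\<^sub>M N) (S \<Otimes>\<^sub>M T) G =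
      distr (M \<Otimes>\<^sub>M N) (S \<Otimes>\<^sub>M (S \<Otimes>\<^sub>M T)) (\<lambda>z. (P (fst z), G z))"
  proof (rule pair_measure_eqI)
    fix A B assume "A \<in> sets (distr (M \<Otimes>\<^sub>M N) S (\<lambda>z. P (fst z)))" "B \<in> sets (distr (M \<Otimes>\<^sub>M N) (S \<Otimes>\<^sub>M T) G)"
    then have A [measurable]: "A \<in> sets S" and B [measurable]: "B \<in> sets (S \<Otimes>\<^sub>M T)"
      by auto
    \<comment> \<open>For a frozen copy \<open>\<nu>\<close> the condition on \<open>G\<close>
      concerns \<open>Q\<close> alone, so independence of \<open>P\<close> and \<open>Q\<close>
      factorises the section; integrating over \<open>\<nu>\<close> gives the product.\<close>
    have slice: "emeasure M ((\<lambda>\<omega>. (\<omega>, \<nu>)) -` ((\<lambda>z. (P (fst z), G z)) -` (A' \<times> B) \<inter> space (M \<Otimes>\<^sub>M N))) =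
        emeasure M (P -` A' \<inter> space M) * emeasure M (Q -` (Pair \<nu> -` B) \<inter> space M)"
      if \<nu>: "\<nu> \<in> space N" and A': "A' \<in> sets S" for \<nu> A'
    proof -
      have "(\<lambda>\<omega>. (\<omega>, \<nu>)) -` ((\<lambda>z. (P (fst z), G z)) -` (A' \<times> B) \<inter> space (M \<Otimes>\<^sub>M N)) =
          (\<lambda>\<omega>. (P \<omega>, Q \<omega>)) -` (A' \<times> (Pair \<nu> -` B)) \<inter> space M"
        using \<nu> by (auto simp: G_def space_pair_measure)
      then show ?thesis
        using indep_varD[OF indep A' sets_Pair1[OF B]]
        by (simp add: emeasure_eq_measure ennreal_mult)
    qed
    have B1: "emeasure (distr (M \<Otimes>\<^sub>M N) (S \<Otimes>\<^sub>M T) G) B = (\<integral>\<^sup>+ \<nu>. emeasure M (Q -` (Pair \<nu> -` B) \<inter> space M) \<partial>N)"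
    proof -
      have "G -` B \<inter> space (M \<Otimes>\<^sub>M N) = (\<lambda>z. (P (fst z), G z)) -` (space S \<times> B) \<inter> space (M \<Otimes>\<^sub>M N)"
        using measurable_space[OF \<open>P \<in> M \<rightarrow>\<^sub>M S\<close>] by (auto simp: space_pair_measure)
      moreover have "P -` space S \<inter> space M = space M"
        using measurable_space[OF \<open>P \<in> M \<rightarrow>\<^sub>M S\<close>] by auto
      ultimately show ?thesis
        by (simp add: emeasure_distr MN.emeasure_pair_measure_alt2 slice emeasure_space_1 del: vimage_Int cong: nn_integral_cong)
    qed
    have [measurable]: "(\<lambda>\<nu>. emeasure M (Q -` (Pair \<nu> -` B) \<inter> space M)) \<in> borel_measurable N"
    proof -
      have "(\<lambda>\<nu>. emeasure (distr M T Q) (Pair \<nu> -` B)) \<in> borel_measurable N"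
        by (rule Q.measurable_emeasure_Pair) (use B in \<open>simp cong: sets_pair_measure_cong add: sets_N\<close>)
      then show ?thesis
        using sets_Pair1[OF B] by (simp add: emeasure_distr)
    qed
    have "emeasure (distr (M \<Otimes>\<^sub>M N) (S \<Otimes>\<^sub>M (S \<Otimes>\<^sub>M T)) (\<lambda>z. (P (fst z), G z))) (A \<times> B) =
        (\<integral>\<^sup>+ \<nu>. emeasure M (P -` A \<inter> space M) * emeasure M (Q -` (Pair \<nu> -` B) \<inter> space M) \<partial>N)"
      using A B by (simp add: emeasure_distr MN.emeasure_pair_measure_alt2 slice del: vimage_Int cong: nn_integral_cong)
    also have "\<dots> = emeasure M (P -` A \<inter> space M) * emeasure (distr (M \<Otimes>\<^sub>M N) (S \<Otimes>\<^sub>M T) G) B"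
      unfolding B1 by (rule nn_integral_cmult) measurable
    also have "emeasure M (P -` A \<inter> space M) = emeasure (distr (M \<Otimes>\<^sub>M N) S (\<lambda>z. P (fst z))) A"
    proof -
      have "(\<lambda>z. P (fst z)) -` A \<inter> space (M \<Otimes>\<^sub>M N) = (P -` A \<inter> space M) \<times> space N"
        by (auto simp: space_pair_measure)
      then show ?thesis
        by (simp add: emeasure_distr N.emeasure_pair_measure_Times N.emeasure_space_1)
    qed
    finally show "emeasure (distr (M \<Otimes>\<^sub>M N) S (\<lambda>z. P (fst z))) A * emeasure (distr (M \<Otimes>\<^sub>M N) (S \<Otimes>\<^sub>M T) G) B =
        emeasure (distr (M \<Otimes>\<^sub>M N) (S \<Otimes>\<^sub>M (S \<Otimes>\<^sub>M T)) (\<lambda>z. (P (fst z), G z))) (A \<times> B)" ..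
  qed (auto intro!: prob_space_imp_sigma_finite MN.prob_space_distr cong: sets_pair_measure_cong)
  fix h :: "'b \<times> 'b \<Rightarrow> 'b" and L
  assume h [measurable]: "h \<in> S \<Otimes>\<^sub>M T \<rightarrow>\<^sub>M L"
  have hG: "(\<lambda>z. h (G z)) \<in> M \<Otimes>\<^sub>M N \<rightarrow>\<^sub>M L"
    by measurable
  let ?D1 = "distr (M \<Otimes>\<^sub>M N) S (\<lambda>z. P (fst z))" and ?D2 = "distr (M \<Otimes>\<^sub>M N) (S \<Otimes>\<^sub>M T) G"
  have D2: "distr ?D2 L h = distr (M \<Otimes>\<^sub>M N) L (\<lambda>z. h (G z))"
    by (subst distr_distr) (auto simp: comp_def)
  have "?D1 \<Otimes>\<^sub>M distr (M \<Otimes>\<^sub>M N) L (\<lambda>z. h (G z)) = distr ?D1 S (\<lambda>x. x) \<Otimes>\<^sub>M distr ?D2 L h"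
    unfolding D2 by (subst distr_distr) (auto simp: comp_def)
  also have "\<dots> = distr (?D1 \<Otimes>\<^sub>M ?D2) (S \<Otimes>\<^sub>M L) (\<lambda>(x, y). (x, h y))"
    unfolding D2[symmetric]
    by (rule pair_measure_distr)
      (auto simp: D2 intro!: prob_space_imp_sigma_finite MN.prob_space_distr hG)
  also have "\<dots> = distr (M \<Otimes>\<^sub>M N) (S \<Otimes>\<^sub>M L) (\<lambda>z. (P (fst z), h (G z)))"
    unfolding prod by (subst distr_distr) (auto simp: comp_def)
  finally show "MN.indep_var S (\<lambda>z. P (fst z)) L (\<lambda>z. h (G z))"
    unfolding MN.indep_var_distribution_eq using hG by simp
qed

text \<open>The recursion as a deterministic map of a past \<open>y\<close> and innovations
  \<open>e\<close>. \<open>Y\<close> and its copy are this map at different pasts with equal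
  innovations, which yields equality in law and an innovation-free difference. Restricting to
  indices below \<open>p\<close> places the generated values in the extensional functions underlying
  \<open>Rp p\<close>.\<close>

function rerun :: "nat \<Rightarrow> nat \<Rightarrow> (nat \<Rightarrow> real mat) \<Rightarrow> int \<Rightarrow> (int \<Rightarrow> nat \<Rightarrow> real) \<Rightarrow>
    (int \<Rightarrow> nat \<Rightarrow> real) \<Rightarrow> int \<Rightarrow> nat \<Rightarrow> real" where
  "rerun p d A j y e t = (if t \<le> j then y t else
     (\<lambda>i\<in>{..<p}. (\<Sum>k\<in>{1..d}. mat_app (A k) (rerun p d A j y e (t - int k)) i) + e t i))"
  by pat_completeness auto
termination
  by (relation "Wellfounded.measure (\<lambda>(p, d, A, j, y, e, t). nat (t - j))") auto

declare rerun.simps [simp del]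

lemma rerun_past: "t \<le> j \<Longrightarrow> rerun p d A j y e t = y t"
  by (simp add: rerun.simps)

lemma rerun_future:
  "j < t \<Longrightarrow> i < p \<Longrightarrow> rerun p d A j y e t i = (\<Sum>k = 1..d. mat_app (A k) (rerun p d A j y e (t - int k)) i) + e t i"
  by (subst rerun.simps) simp

lemma measurable_path_component: "t \<in> T \<Longrightarrow> (\<lambda>y. y t) \<in> path_space p T \<rightarrow>\<^sub>M Rp p"
  unfolding path_space_def by (rule measurable_component_singleton)

lemma measurable_path:
  "(\<And>t. t \<in> T \<Longrightarrow> X t \<in> M \<rightarrow>\<^sub>M Rp p) \<Longrightarrow> path T X \<in> M \<rightarrow>\<^sub>M path_space p T"
  unfolding path_space_def path_def [abs_def] by (rule measurable_restrict)

lemma measurable_rerun: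
  assumes A: "\<And>k. k \<in> {1..d} \<Longrightarrow> A k \<in> carrier_mat p p"
  shows "(\<lambda>z. rerun p d A j (fst z) (snd z) t) \<in> path_space p {..j} \<Otimes>\<^sub>M path_space p {j<..} \<rightarrow>\<^sub>M Rp p"
proof (induction "nat (t - j)" arbitrary: t rule: less_induct)
  case less
  show ?case
  proof (cases "t \<le> j")
    case True
    then show ?thesis
      using measurable_compose[OF measurable_fst measurable_path_component[of t "{..j}" p]]
      by (simp add: rerun_past)
  next
    case False
    have "(\<lambda>z. snd z t) \<in> path_space p {..j} \<Otimes>\<^sub>M path_space p {j<..} \<rightarrow>\<^sub>M Rp p"
      using False by (intro measurable_compose[OF measurable_snd measurable_path_component]) auto
    then have "(\<lambda>z. \<lambda>i\<in>{..<p}. (\<Sum>k\<in>{1..d}. mat_app (A k) (rerun p d A j (fst z) (snd z) (t - int k)) i) + snd z t i)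
        \<in> path_space p {..j} \<Otimes>\<^sub>M path_space p {j<..} \<rightarrow>\<^sub>M Rp p"
      using False
      by (intro measurable_restrict borel_measurable_add borel_measurable_sum measurable_mat_app[where p = p] less A)
        (auto intro: measurable_Rp_component)
    then show ?thesis
      using False by (subst rerun.simps) simp
  qed
qed

context var_model
begin

lemma Y_extensional: "\<omega> \<in> space M \<Longrightarrow> Y t \<omega> \<in> extensional {..<p}"
  using measurable_space[OF Y_measurable, of \<omega> t] by (auto simp: space_PiM PiE_def)

text \<open>The recursion holds almost surely at each time; as the times are countable, one null set
  serves all \<open>t\<close>. At indices from \<open>p\<close> on, the two functions agree because
  both are extensional.\<close>

lemma Y_eq_rerun:
  "AE \<omega> in M. \<forall>t. Y t \<omega> = rerun p d A j (path {..j} Y \<omega>) (path {j<..} E \<omega>) t"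
proof -
  have "AE \<omega> in M. \<forall>t. \<forall>i<p. Y t \<omega> i = (\<Sum>k = 1..d. mat_app (A k) (Y (t - int k) \<omega>) i) + E t \<omega> i"
    using Y_recursion by (simp add: AE_all_countable)
  then show ?thesis
    using AE_space
  proof eventually_elim
    case (elim \<omega>)
    show ?case
    proof
      fix t
      show "Y t \<omega> = rerun p d A j (path {..j} Y \<omega>) (path {j<..} E \<omega>) t"
      proof (induction "nat (t - j)" arbitrary: t rule: less_induct)
        case less
        show ?case
        proof (cases "t \<le> j")
          case True
          then show ?thesis
            by (simp add: rerun_past path_def)
        next
          case False
          show ?thesis
          proof
            fix i
            show "Y t \<omega> i = rerun p d A j (path {..j} Y \<omega>) (path {j<..} E \<omega>) t i"
            proof (cases "i < p")
              case True
              have "mat_app (A k) (Y (t - int k) \<omega>) i =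
                  mat_app (A k) (rerun p d A j (path {..j} Y \<omega>) (path {j<..} E \<omega>) (t - int k)) i"
                if "k \<in> {1..d}" for k
                using less[of "t - int k"] that False by auto
              then have "(\<Sum>k = 1..d. mat_app (A k) (Y (t - int k) \<omega>) i) =
                  (\<Sum>k = 1..d. mat_app (A k) (rerun p d A j (path {..j} Y \<omega>) (path {j<..} E \<omega>) (t - int k)) i)"
                by (rule sum.cong[OF refl])
              then show ?thesis
                using True False elim(1) by (simp add: rerun_future) (simp add: path_def)
            next
              case i: False
              then show ?thesis
                using False Y_extensional[OF elim(2), of t] by (subst rerun.simps) (simp add: extensional_def)
            qed
          qed
        qed
      qed
    qed
  qed
qed

text \<open>By the moving average the past of \<open>Y\<close> is a measurable function of the past
  of \<open>E\<close>, and disjoint blocks of independent innovations are independent. This is where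
  causality enters.\<close>

lemma indep_past_Y_future_E:
  "indep_var (path_space p {..j}) (path {..j} Y) (path_space p {j<..}) (path {j<..} E)"
proof -
  \<comment> \<open>\<open>suminf\<close> is total, so \<open>F\<close> is measurable everywhere;
    its value at divergent series matters on a null set only.\<close>
  define F where "F x = (\<lambda>t\<in>{..j}. \<lambda>i\<in>{..<p}. \<Sum>n. mat_app (ma_coeff p d A n) (x (t - int n)) i)"
    for x :: "int \<Rightarrow> nat \<Rightarrow> real"
  have F: "F \<in> path_space p {..j} \<rightarrow>\<^sub>M path_space p {..j}"
    unfolding F_def [abs_def] path_space_def[of p "{..j}"]
    by (intro measurable_restrict borel_measurable_suminf measurable_mat_app ma_coeff_carrier
        measurable_component_singleton) auto
  have "indep_var (path_space p {..j}) (path {..j} E) (path_space p {j<..}) (path {j<..} E)"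
    unfolding path_space_def path_def [abs_def] using indep by (rule indep_var_restrict) auto
  from indep_var_compose[OF this F measurable_ident]
  have "indep_var (path_space p {..j}) (F \<circ> path {..j} E) (path_space p {j<..}) (path {j<..} E)"
    by simp
  then show ?thesis
  proof (rule indep_var_cong_AE)
    show "path {..j} Y \<in> M \<rightarrow>\<^sub>M path_space p {..j}"
      by (intro measurable_path Y_measurable)
    have "AE \<omega> in M. \<forall>t. \<forall>i<p. (\<lambda>n. mat_app (ma_coeff p d A n) (E (t - int n) \<omega>) i) sums Y t \<omega> i"
      using Y_series by (simp add: AE_all_countable)
    then show "AE \<omega> in M. (F \<circ> path {..j} E) \<omega> = path {..j} Y \<omega>"
      using AE_space
    proof eventually_elim
      case (elim \<omega>)
      have eq: "(\<lambda>i\<in>{..<p}. \<Sum>n. mat_app (ma_coeff p d A n) (E (t - int n) \<omega>) i) = Y t \<omega>" for t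
        using elim(1) Y_extensional[OF elim(2), of t]
        by (auto simp: fun_eq_iff extensional_def restrict_def sums_iff)
      show ?case
      proof
        show "(F \<circ> path {..j} E) \<omega> t = path {..j} Y \<omega> t" for t
          by (cases "t \<le> j") (simp_all add: F_def path_def eq)
      qed
    qed
  qed
qed

text \<open>\<open>Y'\<close> is defined also at times up to \<open>j\<close>, where it is the fresh
  past itself; equality of laws at all times supplies the initial bounds of the error
  recursion.\<close>

lemma coupling:
  obtains N :: "(int \<Rightarrow> nat \<Rightarrow> real) measure" and Y' where
    "independent_future_copy M p Y j N Y'"
    "\<And>t. Y' t \<in> M \<Otimes>\<^sub>M N \<rightarrow>\<^sub>M Rp p"
    "\<And>t. distr (M \<Otimes>\<^sub>M N) (Rp p) (Y' t) = distr M (Rp p) (Y t)"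
    "\<And>t. j < t \<Longrightarrow> AE z in M \<Otimes>\<^sub>M N. \<forall>i<p. Y t (fst z) i - Y' t z i =
      (\<Sum>k = 1..d. mat_app (A k) (\<lambda>l. Y (t - int k) (fst z) l - Y' (t - int k) z l) i)"
proof -
  let ?S = "path_space p {..j}" and ?T = "path_space p {j<..}"
  define P Q where "P = path {..j} Y" and "Q = path {j<..} E"
  define N where "N = distr M ?S P"
  define G where "G z = (snd z, Q (fst z))" for z :: "'w \<times> (int \<Rightarrow> nat \<Rightarrow> real)"
  define R where "R t z = rerun p d A j (fst z) (snd z) t" for t and z :: "(int \<Rightarrow> nat \<Rightarrow> real) \<times> (int \<Rightarrow> nat \<Rightarrow> real)"
  define Y' where "Y' t z = R t (G z)" for t z
  have indep_PQ: "indep_var ?S P ?T Q"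
    unfolding P_def Q_def by (rule indep_past_Y_future_E)
  have PQ [measurable]: "P \<in> M \<rightarrow>\<^sub>M ?S" "Q \<in> M \<rightarrow>\<^sub>M ?T"
    using indep_PQ by (auto dest: indep_var_rv1 indep_var_rv2)
  have sets_N [measurable_cong]: "sets N = sets ?S"
    by (simp add: N_def)
  interpret N: prob_space N
    unfolding N_def by (rule prob_space_distr) simp
  interpret MN: pair_prob_space M N ..
  have G [measurable]: "G \<in> M \<Otimes>\<^sub>M N \<rightarrow>\<^sub>M ?S \<Otimes>\<^sub>M ?T"
    unfolding G_def by measurable
  have R [measurable]: "R t \<in> ?S \<Otimes>\<^sub>M ?T \<rightarrow>\<^sub>M Rp p" for t
    unfolding R_def using A_carrier by (rule measurable_rerun)
  have Y' [measurable]: "Y' t \<in> M \<Otimes>\<^sub>M N \<rightarrow>\<^sub>M Rp p" for t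
    unfolding Y'_def by measurable
  note copy = indep_copy[OF indep_PQ, folded N_def G_def]
  \<comment> \<open>A functional of fresh past and innovations has the law of the same functional of
    true past and innovations; for the rerun the latter is \<open>Y\<close> almost surely.\<close>
  have law: "distr (M \<Otimes>\<^sub>M N) L (\<lambda>z. h (G z)) = distr M L (\<lambda>\<omega>. h (P \<omega>, Q \<omega>))"
    if h [measurable]: "h \<in> ?S \<Otimes>\<^sub>M ?T \<rightarrow>\<^sub>M L" for h and L :: "'l measure"
  proof -
    have "distr (M \<Otimes>\<^sub>M N) L (\<lambda>z. h (G z)) = distr (distr (M \<Otimes>\<^sub>M N) (?S \<Otimes>\<^sub>M ?T) G) L h"
      by (subst distr_distr) (auto simp: comp_def)
    also have "\<dots> = distr M L (\<lambda>\<omega>. h (P \<omega>, Q \<omega>))"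
      unfolding copy(1) by (subst distr_distr) (auto simp: comp_def)
    finally show ?thesis .
  qed
  have R_eq: "AE \<omega> in M. \<forall>t. R t (P \<omega>, Q \<omega>) = Y t \<omega>"
    using Y_eq_rerun[of j] by eventually_elim (simp add: R_def P_def Q_def)
  have path_R: "path {j<..} R \<in> ?S \<Otimes>\<^sub>M ?T \<rightarrow>\<^sub>M ?T"
    by (intro measurable_path R)
  have path_Y': "path {j<..} Y' = (\<lambda>z. path {j<..} R (G z))"
    by (simp add: fun_eq_iff path_def Y'_def restrict_def)
  show thesis
  proof
    show "independent_future_copy M p Y j N Y'"
      unfolding independent_future_copy_def
    proof (intro conjI allI impI)
      show "prob_space N"
        by (rule N.prob_space_axioms)
      have "MN.indep_var ?S (\<lambda>z. P (fst z)) ?T (\<lambda>z. path {j<..} R (G z))"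
        by (rule copy(2)[OF path_R])
      moreover have "path {..j} (\<lambda>t z. Y t (fst z)) = (\<lambda>z :: 'w \<times> (int \<Rightarrow> nat \<Rightarrow> real). P (fst z))"
        by (simp add: fun_eq_iff path_def P_def restrict_def)
      ultimately show "MN.indep_var ?S (path {..j} (\<lambda>t \<omega>. Y t (fst \<omega>))) ?T (path {j<..} Y')"
        by (simp add: comp_def path_Y')
      have "distr (M \<Otimes>\<^sub>M N) ?T (path {j<..} Y') = distr M ?T (\<lambda>\<omega>. path {j<..} R (P \<omega>, Q \<omega>))"
        unfolding path_Y' by (rule law[OF path_R])
      also have "\<dots> = distr M ?T (path {j<..} Y)"
      proof (rule distr_cong_AE)
        show "AE \<omega> in M. path {j<..} R (P \<omega>, Q \<omega>) = path {j<..} Y \<omega>"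
          using R_eq by eventually_elim (simp add: path_def)
        show "(\<lambda>\<omega>. path {j<..} R (P \<omega>, Q \<omega>)) \<in> M \<rightarrow>\<^sub>M ?T"
          using path_R by measurable
        show "path {j<..} Y \<in> M \<rightarrow>\<^sub>M ?T"
          by (intro measurable_path Y_measurable)
      qed auto
      finally show "distr (M \<Otimes>\<^sub>M N) ?T (path {j<..} Y') = distr M ?T (path {j<..} Y)" .
    qed (rule Y')
    show "distr (M \<Otimes>\<^sub>M N) (Rp p) (Y' t) = distr M (Rp p) (Y t)" for t
    proof -
      have "distr (M \<Otimes>\<^sub>M N) (Rp p) (Y' t) = distr M (Rp p) (\<lambda>\<omega>. R t (P \<omega>, Q \<omega>))"
        unfolding Y'_def by (rule law[OF R])
      also have "\<dots> = distr M (Rp p) (Y t)"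
        using R_eq by (intro distr_cong_AE) (auto intro: Y_measurable)
      finally show ?thesis .
    qed
    show "AE z in M \<Otimes>\<^sub>M N. \<forall>i<p. Y t (fst z) i - Y' t z i =
        (\<Sum>k = 1..d. mat_app (A k) (\<lambda>l. Y (t - int k) (fst z) l - Y' (t - int k) z l) i)" if t: "j < t" for t
    proof -
      \<comment> \<open>The recursion of \<open>Y\<close> is lifted along \<open>fst\<close>;
        subtracting the rerun cancels \<open>E t\<close>.\<close>
      have "AE \<omega> in distr (M \<Otimes>\<^sub>M N) M fst.
          \<forall>i<p. Y t \<omega> i = (\<Sum>k = 1..d. mat_app (A k) (Y (t - int k) \<omega>) i) + E t \<omega> i"
        unfolding N.distr_pair_fst[OF sigma_finite_measure_axioms] by (rule Y_recursion)
      from AE_distrD[OF measurable_fst this] show ?thesis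
        by eventually_elim
          (use t in \<open>auto simp: Y'_def R_def G_def Q_def path_def rerun_future mat_app_diff sum_subtractf\<close>)
    qed
  qed (rule Y')
qed

end

section \<open>Decay of the coupling error\<close>

lemma exp_ln_inverse_mult: "0 < r \<Longrightarrow> exp (- ln (inverse r) * real_of_int (int n)) = r ^ n"
  using powr_realpow[of r n] by (simp add: powr_def ln_inverse mult.commute)

lemma norm2_diff_le: "norm2 p (\<lambda>i. x i - y i) \<le> norm2 p x + norm2 p y"
  using L2_set_triangle_ineq[of x "\<lambda>i. - 1 * y i" "{..<p}"] norm2_cmult[of "- 1" y p] by simp

text \<open>Homogeneity in the direction: a transposed matrix changes the length of a unit
  direction, and this leads back to the supremum over the unit sphere.\<close>

lemma L_norm_dotp_le:
  assumes q: "1 \<le> q" and X: "\<And>u. (\<lambda>\<omega>. dotp p (X \<omega>) u) \<in> borel_measurable M"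
  shows "L_norm M q (\<lambda>\<omega>. dotp p (X \<omega>) w) \<le>
    ennreal (norm2 p w) * (SUP u\<in>unit_sphere p. L_norm M q (\<lambda>\<omega>. dotp p (X \<omega>) u))"
proof (cases "norm2 p w = 0")
  case True
  then show ?thesis
    using norm2_eq_0D[OF True] q by (simp add: L_norm_def dotp_def)
next
  case False
  then obtain u where u: "u \<in> unit_sphere p" "w = (\<lambda>i. norm2 p w * u i)"
    by (rule normalize_unit_sphere)
  have "dotp p x w = norm2 p w * dotp p x u" for x
    using dotp_cmult[of p "norm2 p w" u x] unfolding u(2)[symmetric] by (simp add: dotp_commute[of p x])
  then have "L_norm M q (\<lambda>\<omega>. dotp p (X \<omega>) w) \<le> ennreal \<bar>norm2 p w\<bar> * L_norm M q (\<lambda>\<omega>. dotp p (X \<omega>) u)"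
    using L_norm_cmult[OF q X, of "norm2 p w" u] by simp
  also have "\<dots> \<le> ennreal (norm2 p w) * (SUP u\<in>unit_sphere p. L_norm M q (\<lambda>\<omega>. dotp p (X \<omega>) u))"
    using u(1) by (intro mult_mono SUP_upper) (auto simp: L2_set_nonneg)
  finally show ?thesis .
qed

context var_model
begin

lemma decay_bound:
  fixes x :: "int \<Rightarrow> ennreal"
  assumes "\<And>t. t \<le> j \<Longrightarrow> x t \<le> B"
    and "\<And>t. j < t \<Longrightarrow> x t \<le> (\<Sum>k = 1..d. ennreal (a k) * x (t - int k))" and k: "j + 1 \<le> k"
  shows "x k \<le> B * ennreal (exp (- ln (inverse r) * real_of_int (k - j - 1)))"
proof -
  define n where "n = nat (k - j - 1)"
  have n: "k = j + int (Suc n)" "k - j - 1 = int n"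
    using k by (auto simp: n_def)
  have "x k \<le> B * ennreal (r ^ Suc n)"
    unfolding n(1) using assms(1,2) a_nonneg r by (intro recursion_decay) auto
  \<comment> \<open>At distance \<open>k - j = Suc n\<close> the recursion yields
    \<open>r ^ Suc n\<close>; (A2) and (A3) count from \<open>k - j - 1\<close>, so one factor
    \<open>r\<close> is given away.\<close>
  also have "\<dots> \<le> B * ennreal (r ^ n)"
    using r by (intro mult_left_mono ennreal_leI power_decreasing) auto
  finally show ?thesis
    unfolding n(2) using exp_ln_inverse_mult[OF r(1)] by simp
qed

lemma coupling_L_norm_eq:
  assumes "prob_space N" and Y': "Y' \<in> M \<Otimes>\<^sub>M N \<rightarrow>\<^sub>M Rp p"
    and law: "distr (M \<Otimes>\<^sub>M N) (Rp p) Y' = distr M (Rp p) (Y t)"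
    and h: "h \<in> borel_measurable (Rp p)"
  shows "L_norm (M \<Otimes>\<^sub>M N) q (\<lambda>z. h (Y t (fst z))) = L_norm M q (\<lambda>\<omega>. h (Y t \<omega>))"
    and "L_norm (M \<Otimes>\<^sub>M N) q (\<lambda>z. h (Y' z)) = L_norm M q (\<lambda>\<omega>. h (Y t \<omega>))"
proof -
  interpret N: prob_space N by fact
  have "L_norm (distr (M \<Otimes>\<^sub>M N) M fst) q (\<lambda>\<omega>. h (Y t \<omega>)) = L_norm (M \<Otimes>\<^sub>M N) q (\<lambda>z. h (Y t (fst z)))"
    by (intro L_norm_distr measurable_fst measurable_compose[OF Y_measurable h])
  then show "L_norm (M \<Otimes>\<^sub>M N) q (\<lambda>z. h (Y t (fst z))) = L_norm M q (\<lambda>\<omega>. h (Y t \<omega>))"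
    unfolding N.distr_pair_fst[OF sigma_finite_measure_axioms] by simp
  show "L_norm (M \<Otimes>\<^sub>M N) q (\<lambda>z. h (Y' z)) = L_norm M q (\<lambda>\<omega>. h (Y t \<omega>))"
    using L_norm_distr[OF Y' h, of q] L_norm_distr[OF Y_measurable h, of t q] law by simp
qed

lemma assumption_A2:
  assumes \<epsilon>: "0 < \<epsilon>" and \<kappa>1: "kappa1 M p Y \<noteq> 0"
  shows "assumption_A2 M p Y
    (2 * moment_const (1 + \<epsilon>) * (enn2real (kappa_star M p Y) / enn2real (kappa1 M p Y))) (ln (inverse r)) \<epsilon>"
  unfolding assumption_A2_def
proof (intro conjI allI)
  define q where "q = 1 + \<epsilon>"
  have q: "1 \<le> q"
    using \<epsilon> by (simp add: q_def)
  have mc: "0 < moment_const q"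
    by (simp add: moment_const_def add_pos_nonneg)
  have fin: "kappa1 M p Y < \<infinity>" "kappa_star M p Y < \<infinity>"
    using assumption_A1 by (auto simp: assumption_A1_def)
  have "0 < kappa1 M p Y" "0 < kappa_star M p Y"
    using \<kappa>1 kappa1_le_kappa_star by (auto simp: zero_less_iff_neq_zero)
  then have \<kappa>: "0 < enn2real (kappa1 M p Y)" "0 < enn2real (kappa_star M p Y)"
    using fin by (auto simp: enn2real_positive_iff)
  show "0 < 2 * moment_const (1 + \<epsilon>) * (enn2real (kappa_star M p Y) / enn2real (kappa1 M p Y))"
    using mc \<kappa> by (simp add: q_def)
  show "0 < ln (inverse r)"
    using r by (simp add: ln_inverse)
  show "0 < \<epsilon>" by fact
  \<comment> \<open>The factor 2 comes from estimating \<open>Y\<close> and its copy separately,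
    \<open>moment_const q\<close> from passing from the psi2 norm to the L(q) norm.\<close>
  define B where "B = ennreal (2 * moment_const q) * kappa_star M p Y"
  \<comment> \<open>Undoes the division by \<open>kappa1\<close>; \<open>enn2real\<close> loses
    nothing because both suprema are finite.\<close>
  have B: "B = ennreal (2 * moment_const (1 + \<epsilon>) * (enn2real (kappa_star M p Y) / enn2real (kappa1 M p Y))) * kappa1 M p Y"
  proof -
    have "ennreal (2 * moment_const q * (enn2real (kappa_star M p Y) / enn2real (kappa1 M p Y))) * ennreal (enn2real (kappa1 M p Y))
        = ennreal (2 * moment_const q) * ennreal (enn2real (kappa_star M p Y))"
      using mc \<kappa> by (simp flip: ennreal_mult)
    then show ?thesis
      using fin by (simp add: B_def q_def)
  qed
  fix j
  obtain N :: "(int \<Rightarrow> nat \<Rightarrow> real) measure" and Y' where copy: "independent_future_copy M p Y j N Y'"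
      and Y': "\<And>t. Y' t \<in> M \<Otimes>\<^sub>M N \<rightarrow>\<^sub>M Rp p"
      and law: "\<And>t. distr (M \<Otimes>\<^sub>M N) (Rp p) (Y' t) = distr M (Rp p) (Y t)"
      and rec: "\<And>t. j < t \<Longrightarrow> AE z in M \<Otimes>\<^sub>M N. \<forall>i<p. Y t (fst z) i - Y' t z i =
        (\<Sum>k = 1..d. mat_app (A k) (\<lambda>l. Y (t - int k) (fst z) l - Y' (t - int k) z l) i)"
    using coupling by blast
  have N: "prob_space N"
    using copy by (simp add: independent_future_copy_def)
  have Yfst: "(\<lambda>z. Y t (fst z)) \<in> M \<Otimes>\<^sub>M N \<rightarrow>\<^sub>M Rp p" for t
    by (rule measurable_compose[OF measurable_fst Y_measurable])
  define D where "D t z = (\<lambda>i. Y t (fst z) i - Y' t z i)" for t z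
  have D: "(\<lambda>z. norm2 p (D t z)) \<in> borel_measurable (M \<Otimes>\<^sub>M N)" for t
    unfolding D_def
    by (intro measurable_norm2 borel_measurable_diff measurable_Rp_component[OF Yfst] measurable_Rp_component[OF Y'])
  have norm2: "norm2 p \<in> borel_measurable (Rp p)"
    by (intro measurable_norm2 measurable_Rp_component[OF measurable_ident_sets]) auto
  define x where "x t = L_norm (M \<Otimes>\<^sub>M N) q (\<lambda>z. norm2 p (D t z))" for t
  have init: "x t \<le> B" for t
  proof -
    have "x t \<le> L_norm (M \<Otimes>\<^sub>M N) q (\<lambda>z. norm2 p (Y t (fst z)) + norm2 p (Y' t z))"
      unfolding x_def
      by (intro L_norm_mono[OF q] D borel_measurable_add measurable_compose[OF Yfst norm2] measurable_compose[OF Y' norm2])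
        (simp add: D_def norm2_diff_le L2_set_nonneg)
    also have "\<dots> \<le> L_norm (M \<Otimes>\<^sub>M N) q (\<lambda>z. norm2 p (Y t (fst z))) + L_norm (M \<Otimes>\<^sub>M N) q (\<lambda>z. norm2 p (Y' t z))"
      by (intro L_norm_add[OF q] measurable_compose[OF Yfst norm2] measurable_compose[OF Y' norm2])
    also have "\<dots> = L_norm M q (\<lambda>\<omega>. norm2 p (Y t \<omega>)) + L_norm M q (\<lambda>\<omega>. norm2 p (Y t \<omega>))"
      using coupling_L_norm_eq[OF N Y' law norm2] by simp
    also have "\<dots> \<le> ennreal (moment_const q) * kappa_star M p Y + ennreal (moment_const q) * kappa_star M p Y"
    proof -
      have "L_norm M q (\<lambda>\<omega>. norm2 p (Y t \<omega>)) \<le> ennreal (moment_const q) * psi2_norm M (\<lambda>\<omega>. norm2 p (Y t \<omega>))"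
        by (intro L_norm_le_psi2_norm[OF q] measurable_compose[OF Y_measurable norm2])
      also have "\<dots> \<le> ennreal (moment_const q) * kappa_star M p Y"
        by (intro mult_left_mono psi2_norm_le_kappa_star) simp
      finally show ?thesis
        by (intro add_mono)
    qed
    also have "\<dots> = B"
      using less_imp_le[OF mc] by (simp only: B_def mult_2 ennreal_plus distrib_right)
    finally show ?thesis .
  qed
  have step: "x t \<le> (\<Sum>k = 1..d. ennreal (a k) * x (t - int k))" if t: "j < t" for t
  proof -
    have "x t \<le> L_norm (M \<Otimes>\<^sub>M N) q (\<lambda>z. \<Sum>k = 1..d. a k * norm2 p (D (t - int k) z))"
      unfolding x_def
    proof (rule L_norm_mono[OF q])
      show "AE z in M \<Otimes>\<^sub>M N. \<bar>norm2 p (D t z)\<bar> \<le> \<bar>\<Sum>k = 1..d. a k * norm2 p (D (t - int k) z)\<bar>"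
        using rec[OF t]
      proof eventually_elim
        case (elim z)
        have "norm2 p (D t z) = norm2 p (\<lambda>i. \<Sum>k = 1..d. mat_app (A k) (D (t - int k) z) i)"
          using elim by (intro norm2_cong) (simp add: D_def)
        also have "\<dots> \<le> (\<Sum>k = 1..d. norm2 p (mat_app (A k) (D (t - int k) z)))"
          by (rule norm2_sum_le) simp
        also have "\<dots> \<le> (\<Sum>k = 1..d. a k * norm2 p (D (t - int k) z))"
        proof (rule sum_mono)
          fix k assume k: "k \<in> {1..d}"
          show "norm2 p (mat_app (A k) (D (t - int k) z)) \<le> a k * norm2 p (D (t - int k) z)"
            using op_leD[OF op_le_A[OF k], of "D (t - int k) z"] A_carrier[OF k] by auto
        qed
        finally show ?case
          by (simp add: L2_set_nonneg)
      qed
    qed (intro borel_measurable_sum borel_measurable_times borel_measurable_const D)+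
    also have "\<dots> \<le> (\<Sum>k = 1..d. L_norm (M \<Otimes>\<^sub>M N) q (\<lambda>z. a k * norm2 p (D (t - int k) z)))"
      by (intro L_norm_sum[OF q] borel_measurable_times borel_measurable_const D) auto
    also have "\<dots> \<le> (\<Sum>k = 1..d. ennreal (a k) * x (t - int k))"
    proof (rule sum_mono)
      fix k assume k: "k \<in> {1..d}"
      show "L_norm (M \<Otimes>\<^sub>M N) q (\<lambda>z. a k * norm2 p (D (t - int k) z)) \<le> ennreal (a k) * x (t - int k)"
        using L_norm_cmult[OF q D, of "a k" "t - int k"] a_nonneg[OF k] by (simp add: x_def)
    qed
    finally show ?thesis .
  qed
  show "\<exists>(N :: (int \<Rightarrow> nat \<Rightarrow> real) measure) Y'. independent_future_copy M p Y j N Y' \<and>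
      (\<forall>k\<ge>j + 1. L_norm (M \<Otimes>\<^sub>M N) (1 + \<epsilon>) (\<lambda>\<omega>. norm2 p (\<lambda>i. Y k (fst \<omega>) i - Y' k \<omega> i))
        \<le> ennreal (2 * moment_const (1 + \<epsilon>) * (enn2real (kappa_star M p Y) / enn2real (kappa1 M p Y))) *
          kappa1 M p Y * ennreal (exp (- ln (inverse r) * real_of_int (k - j - 1))))"
  proof (intro exI conjI allI impI)
    show "independent_future_copy M p Y j N Y'" by (rule copy)
    fix k assume "j + 1 \<le> k"
    from decay_bound[OF init step this]
    show "L_norm (M \<Otimes>\<^sub>M N) (1 + \<epsilon>) (\<lambda>\<omega>. norm2 p (\<lambda>i. Y k (fst \<omega>) i - Y' k \<omega> i))
        \<le> ennreal (2 * moment_const (1 + \<epsilon>) * (enn2real (kappa_star M p Y) / enn2real (kappa1 M p Y))) *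
          kappa1 M p Y * ennreal (exp (- ln (inverse r) * real_of_int (k - j - 1)))"
      unfolding B by (simp add: x_def D_def q_def)
  qed
qed

lemma assumption_A3:
  assumes \<epsilon>: "0 < \<epsilon>" and d: "1 \<le> d"
  shows "assumption_A3 M p Y (2 * moment_const (1 + \<epsilon>) * real d) (ln (inverse r)) \<epsilon>"
  unfolding assumption_A3_def
proof (intro conjI allI)
  define q where "q = 1 + \<epsilon>"
  have q: "1 \<le> q"
    using \<epsilon> by (simp add: q_def)
  have mc: "0 < moment_const q"
    by (simp add: moment_const_def add_pos_nonneg)
  show "0 < 2 * moment_const (1 + \<epsilon>) * real d"
    using mc d by (simp add: q_def)
  show "0 < ln (inverse r)"
    using r by (simp add: ln_inverse)
  show "0 < \<epsilon>" by fact
  define B where "B = ennreal (2 * moment_const q) * kappa1 M p Y"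
  \<comment> \<open>The error recursion starts from \<open>B\<close>, which lies below the claimed
    constant because \<open>d \<ge> 1\<close>.\<close>
  have B: "B \<le> ennreal (2 * moment_const (1 + \<epsilon>) * real d) * kappa1 M p Y"
    unfolding B_def q_def[symmetric] using mc d
    by (intro mult_right_mono ennreal_leI) (auto simp: mult_le_cancel_left1)
  fix j
  obtain N :: "(int \<Rightarrow> nat \<Rightarrow> real) measure" and Y' where copy: "independent_future_copy M p Y j N Y'"
      and Y': "\<And>t. Y' t \<in> M \<Otimes>\<^sub>M N \<rightarrow>\<^sub>M Rp p"
      and law: "\<And>t. distr (M \<Otimes>\<^sub>M N) (Rp p) (Y' t) = distr M (Rp p) (Y t)"
      and rec: "\<And>t. j < t \<Longrightarrow> AE z in M \<Otimes>\<^sub>M N. \<forall>i<p. Y t (fst z) i - Y' t z i =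
        (\<Sum>k = 1..d. mat_app (A k) (\<lambda>l. Y (t - int k) (fst z) l - Y' (t - int k) z l) i)"
    using coupling by blast
  have N: "prob_space N"
    using copy by (simp add: independent_future_copy_def)
  have Yfst: "(\<lambda>z. Y t (fst z)) \<in> M \<Otimes>\<^sub>M N \<rightarrow>\<^sub>M Rp p" for t
    by (rule measurable_compose[OF measurable_fst Y_measurable])
  define D where "D t z = (\<lambda>i. Y t (fst z) i - Y' t z i)" for t z
  have dotp_D: "dotp p (D t z) u = dotp p u (Y t (fst z)) + - 1 * dotp p u (Y' t z)" for t z u
    by (simp add: D_def dotp_def algebra_simps sum_subtractf)
  have D: "(\<lambda>z. dotp p (D t z) u) \<in> borel_measurable (M \<Otimes>\<^sub>M N)" for t u
    unfolding dotp_D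
    by (intro borel_measurable_add borel_measurable_times borel_measurable_const measurable_dotp Yfst Y')
  have dotp: "dotp p u \<in> borel_measurable (Rp p)" for u
    by (intro measurable_dotp[where X = "\<lambda>x. x"]) simp
  \<comment> \<open>Each step applies the transposes to the direction, so a single direction does
    not close the recursion; the supremum over all of them does.\<close>
  define x where "x t = (SUP u\<in>unit_sphere p. L_norm (M \<Otimes>\<^sub>M N) q (\<lambda>z. dotp p (D t z) u))" for t
  have init: "x t \<le> B" for t
    unfolding x_def
  proof (rule SUP_least)
    fix u assume u: "u \<in> unit_sphere p"
    have "L_norm (M \<Otimes>\<^sub>M N) q (\<lambda>z. dotp p (D t z) u) \<le> L_norm (M \<Otimes>\<^sub>M N) q (\<lambda>z. dotp p u (Y t (fst z)))
        + L_norm (M \<Otimes>\<^sub>M N) q (\<lambda>z. - 1 * dotp p u (Y' t z))"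
      unfolding dotp_D
      by (intro L_norm_add[OF q] borel_measurable_times borel_measurable_const measurable_dotp Yfst Y')
    also have "\<dots> \<le> L_norm (M \<Otimes>\<^sub>M N) q (\<lambda>z. dotp p u (Y t (fst z)))
        + ennreal \<bar>- 1\<bar> * L_norm (M \<Otimes>\<^sub>M N) q (\<lambda>z. dotp p u (Y' t z))"
      by (intro add_left_mono L_norm_cmult[OF q] measurable_dotp Y')
    also have "\<dots> = L_norm M q (\<lambda>\<omega>. dotp p u (Y t \<omega>)) + L_norm M q (\<lambda>\<omega>. dotp p u (Y t \<omega>))"
      using coupling_L_norm_eq[OF N Y' law dotp] by simp
    also have "\<dots> \<le> ennreal (moment_const q) * kappa1 M p Y + ennreal (moment_const q) * kappa1 M p Y"
    proof -
      have "L_norm M q (\<lambda>\<omega>. dotp p u (Y t \<omega>)) \<le> ennreal (moment_const q) * psi2_norm M (\<lambda>\<omega>. dotp p u (Y t \<omega>))"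
        by (intro L_norm_le_psi2_norm[OF q] measurable_dotp Y_measurable)
      also have "\<dots> \<le> ennreal (moment_const q) * kappa1 M p Y"
        by (intro mult_left_mono psi2_norm_le_kappa1 u) simp
      finally show ?thesis
        by (intro add_mono)
    qed
    also have "\<dots> = B"
      using less_imp_le[OF mc] by (simp only: B_def mult_2 ennreal_plus distrib_right)
    finally show "L_norm (M \<Otimes>\<^sub>M N) q (\<lambda>z. dotp p (D t z) u) \<le> B" .
  qed
  have step: "x t \<le> (\<Sum>k = 1..d. ennreal (a k) * x (t - int k))" if t: "j < t" for t
    unfolding x_def[of t]
  proof (rule SUP_least)
    fix u assume u: "u \<in> unit_sphere p"
    define w where "w k = mat_app (transpose_mat (A k)) u" for k
    have "L_norm (M \<Otimes>\<^sub>M N) q (\<lambda>z. dotp p (D t z) u) \<le>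
        L_norm (M \<Otimes>\<^sub>M N) q (\<lambda>z. \<Sum>k = 1..d. dotp p (D (t - int k) z) (w k))"
    proof (rule L_norm_mono[OF q])
      show "AE z in M \<Otimes>\<^sub>M N. \<bar>dotp p (D t z) u\<bar> \<le> \<bar>\<Sum>k = 1..d. dotp p (D (t - int k) z) (w k)\<bar>"
        using rec[OF t]
      proof eventually_elim
        case (elim z)
        have "dotp p (D t z) u = dotp p u (\<lambda>i. \<Sum>k = 1..d. mat_app (A k) (D (t - int k) z) i)"
          unfolding dotp_commute[of p _ u] using elim by (intro dotp_cong) (simp_all add: D_def)
        also have "\<dots> = (\<Sum>k = 1..d. dotp p u (mat_app (A k) (D (t - int k) z)))"
          by (simp add: dotp_def sum_distrib_left) (rule sum.swap)
        also have "\<dots> = (\<Sum>k = 1..d. dotp p (D (t - int k) z) (w k))"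
        proof (rule sum.cong[OF refl])
          fix k assume k: "k \<in> {1..d}"
          show "dotp p u (mat_app (A k) (D (t - int k) z)) = dotp p (D (t - int k) z) (w k)"
            using dotp_mat_app[of "A k" u "D (t - int k) z"] A_carrier[OF k]
            by (auto simp: w_def dotp_commute[of p "D (t - int k) z"])
        qed
        finally show ?case
          by simp
      qed
    qed (intro borel_measurable_sum D)+
    also have "\<dots> \<le> (\<Sum>k = 1..d. L_norm (M \<Otimes>\<^sub>M N) q (\<lambda>z. dotp p (D (t - int k) z) (w k)))"
      by (intro L_norm_sum[OF q] D) auto
    also have "\<dots> \<le> (\<Sum>k = 1..d. ennreal (a k) * x (t - int k))"
    proof (rule sum_mono)
      fix k assume k: "k \<in> {1..d}"
      have "L_norm (M \<Otimes>\<^sub>M N) q (\<lambda>z. dotp p (D (t - int k) z) (w k)) \<le> ennreal (norm2 p (w k)) * x (t - int k)"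
        unfolding x_def by (rule L_norm_dotp_le[OF q D])
      also have "\<dots> \<le> ennreal (a k) * x (t - int k)"
        using norm2_A_transpose_le[OF k, of u] u
        by (intro mult_right_mono ennreal_leI) (auto simp: w_def unit_sphere_def)
      finally show "L_norm (M \<Otimes>\<^sub>M N) q (\<lambda>z. dotp p (D (t - int k) z) (w k)) \<le> ennreal (a k) * x (t - int k)" .
    qed
    finally show "L_norm (M \<Otimes>\<^sub>M N) q (\<lambda>z. dotp p (D t z) u) \<le> (\<Sum>k = 1..d. ennreal (a k) * x (t - int k))" .
  qed
  show "\<exists>(N :: (int \<Rightarrow> nat \<Rightarrow> real) measure) Y'. independent_future_copy M p Y j N Y' \<and>
      (\<forall>k\<ge>j + 1. (SUP u\<in>unit_sphere p.
          L_norm (M \<Otimes>\<^sub>M N) (1 + \<epsilon>) (\<lambda>\<omega>. dotp p (\<lambda>i. Y k (fst \<omega>) i - Y' k \<omega> i) u))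
        \<le> ennreal (2 * moment_const (1 + \<epsilon>) * real d) * kappa1 M p Y *
          ennreal (exp (- ln (inverse r) * real_of_int (k - j - 1))))"
  proof (intro exI conjI allI impI)
    show "independent_future_copy M p Y j N Y'" by (rule copy)
    fix k assume "j + 1 \<le> k"
    from decay_bound[OF init step this]
    have "x k \<le> B * ennreal (exp (- ln (inverse r) * real_of_int (k - j - 1)))" .
    also have "\<dots> \<le> ennreal (2 * moment_const (1 + \<epsilon>) * real d) * kappa1 M p Y *
          ennreal (exp (- ln (inverse r) * real_of_int (k - j - 1)))"
      by (intro mult_right_mono B) simp
    finally show "(SUP u\<in>unit_sphere p.
          L_norm (M \<Otimes>\<^sub>M N) (1 + \<epsilon>) (\<lambda>\<omega>. dotp p (\<lambda>i. Y k (fst \<omega>) i - Y' k \<omega> i) u))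
        \<le> ennreal (2 * moment_const (1 + \<epsilon>) * real d) * kappa1 M p Y *
          ennreal (exp (- ln (inverse r) * real_of_int (k - j - 1)))"
      by (simp add: x_def D_def q_def)
  qed
qed

end

lemma var_modelI:
  assumes d: "d \<ge> 1" and a: "\<And>k. k \<in> {1..d} \<Longrightarrow> 0 \<le> a k" "(\<Sum>k = 1..d. a k) < 1"
    and r: "rho (A_bar d a) < r" "r < 1"
    and "prob_space M" "\<And>k. k \<in> {1..d} \<Longrightarrow> A k \<in> carrier_mat p p"
    "\<And>k. k \<in> {1..d} \<Longrightarrow> spectral_norm (A k) \<le> a k"
    "prob_space.indep_vars M (\<lambda>_. Rp p) E UNIV" "0 < D1"
    "(SUP t. SUP u\<in>unit_sphere p. psi2_norm M (\<lambda>\<omega>. dotp p u (E t \<omega>))) < ennreal D1"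
    "stable_VAR M p d A E Y"
  shows "var_model M p d a A E Y D1 r"
proof -
  have "0 < r"
    using rho_A_bar_nonneg[OF d, of a] r by simp
  then show ?thesis
    using assms sum_le_1_of_rho_less[OF d a r]
    by (intro var_model.intro var_model_axioms.intro) auto
qed

theorem theorem3p1:
  shows "\<exists>(C :: real \<Rightarrow> real) (C' :: real \<Rightarrow> real) (K :: real \<Rightarrow> nat).
    (\<forall>\<epsilon>>0. C \<epsilon> > 0 \<and> C' \<epsilon> > 0) \<and>
    (\<forall>(d :: nat) (a :: nat \<Rightarrow> real) (c' :: real) (D1 :: real).
       d \<ge> 1 \<and> (\<forall>k\<in>{1..d}. 0 \<le> a k \<and> a k < 1) \<and> (\<Sum>k = 1..d. a k) < 1 \<and> c' > 0 \<and> D1 > 0 \<longrightarrow>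
       rho (A_bar d a) < 1 \<and>
       (\<exists>c>0. \<forall>(p :: nat) (M :: 'w measure) (A :: nat \<Rightarrow> real mat)
            (E :: int \<Rightarrow> 'w \<Rightarrow> nat \<Rightarrow> real) (Y :: int \<Rightarrow> 'w \<Rightarrow> nat \<Rightarrow> real).
          p \<ge> 1 \<and> prob_space M \<and>
          (\<forall>k\<in>{1..d}. A k \<in> carrier_mat p p \<and> spectral_norm (A k) \<le> a k) \<and>
          prob_space.indep_vars M (\<lambda>_. Rp p) E UNIV \<and>
          (\<forall>t u. psi2_norm M (\<lambda>\<omega>. dotp p u (E t \<omega>))
                   \<le> ennreal c' * L_norm M 2 (\<lambda>\<omega>. dotp p u (E t \<omega>))) \<and>
          (SUP t. SUP u\<in>unit_sphere p. psi2_norm M (\<lambda>\<omega>. dotp p u (E t \<omega>))) < ennreal D1 \<and>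
          stable_VAR M p d A E Y \<longrightarrow>
          assumption_A1 M p Y \<and>
          (\<forall>\<rho>1 \<epsilon>. rho (A_bar d a) < \<rho>1 \<and> \<rho>1 < 1 \<and> \<epsilon> > 0 \<longrightarrow>
             (kappa1 M p Y \<noteq> 0 \<longrightarrow>
                assumption_A2 M p Y
                  (C \<epsilon> * (enn2real (kappa_star M p Y) / enn2real (kappa1 M p Y))
                     * (spectral_norm (A_bar d a) / \<rho>1) ^ K \<rho>1)
                  (ln (inverse \<rho>1)) \<epsilon>) \<and>
             assumption_A3 M p Y
               (C' \<epsilon> * real d * (spectral_norm (A_bar d a) / \<rho>1) ^ K \<rho>1)
               (ln (inverse \<rho>1)) \<epsilon>) \<and>
          (mean_zero M p Y \<longrightarrow> assumption_A4 M p Y c)))"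
proof (rule exI[of _ "\<lambda>\<epsilon>. 2 * moment_const (1 + \<epsilon>)"], rule exI[of _ "\<lambda>\<epsilon>. 2 * moment_const (1 + \<epsilon>)"],
    rule exI[of _ "\<lambda>_. 0"], intro conjI allI impI)
  show "0 < 2 * moment_const (1 + \<epsilon>)" "0 < 2 * moment_const (1 + \<epsilon>)" for \<epsilon> :: real
    by (simp_all add: moment_const_def add_pos_nonneg)
next
  fix d :: nat and a :: "nat \<Rightarrow> real" and c' D1 :: real
  assume asm: "d \<ge> 1 \<and> (\<forall>k\<in>{1..d}. 0 \<le> a k \<and> a k < 1) \<and> (\<Sum>k = 1..d. a k) < 1 \<and> c' > 0 \<and> D1 > 0"
  then have d: "d \<ge> 1" and a: "\<And>k. k \<in> {1..d} \<Longrightarrow> 0 \<le> a k" "(\<Sum>k = 1..d. a k) < 1"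
      and c': "0 < c'" and D1: "0 < D1"
    by auto
  show rho: "rho (A_bar d a) < 1"
    using d a by (rule rho_A_bar_less_1)
  \<comment> \<open>(A1) and (A4) do not mention \<open>\<rho>1\<close>; any rate between the
    spectral radius and 1 serves for them.\<close>
  then obtain r0 where r0: "rho (A_bar d a) < r0" "r0 < 1"
    using dense by blast
  let ?C = "\<lambda>\<epsilon>. 2 * moment_const (1 + \<epsilon>)"
  have main: "assumption_A1 M p Y \<and>
          (\<forall>\<rho>1 \<epsilon>. rho (A_bar d a) < \<rho>1 \<and> \<rho>1 < 1 \<and> \<epsilon> > 0 \<longrightarrow>
             (kappa1 M p Y \<noteq> 0 \<longrightarrow>
                assumption_A2 M p Y
                  (?C \<epsilon> * (enn2real (kappa_star M p Y) / enn2real (kappa1 M p Y))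
                     * (spectral_norm (A_bar d a) / \<rho>1) ^ 0)
                  (ln (inverse \<rho>1)) \<epsilon>) \<and>
             assumption_A3 M p Y (?C \<epsilon> * real d * (spectral_norm (A_bar d a) / \<rho>1) ^ 0) (ln (inverse \<rho>1)) \<epsilon>) \<and>
          (mean_zero M p Y \<longrightarrow> assumption_A4 M p Y (16 / 3 * c'\<^sup>2))"
    if hyp: "p \<ge> 1 \<and> prob_space M \<and>
          (\<forall>k\<in>{1..d}. A k \<in> carrier_mat p p \<and> spectral_norm (A k) \<le> a k) \<and>
          prob_space.indep_vars M (\<lambda>_. Rp p) E UNIV \<and>
          (\<forall>t u. psi2_norm M (\<lambda>\<omega>. dotp p u (E t \<omega>)) \<le> ennreal c' * L_norm M 2 (\<lambda>\<omega>. dotp p u (E t \<omega>))) \<and>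
          (SUP t. SUP u\<in>unit_sphere p. psi2_norm M (\<lambda>\<omega>. dotp p u (E t \<omega>))) < ennreal D1 \<and>
          stable_VAR M p d A E Y"
    for p and M :: "'w measure" and A E Y
  proof -
    have model: "var_model M p d a A E Y D1 r" if "rho (A_bar d a) < r" "r < 1" for r
      using hyp by (intro var_modelI d a that D1) auto
    have "(kappa1 M p Y \<noteq> 0 \<longrightarrow>
          assumption_A2 M p Y
            (?C \<epsilon> * (enn2real (kappa_star M p Y) / enn2real (kappa1 M p Y))
               * (spectral_norm (A_bar d a) / \<rho>1) ^ 0)
            (ln (inverse \<rho>1)) \<epsilon>) \<and>
        assumption_A3 M p Y (?C \<epsilon> * real d * (spectral_norm (A_bar d a) / \<rho>1) ^ 0) (ln (inverse \<rho>1)) \<epsilon>"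
      if "rho (A_bar d a) < \<rho>1" "\<rho>1 < 1" "\<epsilon> > 0" for \<rho>1 \<epsilon>
      using var_model.assumption_A2[OF model[OF that(1,2)] that(3)]
        var_model.assumption_A3[OF model[OF that(1,2)] that(3) d]
      by (simp only: power_0 mult_1_right) blast
    moreover have "mean_zero M p Y \<longrightarrow> assumption_A4 M p Y (16 / 3 * c'\<^sup>2)"
      using var_model.assumption_A4[OF model[OF r0] _ c'] hyp by blast
    ultimately show ?thesis
      using var_model.assumption_A1[OF model[OF r0]] by blast
  qed
  show "\<exists>c>0. \<forall>(p :: nat) (M :: 'w measure) (A :: nat \<Rightarrow> real mat)
            (E :: int \<Rightarrow> 'w \<Rightarrow> nat \<Rightarrow> real) (Y :: int \<Rightarrow> 'w \<Rightarrow> nat \<Rightarrow> real).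
          p \<ge> 1 \<and> prob_space M \<and>
          (\<forall>k\<in>{1..d}. A k \<in> carrier_mat p p \<and> spectral_norm (A k) \<le> a k) \<and>
          prob_space.indep_vars M (\<lambda>_. Rp p) E UNIV \<and>
          (\<forall>t u. psi2_norm M (\<lambda>\<omega>. dotp p u (E t \<omega>))
                   \<le> ennreal c' * L_norm M 2 (\<lambda>\<omega>. dotp p u (E t \<omega>))) \<and>
          (SUP t. SUP u\<in>unit_sphere p. psi2_norm M (\<lambda>\<omega>. dotp p u (E t \<omega>))) < ennreal D1 \<and>
          stable_VAR M p d A E Y \<longrightarrow>
          assumption_A1 M p Y \<and>
          (\<forall>\<rho>1 \<epsilon>. rho (A_bar d a) < \<rho>1 \<and> \<rho>1 < 1 \<and> \<epsilon> > 0 \<longrightarrow>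
             (kappa1 M p Y \<noteq> 0 \<longrightarrow>
                assumption_A2 M p Y
                  (?C \<epsilon> * (enn2real (kappa_star M p Y) / enn2real (kappa1 M p Y))
                     * (spectral_norm (A_bar d a) / \<rho>1) ^ 0)
                  (ln (inverse \<rho>1)) \<epsilon>) \<and>
             assumption_A3 M p Y
               (?C \<epsilon> * real d * (spectral_norm (A_bar d a) / \<rho>1) ^ 0)
               (ln (inverse \<rho>1)) \<epsilon>) \<and>
          (mean_zero M p Y \<longrightarrow> assumption_A4 M p Y c)"
    \<comment> \<open>The constant of (A4) depends on \<open>c'\<close> alone and is chosen before
      the dimension.\<close>
    by (rule exI[of _ "16 / 3 * c'\<^sup>2"], rule conjI) (use c' in simp, intro allI impI, rule main)
qed

end
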